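(* Let $(R,\mathfrak m,k)$ be a commutative noetherian local ring. Let $\Gamma$ be a semiperfect, module-finite and elementary $R$-algebra. Then there exist a finite quiver $Q$ and a two-sided ideal $I\triangleleft RQ$ that is permissible, arrow-radical and arrow-distinct such that $\Gamma\cong RQ/I$ as $R$-algebras.
   Context: Rings are unital and associative; $k=R/\mathfrak m$. Rings: let $\Gamma$ be a ring with Jacobson radical $\mathcal J$. $\Gamma$ is semiperfect if $\Gamma/\mathcal J$ is semisimple artinian and every idempotent of $\Gamma/\mathcal J$ lifts to an idempotent of $\Gamma$. A semiperfect ring $\Gamma$ is basic if $\Gamma/\mathcal J$ is a product of division rings. An $R$-algebra is module-finite if it is finitely generated as an $R$-module. A semiperfect, basic, module-finite $R$-algebra $\Gamma$ is elementary if $\Gamma/\mathcal J$ is isomorphic (as an $R$-algebra) to a product of copies of $k$. Quivers: a quiver $Q=(Q_0,Q_1,h,t)$ has vertices $Q_0$, arrows $Q_1$, and head and tail maps $h,t:Q_1\to Q_0$; it is finite if $Q_0,Q_1$ are finite. Each vertex $v$ has a trivial path $e_v$ (length $0$, head and tail $v$); a path of length $n\ge 1$ is $a_n\cdots a_1$ with arrows satisfying $t(a_{i+1})=h(a_i)$; its head is $h(a_n)$ and its tail is $t(a_1)$. The path algebra $RQ$ is the free $R$-module on the paths, with product of paths $pq$ the composition if $t(p)=h(q)$ and $0$ otherwise. Let $I\triangleleft RQ$ be a two-sided ideal and $\Lambda=RQ/I$; elements of $RQ$ are identified with their cosets when they act on $\Lambda$ (e.g. $\Lambda a=\Lambda (a+I)$).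 For a module $M$, $\mathrm{rad}(M)$ is its Jacobson radical; $M$ is local if it has a unique maximal submodule (then equal to $\mathrm{rad}(M)$). - $I$ is permissible if $a\notin I$ for every arrow $a$. - $I$ is arrow-radical if for every vertex $v$: (i) the left module $\Lambda e_v$ is local with $\mathrm{rad}(\Lambda e_v)=\sum_{t(a)=v}\Lambda a$; and (ii) the right module $e_v\Lambda$ is local with $\mathrm{rad}(e_v\Lambda)=\sum_{h(a)=v}a\Lambda$ (sums over arrows $a$). - $I$ is arrow-distinct if for every arrow $a$: (iii) $\Lambda a\cap\sum\Lambda b\subseteq\mathrm{rad}(\Lambda a)$, the sum over arrows $b\ne a$ with $t(b)=t(a)$; and (iv) $a\Lambda\cap\sum b\Lambda\subseteq\mathrm{rad}(a\Lambda)$, the sum over arrows $b\neq a$ with $h(b)=h(a)$. *)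

theory Defs
  imports "HOL-Algebra.Algebra" "Graph_Theory.Arc_Walk"
begin

section \<open>Associative algebras\<close>

text \<open>The library's \<^locale>\<open>algebra\<close> requires the algebra to be commutative; here it is
  only a unital associative ring on which \<open>R\<close> acts centrally.\<close>

locale assoc_algebra = module R M + ring M for R (structure) and M (structure) +
  assumes smult_mult_left:
      "\<lbrakk>r \<in> carrier R; x \<in> carrier M; y \<in> carrier M\<rbrakk>
        \<Longrightarrow> (r \<odot>\<^bsub>M\<^esub> x) \<otimes>\<^bsub>M\<^esub> y = r \<odot>\<^bsub>M\<^esub> (x \<otimes>\<^bsub>M\<^esub> y)"
    and smult_mult_right:
      "\<lbrakk>r \<in> carrier R; x \<in> carrier M; y \<in> carrier M\<rbrakk>
        \<Longrightarrow> x \<otimes>\<^bsub>M\<^esub> (r \<odot>\<^bsub>M\<^esub> y) = r \<odot>\<^bsub>M\<^esub> (x \<otimes>\<^bsub>M\<^esub> y)"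

definition algebra_isomorphic ::
    "('r, 'm) ring_scheme \<Rightarrow> ('r, 'a, 'n) module_scheme \<Rightarrow> ('r, 'b, 'p) module_scheme \<Rightarrow> bool" where
  "algebra_isomorphic R A B \<longleftrightarrow>
    (\<exists>h \<in> ring_iso A B. \<forall>r \<in> carrier R. \<forall>x \<in> carrier A. h (r \<odot>\<^bsub>A\<^esub> x) = r \<odot>\<^bsub>B\<^esub> h x)"

text \<open>The ring \<open>A Quot I\<close> with the scalar action \<open>r \<odot> (I + x) = I + r \<odot> x\<close>, written on cosets
  in the same way as the library's \<^const>\<open>rcoset_mult\<close>.\<close>

definition quot_algebra :: "('r, 'a, 'n) module_scheme \<Rightarrow> 'a set \<Rightarrow> ('r, 'a set) module" where
  "quot_algebra A I =
    ring.extend (A Quot I) (module.fields (\<lambda>r C. (\<Union>x\<in>C. I +>\<^bsub>A\<^esub> (r \<odot>\<^bsub>A\<^esub> x))))"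

definition module_finite :: "('r, 'm) ring_scheme \<Rightarrow> ('r, 'a, 'n) module_scheme \<Rightarrow> bool" where
  "module_finite R A \<longleftrightarrow>
    (\<exists>S \<subseteq> carrier A. finite S \<and>
      (\<forall>x \<in> carrier A. \<exists>c \<in> S \<rightarrow> carrier R. x = (\<Oplus>\<^bsub>A\<^esub>s\<in>S. c s \<odot>\<^bsub>A\<^esub> s)))"

definition local_ring :: "('r, 'm) ring_scheme \<Rightarrow> 'r set \<Rightarrow> bool" where
  "local_ring R \<mm> \<longleftrightarrow> cring R \<and> maximalideal \<mm> R \<and> (\<forall>J. maximalideal J R \<longrightarrow> J = \<mm>)"

text \<open>The residue field \<open>R Quot \<mm>\<close>, with \<open>R\<close> acting through the residue map.\<close>

definition residue_algebra :: "('r, 'm) ring_scheme \<Rightarrow> 'r set \<Rightarrow> ('r, 'r set) module" where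
  "residue_algebra R \<mm> =
    ring.extend (R Quot \<mm>) (module.fields (\<lambda>r C. (\<mm> +>\<^bsub>R\<^esub> r) \<otimes>\<^bsub>R Quot \<mm>\<^esub> C))"

definition product_ring :: "'i set \<Rightarrow> ('i \<Rightarrow> ('a, 'm) ring_scheme) \<Rightarrow> ('i \<Rightarrow> 'a) ring" where
  "product_ring T D =
    \<lparr>carrier = (\<Pi>\<^sub>E i\<in>T. carrier (D i)),
     monoid.mult = (\<lambda>f g. \<lambda>i\<in>T. f i \<otimes>\<^bsub>D i\<^esub> g i),
     one = (\<lambda>i\<in>T. \<one>\<^bsub>D i\<^esub>),
     ring.zero = (\<lambda>i\<in>T. \<zero>\<^bsub>D i\<^esub>),
     add = (\<lambda>f g. \<lambda>i\<in>T. f i \<oplus>\<^bsub>D i\<^esub> g i)\<rparr>"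

definition product_algebra ::
    "'i set \<Rightarrow> ('i \<Rightarrow> ('r, 'a, 'n) module_scheme) \<Rightarrow> ('r, 'i \<Rightarrow> 'a) module" where
  "product_algebra T A =
    ring.extend (product_ring T A) (module.fields (\<lambda>r f. \<lambda>i\<in>T. r \<odot>\<^bsub>A i\<^esub> f i))"


section \<open>One-sided ideals and radicals\<close>

definition left_ideal :: "('a, 'm) ring_scheme \<Rightarrow> 'a set \<Rightarrow> bool" where
  "left_ideal A L \<longleftrightarrow> additive_subgroup L A \<and> (\<forall>x \<in> carrier A. \<forall>y \<in> L. x \<otimes>\<^bsub>A\<^esub> y \<in> L)"

definition right_ideal :: "('a, 'm) ring_scheme \<Rightarrow> 'a set \<Rightarrow> bool" where
  "right_ideal A L \<longleftrightarrow> additive_subgroup L A \<and> (\<forall>x \<in> carrier A. \<forall>y \<in> L. y \<otimes>\<^bsub>A\<^esub> x \<in> L)"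

text \<open>All modules that occur are left (or right) ideals \<open>M\<close> of a ring \<open>A\<close>, whose submodules are
  the left (right) ideals of \<open>A\<close> contained in \<open>M\<close>. The parameter \<open>S\<close> below is instantiated to
  \<open>left_ideal A\<close> or \<open>right_ideal A\<close>.\<close>

definition maximal_submodule :: "('a set \<Rightarrow> bool) \<Rightarrow> 'a set \<Rightarrow> 'a set \<Rightarrow> bool" where
  "maximal_submodule S M N \<longleftrightarrow>
    S N \<and> N \<subset> M \<and> (\<forall>L. S L \<and> N \<subseteq> L \<and> L \<subseteq> M \<longrightarrow> L = N \<or> L = M)"

text \<open>The intersection of all maximal submodules of \<open>M\<close>, which is \<open>M\<close> if there are none.\<close>

definition module_rad :: "('a set \<Rightarrow> bool) \<Rightarrow> 'a set \<Rightarrow> 'a set" where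
  "module_rad S M = {x \<in> M. \<forall>N. maximal_submodule S M N \<longrightarrow> x \<in> N}"

definition local_module :: "('a set \<Rightarrow> bool) \<Rightarrow> 'a set \<Rightarrow> bool" where
  "local_module S M \<longleftrightarrow> (\<exists>!N. maximal_submodule S M N)"

definition jacobson_radical :: "('a, 'm) ring_scheme \<Rightarrow> 'a set" where
  "jacobson_radical A = module_rad (left_ideal A) (carrier A)"

definition principal_left :: "('a, 'm) ring_scheme \<Rightarrow> 'a \<Rightarrow> 'a set" where
  "principal_left A x = (\<lambda>y. y \<otimes>\<^bsub>A\<^esub> x) ` carrier A"

definition principal_right :: "('a, 'm) ring_scheme \<Rightarrow> 'a \<Rightarrow> 'a set" where
  "principal_right A x = (\<lambda>y. x \<otimes>\<^bsub>A\<^esub> y) ` carrier A"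

text \<open>The sum \<open>\<Sum>i\<in>T. N i\<close> of additive subgroups, for a finite index set \<open>T\<close>; it is \<open>{\<zero>}\<close> if
  \<open>T\<close> is empty.\<close>

definition submodule_sum :: "('a, 'm) ring_scheme \<Rightarrow> 'i set \<Rightarrow> ('i \<Rightarrow> 'a set) \<Rightarrow> 'a set" where
  "submodule_sum A T N = {(\<Oplus>\<^bsub>A\<^esub>i\<in>T. f i) |f. f \<in> (\<Pi> i\<in>T. N i)}"


section \<open>Semiperfect, basic and elementary rings\<close>

definition semisimple_ring :: "('a, 'm) ring_scheme \<Rightarrow> bool" where
  "semisimple_ring A \<longleftrightarrow> ring A \<and>
    (\<forall>L. left_ideal A L \<longrightarrow>
      (\<exists>L'. left_ideal A L' \<and> L \<inter> L' = {\<zero>\<^bsub>A\<^esub>} \<and> L <+>\<^bsub>A\<^esub> L' = carrier A))"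

definition artinian_ring :: "('a, 'm) ring_scheme \<Rightarrow> bool" where
  "artinian_ring A \<longleftrightarrow> ring A \<and>
    (\<forall>L :: nat \<Rightarrow> 'a set. (\<forall>n. left_ideal A (L n)) \<and> (\<forall>n. L (Suc n) \<subseteq> L n) \<longrightarrow>
      (\<exists>n. \<forall>m\<ge>n. L m = L n))"

definition semiperfect :: "('a, 'm) ring_scheme \<Rightarrow> bool" where
  "semiperfect A \<longleftrightarrow> ring A \<and>
    (let J = jacobson_radical A; B = A Quot J in
      semisimple_ring B \<and> artinian_ring B \<and>
      (\<forall>e \<in> carrier B. e \<otimes>\<^bsub>B\<^esub> e = e \<longrightarrow>
        (\<exists>f \<in> carrier A. f \<otimes>\<^bsub>A\<^esub> f = f \<and> J +>\<^bsub>A\<^esub> f = e)))"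

definition division_ring :: "('a, 'm) ring_scheme \<Rightarrow> bool" where
  "division_ring D \<longleftrightarrow> ring D \<and> \<one>\<^bsub>D\<^esub> \<noteq> \<zero>\<^bsub>D\<^esub> \<and> Units D = carrier D - {\<zero>\<^bsub>D\<^esub>}"

text \<open>In the next two definitions the index set and the division rings are taken in the type
  \<open>'a set\<close> of the cosets of the radical. This is no restriction: a product of nonzero rings
  contains copies of its factors, and its index set injects into it through the coordinate
  idempotents. The index set is not assumed to be finite.\<close>

definition basic_ring :: "('a, 'm) ring_scheme \<Rightarrow> bool" where
  "basic_ring A \<longleftrightarrow> semiperfect A \<and>
    (\<exists>(T :: 'a set set) (D :: 'a set \<Rightarrow> 'a set ring).
      (\<forall>i \<in> T. division_ring (D i)) \<and> A Quot jacobson_radical A \<simeq> product_ring T D)"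

definition elementary ::
    "('r, 'm) ring_scheme \<Rightarrow> 'r set \<Rightarrow> ('r, 'a, 'n) module_scheme \<Rightarrow> bool" where
  "elementary R \<mm> A \<longleftrightarrow> assoc_algebra R A \<and> semiperfect A \<and> basic_ring A \<and> module_finite R A \<and>
    (\<exists>T :: 'a set set.
      algebra_isomorphic R (quot_algebra A (jacobson_radical A))
        (product_algebra T (\<lambda>_. residue_algebra R \<mm>)))"


section \<open>Path algebras\<close>

text \<open>A quiver is a \<^typ>\<open>('v, 'e) pre_digraph\<close> satisfying \<^locale>\<open>wf_digraph\<close>, and a finite one
  satisfies \<^locale>\<open>fin_digraph\<close>. The path \<open>a\<^sub>n \<cdots> a\<^sub>1\<close> with tail \<open>v\<close> is the pair
  \<open>(v, [a\<^sub>1, \<dots>, a\<^sub>n])\<close>, listing the arrows in the order in which they are traversed; the trivial path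
  at \<open>v\<close> is \<open>(v, [])\<close>.\<close>

type_synonym ('v, 'e) path = "'v \<times> 'e list"

definition paths :: "('v, 'e) pre_digraph \<Rightarrow> ('v, 'e) path set" where
  "paths Q = {(u, p). \<exists>v. pre_digraph.awalk Q u p v}"

definition path_tail :: "('v, 'e) path \<Rightarrow> 'v" where
  "path_tail p = fst p"

definition path_head :: "('v, 'e) pre_digraph \<Rightarrow> ('v, 'e) path \<Rightarrow> 'v" where
  "path_head Q p = last (pre_digraph.awalk_verts Q (fst p) (snd p))"

text \<open>The composition \<open>pq\<close>, first \<open>q\<close> and then \<open>p\<close>, for \<open>path_tail p = path_head Q q\<close>.\<close>

definition path_comp :: "('v, 'e) path \<Rightarrow> ('v, 'e) path \<Rightarrow> ('v, 'e) path" where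
  "path_comp p q = (fst q, snd q @ snd p)"

definition factorizations ::
    "('v, 'e) pre_digraph \<Rightarrow> ('v, 'e) path \<Rightarrow> (('v, 'e) path \<times> ('v, 'e) path) set" where
  "factorizations Q w =
    {(p, q). p \<in> paths Q \<and> q \<in> paths Q \<and> path_tail p = path_head Q q \<and> path_comp p q = w}"

lemma finite_factorizations: "finite (factorizations Q w)"
proof -
  let ?c = "\<lambda>n. ((path_head Q (fst w, take n (snd w)), drop n (snd w)), (fst w, take n (snd w)))"
  have "x \<in> ?c ` {..length (snd w)}" if x: "x \<in> factorizations Q w" for x
  proof -
    obtain u p v q where eq: "x = ((u, p), (v, q))" by (metis surj_pair)
    from x have "x = ?c (length q)" and "length q \<le> length (snd w)"
      unfolding eq by (auto simp: factorizations_def path_comp_def path_tail_def)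
    then show ?thesis by blast
  qed
  then have "factorizations Q w \<subseteq> ?c ` {..length (snd w)}" by blast
  then show ?thesis by (rule finite_subset) simp
qed

text \<open>Elements of the free module on the paths are finitely supported coefficient functions.\<close>

definition path_algebra ::
    "('r, 'm) ring_scheme \<Rightarrow> ('v, 'e) pre_digraph \<Rightarrow> ('r, ('v, 'e) path \<Rightarrow> 'r) module" where
  "path_algebra R Q =
    \<lparr>carrier = {f. (\<forall>p \<in> paths Q. f p \<in> carrier R) \<and> (\<forall>p. p \<notin> paths Q \<longrightarrow> f p = \<zero>\<^bsub>R\<^esub>) \<and>
                  finite {p. f p \<noteq> \<zero>\<^bsub>R\<^esub>}},
     monoid.mult = (\<lambda>f g w. \<Oplus>\<^bsub>R\<^esub>x\<in>factorizations Q w. f (fst x) \<otimes>\<^bsub>R\<^esub> g (snd x)),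
     one = (\<lambda>p. if p \<in> paths Q \<and> snd p = [] then \<one>\<^bsub>R\<^esub> else \<zero>\<^bsub>R\<^esub>),
     ring.zero = (\<lambda>p. \<zero>\<^bsub>R\<^esub>),
     add = (\<lambda>f g p. f p \<oplus>\<^bsub>R\<^esub> g p),
     module.smult = (\<lambda>r f p. r \<otimes>\<^bsub>R\<^esub> f p)\<rparr>"

definition path_basis :: "('r, 'm) ring_scheme \<Rightarrow> ('v, 'e) path \<Rightarrow> ('v, 'e) path \<Rightarrow> 'r" where
  "path_basis R p = (\<lambda>q. if q = p then \<one>\<^bsub>R\<^esub> else \<zero>\<^bsub>R\<^esub>)"

definition vertex_elem :: "('r, 'm) ring_scheme \<Rightarrow> 'v \<Rightarrow> ('v, 'e) path \<Rightarrow> 'r" where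
  "vertex_elem R v = path_basis R (v, [])"

definition arrow_elem ::
    "('r, 'm) ring_scheme \<Rightarrow> ('v, 'e) pre_digraph \<Rightarrow> 'e \<Rightarrow> ('v, 'e) path \<Rightarrow> 'r" where
  "arrow_elem R Q a = path_basis R (tail Q a, [a])"


section \<open>Conditions on ideals of path algebras\<close>

definition permissible ::
    "('r, 'm) ring_scheme \<Rightarrow> ('v, 'e) pre_digraph \<Rightarrow> (('v, 'e) path \<Rightarrow> 'r) set \<Rightarrow> bool" where
  "permissible R Q I \<longleftrightarrow> (\<forall>a \<in> arcs Q. arrow_elem R Q a \<notin> I)"

definition arrow_radical ::
    "('r, 'm) ring_scheme \<Rightarrow> ('v, 'e) pre_digraph \<Rightarrow> (('v, 'e) path \<Rightarrow> 'r) set \<Rightarrow> bool" where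
  "arrow_radical R Q I \<longleftrightarrow>
    (let \<Lambda> = quot_algebra (path_algebra R Q) I;
         e = (\<lambda>v. I +>\<^bsub>path_algebra R Q\<^esub> vertex_elem R v);
         \<alpha> = (\<lambda>a. I +>\<^bsub>path_algebra R Q\<^esub> arrow_elem R Q a)
     in \<forall>v \<in> verts Q.
          local_module (left_ideal \<Lambda>) (principal_left \<Lambda> (e v)) \<and>
          module_rad (left_ideal \<Lambda>) (principal_left \<Lambda> (e v)) =
            submodule_sum \<Lambda> {a \<in> arcs Q. tail Q a = v} (\<lambda>a. principal_left \<Lambda> (\<alpha> a)) \<and>
          local_module (right_ideal \<Lambda>) (principal_right \<Lambda> (e v)) \<and>
          module_rad (right_ideal \<Lambda>) (principal_right \<Lambda> (e v)) =
            submodule_sum \<Lambda> {a \<in> arcs Q. head Q a = v} (\<lambda>a. principal_right \<Lambda> (\<alpha> a)))"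

definition arrow_distinct ::
    "('r, 'm) ring_scheme \<Rightarrow> ('v, 'e) pre_digraph \<Rightarrow> (('v, 'e) path \<Rightarrow> 'r) set \<Rightarrow> bool" where
  "arrow_distinct R Q I \<longleftrightarrow>
    (let \<Lambda> = quot_algebra (path_algebra R Q) I;
         \<alpha> = (\<lambda>a. I +>\<^bsub>path_algebra R Q\<^esub> arrow_elem R Q a)
     in \<forall>a \<in> arcs Q.
          principal_left \<Lambda> (\<alpha> a) \<inter>
            submodule_sum \<Lambda> {b \<in> arcs Q. b \<noteq> a \<and> tail Q b = tail Q a}
              (\<lambda>b. principal_left \<Lambda> (\<alpha> b))
            \<subseteq> module_rad (left_ideal \<Lambda>) (principal_left \<Lambda> (\<alpha> a)) \<and>
          principal_right \<Lambda> (\<alpha> a) \<inter>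
            submodule_sum \<Lambda> {b \<in> arcs Q. b \<noteq> a \<and> head Q b = head Q a}
              (\<lambda>b. principal_right \<Lambda> (\<alpha> b))
            \<subseteq> module_rad (right_ideal \<Lambda>) (principal_right \<Lambda> (\<alpha> a)))"

end

(*
  Lift the coordinate idempotents of \<Gamma>/J, J the Jacobson radical, to orthogonal idempotents e_v with
  sum 1. As \<m> \<Gamma> \<subseteq> J, the residue classes of the e_v span \<Gamma>/J over R. Take for the arrows a
  minimal finite set B of elements e_v g e_w of J with J = \<Sum> R b + J^2; no basis of J/J^2 is needed.
  By Nakayama's lemma B generates J as a left and as a right ideal. A module \<Gamma> y with 0 \<noteq> y = e_v y
  has J y as its largest proper submodule; this gives the arrow-radical condition, and minimality of B
  the arrow-distinct one.
  The image A of the path algebra satisfies \<Gamma> = A + (A \<inter> J) \<Gamma>, and 1 - p is a unit of A for p in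
  A \<inter> J: if y is the inverse in \<Gamma>, the chain A \<subseteq> y A \<subseteq> y^2 A \<subseteq> ... stabilises as \<Gamma> is a noetherian
  R-module. Nakayama's lemma over A gives A = \<Gamma>, so no completeness of R is needed.
  Statements about right ideals are obtained from the opposite ring.
*)
theory Submission
  imports Defs
begin

section \<open>Finitely generated modules over a noetherian ring, and Nakayama's lemma\<close>

section \<open>Submodules and one-sided ideals\<close>

text \<open>Why a nonzero y = e_v y generates a local module: \<Gamma> is spanned over R by J and
  the idempotents, and all idempotents except e_v kill y, so every x y has the form r y + j y with r
  in R and j in J. For r in the maximal ideal this lies in J y; for any other r it generates
  \<Gamma> y, since r is a unit of R and 1 + j' is a unit of \<Gamma> for every j' in J. With y =
  e_v this serves the vertices, with y an arrow the arrow-distinct condition.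

  The obstacle is that J need not be nilpotent: modulo each power of J the paths do exhaust
  \<Gamma>, but passing from there to \<Gamma> itself would require a limit. Nakayama's lemma over
  the image A replaces the limit, at the price that inverses of 1 - p must be found inside A and not
  merely in \<Gamma>. The chain condition on R-submodules of \<Gamma> enters there, and in providing
  finitely many generators of J over R.\<close>

definition (in module) rspan :: "'c set \<Rightarrow> 'c set" where
  "rspan S = \<Inter>{N. submodule N R M \<and> S \<subseteq> N}"

context module
begin

text \<open>Closure under negation is multiplication by the scalar -1.\<close>

lemma submoduleI':
  assumes "N \<subseteq> carrier M" "\<zero>\<^bsub>M\<^esub> \<in> N"
    and "\<And>x y. x \<in> N \<Longrightarrow> y \<in> N \<Longrightarrow> x \<oplus>\<^bsub>M\<^esub> y \<in> N"
    and "\<And>r x. r \<in> carrier R \<Longrightarrow> x \<in> N \<Longrightarrow> r \<odot>\<^bsub>M\<^esub> x \<in> N"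
  shows "submodule N R M"
proof (rule submoduleI[OF assms(1,2)])
  fix x assume x: "x \<in> N"
  then have "(\<ominus> \<one>) \<odot>\<^bsub>M\<^esub> x \<in> N" using assms(4) by simp
  then show "\<ominus>\<^bsub>M\<^esub> x \<in> N" using x assms(1) by (simp add: smult_l_minus subset_iff)
qed (use assms in auto)

lemma submodule_subset: "submodule N R M \<Longrightarrow> N \<subseteq> carrier M"
  by (simp add: submoduleE(1))

lemma submodule_zero: "submodule N R M \<Longrightarrow> \<zero>\<^bsub>M\<^esub> \<in> N"
  by (metis submodule.axioms(1) subgroup.one_closed monoid.select_convs(2))

lemma submodule_add: "submodule N R M \<Longrightarrow> x \<in> N \<Longrightarrow> y \<in> N \<Longrightarrow> x \<oplus>\<^bsub>M\<^esub> y \<in> N"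
  by (simp add: submoduleE(5))

lemma submodule_smult: "submodule N R M \<Longrightarrow> r \<in> carrier R \<Longrightarrow> x \<in> N \<Longrightarrow> r \<odot>\<^bsub>M\<^esub> x \<in> N"
  by (simp add: submoduleE(4))

lemma submodule_minus: "submodule N R M \<Longrightarrow> x \<in> N \<Longrightarrow> y \<in> N \<Longrightarrow> x \<ominus>\<^bsub>M\<^esub> y \<in> N"
  unfolding a_minus_def by (simp add: submoduleE(3,5))

lemma submodule_finsum:
  assumes N: "submodule N R M" and "finite A" "f \<in> A \<rightarrow> N"
  shows "finsum M f A \<in> N"
  using assms(2,3)
proof (induction A rule: finite_induct)
  case empty
  then show ?case by (simp add: submodule_zero[OF N])
next
  case (insert a A)
  then have "f \<in> A \<rightarrow> carrier M" "f a \<in> carrier M" using submodule_subset[OF N] by auto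
  with insert show ?case by (simp add: submodule_add[OF N])
qed

lemma rspan_submodule:
  assumes "S \<subseteq> carrier M"
  shows "submodule (rspan S) R M"
proof (rule submoduleI')
  show "rspan S \<subseteq> carrier M" unfolding rspan_def using assms carrier_is_submodule by auto
qed (auto simp: rspan_def submodule_zero submodule_add submodule_smult)

lemma rspan_incl: "S \<subseteq> rspan S"
  unfolding rspan_def by auto

lemma rspan_minimal: "submodule N R M \<Longrightarrow> S \<subseteq> N \<Longrightarrow> rspan S \<subseteq> N"
  unfolding rspan_def by auto

lemma rspan_mono: "S \<subseteq> S' \<Longrightarrow> rspan S \<subseteq> rspan S'"
  unfolding rspan_def by auto

lemma rspan_subset: "S \<subseteq> carrier M \<Longrightarrow> rspan S \<subseteq> carrier M"
  using rspan_minimal[OF carrier_is_submodule] .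

text \<open>Isolates the coefficient of one generator; the induction in
  \<open>noetherian_submodule\<close> runs on it.\<close>

lemma rspan_insert:
  assumes "S \<subseteq> carrier M" "s \<in> carrier M"
  shows "rspan (insert s S) = {r \<odot>\<^bsub>M\<^esub> s \<oplus>\<^bsub>M\<^esub> x | r x. r \<in> carrier R \<and> x \<in> rspan S}"
    (is "_ = ?Y")
proof
  note sub = rspan_submodule[OF assms(1)]
  have S: "rspan S \<subseteq> carrier M" by (rule rspan_subset[OF assms(1)])
  have "submodule ?Y R M"
  proof (rule submoduleI')
    show "?Y \<subseteq> carrier M" using S assms by auto
    show "\<zero>\<^bsub>M\<^esub> \<in> ?Y" using submodule_zero[OF sub] assms
      by (auto intro!: exI[of _ \<zero>] exI[of _ "\<zero>\<^bsub>M\<^esub>"])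
  next
    fix x y assume "x \<in> ?Y" "y \<in> ?Y"
    then obtain a x' b y' where *: "x = a \<odot>\<^bsub>M\<^esub> s \<oplus>\<^bsub>M\<^esub> x'" "y = b \<odot>\<^bsub>M\<^esub> s \<oplus>\<^bsub>M\<^esub> y'"
      "a \<in> carrier R" "b \<in> carrier R" "x' \<in> rspan S" "y' \<in> rspan S" by auto
    then have "x \<oplus>\<^bsub>M\<^esub> y = (a \<oplus> b) \<odot>\<^bsub>M\<^esub> s \<oplus>\<^bsub>M\<^esub> (x' \<oplus>\<^bsub>M\<^esub> y')"
      using S assms by (simp add: smult_l_distr M.a_ac subset_iff)
    moreover have "x' \<oplus>\<^bsub>M\<^esub> y' \<in> rspan S" using * sub submodule_add by blast
    ultimately show "x \<oplus>\<^bsub>M\<^esub> y \<in> ?Y" using * by blast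
  next
    fix c x assume c: "c \<in> carrier R" and "x \<in> ?Y"
    then obtain a x' where *: "x = a \<odot>\<^bsub>M\<^esub> s \<oplus>\<^bsub>M\<^esub> x'" "a \<in> carrier R" "x' \<in> rspan S" by auto
    then have "c \<odot>\<^bsub>M\<^esub> x = (c \<otimes> a) \<odot>\<^bsub>M\<^esub> s \<oplus>\<^bsub>M\<^esub> c \<odot>\<^bsub>M\<^esub> x'"
      using S assms c by (simp add: smult_r_distr smult_assoc1 subset_iff)
    moreover have "c \<odot>\<^bsub>M\<^esub> x' \<in> rspan S" using * sub submodule_smult c by blast
    ultimately show "c \<odot>\<^bsub>M\<^esub> x \<in> ?Y" using * c by blast
  qed
  moreover have "s \<in> ?Y" using submodule_zero[OF sub] assms
    by (intro CollectI exI[of _ \<one>] exI[of _ "\<zero>\<^bsub>M\<^esub>"]) auto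
  moreover have "S \<subseteq> ?Y"
  proof
    fix x assume "x \<in> S"
    then have "x \<in> rspan S" "x \<in> carrier M" using rspan_incl assms by auto
    then show "x \<in> ?Y" using assms by (intro CollectI exI[of _ \<zero>] exI[of _ x]) auto
  qed
  ultimately show "rspan (insert s S) \<subseteq> ?Y" by (intro rspan_minimal) auto
next
  have sub: "submodule (rspan (insert s S)) R M" using rspan_submodule assms by simp
  have "s \<in> rspan (insert s S)" "rspan S \<subseteq> rspan (insert s S)"
    using rspan_incl[of "insert s S"] rspan_mono[of S "insert s S"] by auto
  then show "?Y \<subseteq> rspan (insert s S)"
    using submodule_add[OF sub] submodule_smult[OF sub] by auto
qed

text \<open>This is the conductor of \<open>s\<close> into N + L, that is, the annihilator of the
  class of \<open>s\<close> in M/(N + L). It plays the part of the leading-coefficient ideal in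
  Hilbert's basis theorem.\<close>

lemma coefficient_ideal:
  assumes N: "submodule N R M" and L: "submodule L R M" and s: "s \<in> carrier M"
  shows "ideal {r \<in> carrier R. \<exists>x \<in> L. r \<odot>\<^bsub>M\<^esub> s \<oplus>\<^bsub>M\<^esub> x \<in> N} R" (is "ideal ?C R")
proof -
  note cl = submodule_subset[OF N] submodule_subset[OF L]
  show ?thesis
  proof (rule idealI)
    show "subgroup ?C (add_monoid R)"
    proof (rule R.add.subgroupI)
      show "?C \<subseteq> carrier R" by auto
      have "\<zero> \<in> ?C" using submodule_zero[OF N] submodule_zero[OF L] s
        by (auto intro!: bexI[of _ "\<zero>\<^bsub>M\<^esub>"])
      then show "?C \<noteq> {}" by auto
    next
      fix a assume "a \<in> ?C"
      then obtain x where a: "a \<in> carrier R" "x \<in> L" "a \<odot>\<^bsub>M\<^esub> s \<oplus>\<^bsub>M\<^esub> x \<in> N" by auto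
      moreover have "(\<ominus> a) \<odot>\<^bsub>M\<^esub> s \<oplus>\<^bsub>M\<^esub> (\<ominus>\<^bsub>M\<^esub> x) = \<ominus>\<^bsub>M\<^esub> (a \<odot>\<^bsub>M\<^esub> s \<oplus>\<^bsub>M\<^esub> x)"
        using a s cl by (auto simp: smult_l_minus M.minus_add)
      ultimately show "\<ominus> a \<in> ?C" using submoduleE(3)[OF N] submoduleE(3)[OF L]
        by (auto intro!: bexI[of _ "\<ominus>\<^bsub>M\<^esub> x"])
    next
      fix a b assume "a \<in> ?C" "b \<in> ?C"
      then obtain x y where *: "a \<in> carrier R" "x \<in> L" "a \<odot>\<^bsub>M\<^esub> s \<oplus>\<^bsub>M\<^esub> x \<in> N"
        "b \<in> carrier R" "y \<in> L" "b \<odot>\<^bsub>M\<^esub> s \<oplus>\<^bsub>M\<^esub> y \<in> N" by auto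
      moreover have "(a \<oplus> b) \<odot>\<^bsub>M\<^esub> s \<oplus>\<^bsub>M\<^esub> (x \<oplus>\<^bsub>M\<^esub> y)
          = (a \<odot>\<^bsub>M\<^esub> s \<oplus>\<^bsub>M\<^esub> x) \<oplus>\<^bsub>M\<^esub> (b \<odot>\<^bsub>M\<^esub> s \<oplus>\<^bsub>M\<^esub> y)"
        using * s cl by (simp add: smult_l_distr M.a_ac subset_iff)
      ultimately show "a \<oplus> b \<in> ?C" using submodule_add[OF N] submodule_add[OF L]
        by (auto intro!: bexI[of _ "x \<oplus>\<^bsub>M\<^esub> y"])
    qed
  next
    fix a c assume "a \<in> ?C" and c: "c \<in> carrier R"
    then obtain x where a: "a \<in> carrier R" "x \<in> L" "a \<odot>\<^bsub>M\<^esub> s \<oplus>\<^bsub>M\<^esub> x \<in> N" by auto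
    moreover have "(c \<otimes> a) \<odot>\<^bsub>M\<^esub> s \<oplus>\<^bsub>M\<^esub> c \<odot>\<^bsub>M\<^esub> x = c \<odot>\<^bsub>M\<^esub> (a \<odot>\<^bsub>M\<^esub> s \<oplus>\<^bsub>M\<^esub> x)"
      using a s c cl by (auto simp: smult_r_distr smult_assoc1 subset_iff)
    ultimately show ca: "c \<otimes> a \<in> ?C" using submodule_smult[OF N] submodule_smult[OF L] c
      by (auto intro!: bexI[of _ "c \<odot>\<^bsub>M\<^esub> x"])
    then show "a \<otimes> c \<in> ?C" using R.m_comm a c by simp
  qed (rule R.ring_axioms)
qed

text \<open>Induction on the number of generators: \<open>N\<close> is assembled from its ideal of
  coefficients at \<open>s\<close>, finitely generated because \<open>R\<close> is noetherian, and
  from its intersection with the span of the remaining generators. \<open>G1\<close> lifts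
  generators of the former, \<open>G2\<close> generates the latter.\<close>

theorem noetherian_submodule:
  assumes R: "noetherian_ring R" and "finite S" "S \<subseteq> carrier M"
    and "submodule N R M" "N \<subseteq> rspan S"
  shows "\<exists>G. finite G \<and> G \<subseteq> N \<and> N \<subseteq> rspan G"
  using assms(2-)
proof (induction S arbitrary: N rule: finite_induct)
  case empty
  then show ?case by auto
next
  case (insert s S)
  note N = insert.prems(2)
  have S: "S \<subseteq> carrier M" and s: "s \<in> carrier M" using insert.prems(1) by auto
  note L = rspan_submodule[OF S]
  note cl = submodule_subset[OF N] submodule_subset[OF L]
  define C where "C = {r \<in> carrier R. \<exists>x \<in> rspan S. r \<odot>\<^bsub>M\<^esub> s \<oplus>\<^bsub>M\<^esub> x \<in> N}"
  have "ideal C R" unfolding C_def by (rule coefficient_ideal[OF N L s])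
  then obtain A where A: "A \<subseteq> carrier R" "finite A" "C = genideal R A"
    using noetherian_ring.finetely_gen[OF R] by blast
  have "A \<subseteq> C" using A R.genideal_self by auto
  then have "\<forall>c\<in>A. \<exists>x \<in> rspan S. c \<odot>\<^bsub>M\<^esub> s \<oplus>\<^bsub>M\<^esub> x \<in> N" unfolding C_def by auto
  then obtain f where f: "\<And>c. c \<in> A \<Longrightarrow> f c \<in> rspan S \<and> c \<odot>\<^bsub>M\<^esub> s \<oplus>\<^bsub>M\<^esub> f c \<in> N" by metis
  define G1 where "G1 = (\<lambda>c. c \<odot>\<^bsub>M\<^esub> s \<oplus>\<^bsub>M\<^esub> f c) ` A"
  have G1: "finite G1" "G1 \<subseteq> N" unfolding G1_def using A f by auto
  then have G1c: "G1 \<subseteq> carrier M" using cl by auto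
  note L1 = rspan_submodule[OF G1c]
  have G1N: "rspan G1 \<subseteq> N" by (rule rspan_minimal[OF N G1(2)])
  have "submodule (N \<inter> rspan S) R M"
    by (rule submoduleI') (use cl N L in \<open>auto intro: submodule_zero submodule_add submodule_smult\<close>)
  then have "\<exists>G. finite G \<and> G \<subseteq> N \<inter> rspan S \<and> N \<inter> rspan S \<subseteq> rspan G"
    by (rule insert.IH[OF S]) simp
  then obtain G2 where G2: "finite G2" "G2 \<subseteq> N \<inter> rspan S" "N \<inter> rspan S \<subseteq> rspan G2" by (elim exE conjE)
  have "G1 \<union> G2 \<subseteq> carrier M" using G1c G2 cl by auto
  note L12 = rspan_submodule[OF this]
  \<comment> \<open>The coefficients realised by elements of \<open>rspan G1\<close> form an ideal
    containing the generators \<open>A\<close> of \<open>C\<close>, hence all of \<open>C\<close>.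
    No element of \<open>C\<close> has to be expanded as a combination of \<open>A\<close>.\<close>
  let ?D = "{r \<in> carrier R. \<exists>x \<in> rspan S. r \<odot>\<^bsub>M\<^esub> s \<oplus>\<^bsub>M\<^esub> x \<in> rspan G1}"
  have "ideal ?D R" by (rule coefficient_ideal[OF L1 L s])
  moreover have "A \<subseteq> ?D" using f A rspan_incl[of G1] unfolding G1_def by blast
  ultimately have CD: "C \<subseteq> ?D" using A R.genideal_minimal by blast
  have "N \<subseteq> rspan (G1 \<union> G2)"
  proof
    fix y assume y: "y \<in> N"
    then obtain r x where rx: "y = r \<odot>\<^bsub>M\<^esub> s \<oplus>\<^bsub>M\<^esub> x" "r \<in> carrier R" "x \<in> rspan S"
      using insert.prems(3) rspan_insert[OF S s] by blast
    then have "r \<in> C" using y unfolding C_def by auto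
    then obtain x' where x': "x' \<in> rspan S" "r \<odot>\<^bsub>M\<^esub> s \<oplus>\<^bsub>M\<^esub> x' \<in> rspan G1" using CD by auto
    let ?z = "r \<odot>\<^bsub>M\<^esub> s \<oplus>\<^bsub>M\<^esub> x'"
    have c: "x \<in> carrier M" "x' \<in> carrier M" using rx x' cl by auto
    \<comment> \<open>The multiples of \<open>s\<close> cancel, so the difference lies in both
      \<open>N\<close> and \<open>rspan S\<close>, where \<open>G2\<close> takes over.\<close>
    have "y \<ominus>\<^bsub>M\<^esub> ?z = x \<ominus>\<^bsub>M\<^esub> x'"
      unfolding rx(1) using c rx(2) s by (simp add: a_minus_def M.minus_add M.a_ac M.r_neg M.r_neg1 M.r_neg2)
    moreover have "y \<ominus>\<^bsub>M\<^esub> ?z \<in> N" using y x' G1N submodule_minus[OF N] by blast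
    moreover have "x \<ominus>\<^bsub>M\<^esub> x' \<in> rspan S" using rx x' submodule_minus[OF L] by blast
    ultimately have "y \<ominus>\<^bsub>M\<^esub> ?z \<in> rspan G2" using G2 by auto
    then have "y \<ominus>\<^bsub>M\<^esub> ?z \<in> rspan (G1 \<union> G2)" "?z \<in> rspan (G1 \<union> G2)"
      using rspan_mono[of G2 "G1 \<union> G2"] rspan_mono[of G1 "G1 \<union> G2"] x' by auto
    then have "(y \<ominus>\<^bsub>M\<^esub> ?z) \<oplus>\<^bsub>M\<^esub> ?z \<in> rspan (G1 \<union> G2)" using submodule_add[OF L12] by blast
    moreover have "(y \<ominus>\<^bsub>M\<^esub> ?z) \<oplus>\<^bsub>M\<^esub> ?z = y"
      using y cl c s rx(2) by (auto simp: a_minus_def M.a_assoc M.l_neg)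
    ultimately show "y \<in> rspan (G1 \<union> G2)" by simp
  qed
  then show ?case using G1 G2 by (intro exI[of _ "G1 \<union> G2"]) auto
qed

end

text \<open>The acting set \<open>A\<close> is a parameter: the whole carrier gives left ideals, a
  subalgebra gives the modules over it to which \<open>nakayama\<close> is applied in
  \<open>subalgebra_eq_carrier\<close>, and the opposite ring turns both into their right-sided
  versions.\<close>

definition left_stable :: "('a, 'm) ring_scheme \<Rightarrow> 'a set \<Rightarrow> 'a set \<Rightarrow> bool" where
  "left_stable M A Y \<longleftrightarrow> Y \<subseteq> carrier M \<and> \<zero>\<^bsub>M\<^esub> \<in> Y \<and> (\<forall>x\<in>Y. \<forall>y\<in>Y. x \<oplus>\<^bsub>M\<^esub> y \<in> Y) \<and>
    (\<forall>a\<in>A. \<forall>x\<in>Y. a \<otimes>\<^bsub>M\<^esub> x \<in> Y)"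

context ring
begin

lemma left_ideal_iff: "left_ideal R L \<longleftrightarrow> left_stable R (carrier R) L"
proof
  assume "left_ideal R L"
  then show "left_stable R (carrier R) L"
    unfolding left_ideal_def left_stable_def
    by (auto simp: additive_subgroup.zero_closed additive_subgroup.a_closed additive_subgroup.a_Hcarr)
next
  assume L: "left_stable R (carrier R) L"
  have "\<ominus> x \<in> L" if "x \<in> L" for x
  proof -
    have "(\<ominus> \<one>) \<otimes> x \<in> L" "x \<in> carrier R" using L that unfolding left_stable_def by auto
    then show ?thesis by (simp add: l_minus)
  qed
  then have "subgroup L (add_monoid R)"
    using L unfolding left_stable_def by (intro add.subgroupI) auto
  then show "left_ideal R L"
    using L unfolding left_ideal_def left_stable_def by (auto intro: additive_subgroupI)
qed

text \<open>Nakayama's lemma for \<open>\<Sum>A s / N\<close>. The hypothesis says \<open>S \<subseteq> N + \<Sum>P s\<close>.\<close>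

lemma nakayama:
  assumes A: "A \<subseteq> carrier R"
    and P: "left_stable R A P" "P \<subseteq> A"
    and A1: "\<one> \<in> A" "\<And>a b. a \<in> A \<Longrightarrow> b \<in> A \<Longrightarrow> a \<otimes> b \<in> A" "\<And>a b. a \<in> A \<Longrightarrow> b \<in> A \<Longrightarrow> a \<oplus> b \<in> A"
    and inv: "\<And>p. p \<in> P \<Longrightarrow> \<exists>u\<in>A. u \<otimes> (\<one> \<ominus> p) = \<one>"
    and "finite S" "S \<subseteq> carrier R" "left_stable R A N"
    and "\<And>Y. left_stable R A Y \<Longrightarrow> N \<subseteq> Y \<Longrightarrow> (\<And>p s. p \<in> P \<Longrightarrow> s \<in> S \<Longrightarrow> p \<otimes> s \<in> Y) \<Longrightarrow> S \<subseteq> Y"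
  shows "S \<subseteq> N"
  using assms(8-)
proof (induction S arbitrary: N rule: finite_induct)
  case empty
  then show ?case by auto
next
  case (insert s S)
  note N = insert.prems(2)
  have s: "s \<in> carrier R" and S: "S \<subseteq> carrier R" using insert.prems by auto
  have Nc: "N \<subseteq> carrier R" and Pc: "P \<subseteq> carrier R" using N P unfolding left_stable_def by auto
  \<comment> \<open>Enlarging \<open>N\<close> by P s disposes of \<open>s\<close>: the hypothesis
    for \<open>insert s S\<close> over \<open>N\<close> becomes the hypothesis for \<open>S\<close>
    over \<open>?N\<close>.\<close>
  let ?N = "{n \<oplus> p \<otimes> s |n p. n \<in> N \<and> p \<in> P}"
  have N': "left_stable R A ?N"
    unfolding left_stable_def
  proof (intro conjI ballI)
    show "?N \<subseteq> carrier R" using Nc Pc s by auto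
    have "\<zero> = \<zero> \<oplus> \<zero> \<otimes> s" using s by simp
    moreover have "\<zero> \<in> N" "\<zero> \<in> P" using N P unfolding left_stable_def by auto
    ultimately show "\<zero> \<in> ?N" by blast
  next
    fix x y assume "x \<in> ?N" "y \<in> ?N"
    then obtain n p m q where *: "x = n \<oplus> p \<otimes> s" "y = m \<oplus> q \<otimes> s" "n \<in> N" "p \<in> P" "m \<in> N" "q \<in> P"
      by auto
    then have "x \<oplus> y = (n \<oplus> m) \<oplus> (p \<oplus> q) \<otimes> s" using Nc Pc s by (simp add: l_distr a_ac subset_iff)
    moreover have "n \<oplus> m \<in> N" "p \<oplus> q \<in> P" using * N P unfolding left_stable_def by auto
    ultimately show "x \<oplus> y \<in> ?N" by blast
  next
    fix a x assume a: "a \<in> A" and "x \<in> ?N"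
    then obtain n p where *: "x = n \<oplus> p \<otimes> s" "n \<in> N" "p \<in> P" by auto
    then have "a \<otimes> x = a \<otimes> n \<oplus> (a \<otimes> p) \<otimes> s" using Nc Pc s A a by (simp add: r_distr m_assoc subset_iff)
    moreover have "a \<otimes> n \<in> N" "a \<otimes> p \<in> P" using * N P a unfolding left_stable_def by auto
    ultimately show "a \<otimes> x \<in> ?N" by blast
  qed
  have NN': "N \<subseteq> ?N"
  proof
    fix n assume "n \<in> N"
    moreover have "n = n \<oplus> \<zero> \<otimes> s" using s calculation Nc by auto
    moreover have "\<zero> \<in> P" using P unfolding left_stable_def by auto
    ultimately show "n \<in> ?N" by blast
  qed
  have Ps: "p \<otimes> s \<in> ?N" if "p \<in> P" for p
  proof -
    have "p \<otimes> s = \<zero> \<oplus> p \<otimes> s" using that Pc s by auto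
    moreover have "\<zero> \<in> N" using N unfolding left_stable_def by auto
    ultimately show ?thesis using that by blast
  qed
  have SN': "S \<subseteq> ?N"
  proof (rule insert.IH[OF S N'])
    fix Y assume Y: "left_stable R A Y" "?N \<subseteq> Y" and PS: "\<And>p s. p \<in> P \<Longrightarrow> s \<in> S \<Longrightarrow> p \<otimes> s \<in> Y"
    have "insert s S \<subseteq> Y"
      by (rule insert.prems(3)[OF Y(1)]) (use NN' Y(2) Ps PS in auto)
    then show "S \<subseteq> Y" by auto
  qed
  have "insert s S \<subseteq> ?N"
  proof (rule insert.prems(3)[OF N' NN'])
    fix p t assume p: "p \<in> P" and t: "t \<in> insert s S"
    show "p \<otimes> t \<in> ?N"
    proof (cases "t = s")
      case True then show ?thesis using Ps p by simp
    next
      case False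
      then show ?thesis using t SN' p P N' unfolding left_stable_def by blast
    qed
  qed
  \<comment> \<open>Now s = n + p s can be solved for \<open>s\<close>. The left inverse of 1 - p
    has to lie in \<open>A\<close>, since \<open>N\<close> is stable only under
    \<open>A\<close>.\<close>
  then obtain n p where np: "s = n \<oplus> p \<otimes> s" "n \<in> N" "p \<in> P" by auto
  obtain u where u: "u \<in> A" "u \<otimes> (\<one> \<ominus> p) = \<one>" using inv np by auto
  have c: "n \<in> carrier R" "p \<in> carrier R" "u \<in> carrier R" using np Nc Pc u A by auto
  have "(\<one> \<ominus> p) \<otimes> s = s \<ominus> p \<otimes> s" using c s by (simp add: a_minus_def l_distr l_minus)
  also have "\<dots> = (n \<oplus> p \<otimes> s) \<ominus> p \<otimes> s" using np(1) by simp
  also have "\<dots> = n" using c s by (simp add: a_minus_def a_assoc r_neg)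
  finally have "u \<otimes> ((\<one> \<ominus> p) \<otimes> s) = u \<otimes> n" by simp
  moreover have "u \<otimes> ((\<one> \<ominus> p) \<otimes> s) = (u \<otimes> (\<one> \<ominus> p)) \<otimes> s"
    using c s by (simp add: m_assoc)
  ultimately have "s = u \<otimes> n" using u s by simp
  then have sN: "s \<in> N" using u np N unfolding left_stable_def by auto
  have "?N \<subseteq> N"
  proof
    fix x assume "x \<in> ?N"
    then obtain n p where "x = n \<oplus> p \<otimes> s" "n \<in> N" "p \<in> P" by auto
    then show "x \<in> N" using N sN P(2) unfolding left_stable_def by blast
  qed
  then show ?case using SN' sN by auto
qed

end

section \<open>Maximal left ideals and the description of the radical by left inverses\<close>

section \<open>The Jacobson radical\<close>

context ring
begin

lemma left_stable_principal_sum: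
  assumes N: "left_stable R (carrier R) N" and x: "x \<in> carrier R"
  shows "left_stable R (carrier R) {n \<oplus> z \<otimes> x |n z. n \<in> N \<and> z \<in> carrier R}" (is "left_stable R _ ?S")
  unfolding left_stable_def
proof (intro conjI ballI)
  have Nc: "N \<subseteq> carrier R" using N unfolding left_stable_def by auto
  show "?S \<subseteq> carrier R" using Nc x by auto
  have "\<zero> = \<zero> \<oplus> \<zero> \<otimes> x" "\<zero> \<in> N" using x N unfolding left_stable_def by auto
  then show "\<zero> \<in> ?S" by blast
  fix a assume "a \<in> ?S"
  then obtain n z where a: "a = n \<oplus> z \<otimes> x" "n \<in> N" "z \<in> carrier R" by auto
  {
    fix b assume "b \<in> ?S"
    then obtain m w where b: "b = m \<oplus> w \<otimes> x" "m \<in> N" "w \<in> carrier R" by auto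
    have "a \<oplus> b = (n \<oplus> m) \<oplus> (z \<oplus> w) \<otimes> x" using a b Nc x by (simp add: l_distr a_ac subset_iff)
    moreover have "n \<oplus> m \<in> N" using a b N unfolding left_stable_def by auto
    ultimately show "a \<oplus> b \<in> ?S" using a b by blast
  }
  {
    fix c assume c: "c \<in> carrier R"
    have "c \<otimes> a = c \<otimes> n \<oplus> (c \<otimes> z) \<otimes> x" using a c Nc x by (simp add: r_distr m_assoc subset_iff)
    moreover have "c \<otimes> n \<in> N" using a c N unfolding left_stable_def by auto
    ultimately show "c \<otimes> a \<in> ?S" using a c by blast
  }
qed

lemma left_stable_eq_carrier:
  assumes "left_stable R (carrier R) L" "u \<in> carrier R" "x \<in> L" "u \<otimes> x = \<one>"
  shows "L = carrier R"
proof -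
  have "\<one> \<in> L" using assms unfolding left_stable_def by metis
  then have "c \<otimes> \<one> \<in> L" if "c \<in> carrier R" for c using assms(1) that unfolding left_stable_def by blast
  then show ?thesis using assms(1) unfolding left_stable_def by auto
qed

text \<open>Zorn's lemma for the left ideals above \<open>L\<close> that avoid 1. Avoiding 1 is the
  same as being proper, and it survives unions of chains.\<close>

lemma exists_maximal_left_ideal:
  assumes L: "left_stable R (carrier R) L" and "\<one> \<notin> L"
  shows "\<exists>N. maximal_submodule (left_ideal R) (carrier R) N \<and> L \<subseteq> N"
proof -
  define A where "A = {N. left_stable R (carrier R) N \<and> \<one> \<notin> N \<and> L \<subseteq> N}"
  have "\<exists>N\<in>A. \<forall>Y\<in>A. N \<subseteq> Y \<longrightarrow> Y = N"
  proof (rule subset_Zorn_nonempty)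
    show "A \<noteq> {}" using assms unfolding A_def by auto
    fix C assume C: "C \<noteq> {}" "subset.chain A C"
    then have CA: "C \<subseteq> A" unfolding pred_on.chain_def by auto
    have "left_stable R (carrier R) (\<Union>C)"
      unfolding left_stable_def
    proof (intro conjI ballI)
      show "\<Union>C \<subseteq> carrier R" "\<zero> \<in> \<Union>C" using CA C(1) unfolding A_def left_stable_def by auto
      fix x assume "x \<in> \<Union>C"
      then obtain Y where Y: "x \<in> Y" "Y \<in> C" by auto
      {
        fix y assume "y \<in> \<Union>C"
        then obtain Z where Z: "y \<in> Z" "Z \<in> C" by auto
        then have "Y \<subseteq> Z \<or> Z \<subseteq> Y" using C(2) Y unfolding pred_on.chain_def by auto
        then obtain W where "W \<in> C" "x \<in> W" "y \<in> W" using Y Z by blast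
        then show "x \<oplus> y \<in> \<Union>C" using CA unfolding A_def left_stable_def by blast
      }
      fix a assume "a \<in> carrier R"
      then show "a \<otimes> x \<in> \<Union>C" using Y CA unfolding A_def left_stable_def by blast
    qed
    then show "\<Union>C \<in> A" using CA C(1) unfolding A_def by auto
  qed
  then obtain N where NA: "N \<in> A" and max: "\<And>Y. Y \<in> A \<Longrightarrow> N \<subseteq> Y \<Longrightarrow> Y = N" by blast
  then have N: "left_stable R (carrier R) N" "\<one> \<notin> N" "L \<subseteq> N" unfolding A_def by simp_all
  have "maximal_submodule (left_ideal R) (carrier R) N"
    unfolding maximal_submodule_def left_ideal_iff
  proof (intro conjI allI impI)
    show "N \<subset> carrier R" using N unfolding left_stable_def by auto
    fix Y assume Y: "left_stable R (carrier R) Y \<and> N \<subseteq> Y \<and> Y \<subseteq> carrier R"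
    show "Y = N \<or> Y = carrier R"
    proof (cases "\<one> \<in> Y")
      case True
      then show ?thesis using left_stable_eq_carrier[of Y \<one> \<one>] Y by auto
    next
      case False
      then show ?thesis using max Y N unfolding A_def by auto
    qed
  qed (rule N)
  then show ?thesis using N by auto
qed

text \<open>If 1 - z x had no left inverse, the left ideal it generates would lie in a maximal left
  ideal; that ideal contains z x as well, hence 1. Conversely, an x outside a maximal left ideal N
  yields 1 = n + z x with n in N, and the left inverse of n = 1 - z x forces N to be
  everything.\<close>

lemma jacobson_radical_iff:
  "x \<in> jacobson_radical R \<longleftrightarrow>
    x \<in> carrier R \<and> (\<forall>z\<in>carrier R. \<exists>u\<in>carrier R. u \<otimes> (\<one> \<ominus> z \<otimes> x) = \<one>)" (is "_ \<longleftrightarrow> _ \<and> ?U")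
proof (intro iffI conjI ballI)
  assume x: "x \<in> jacobson_radical R"
  then show xc: "x \<in> carrier R" unfolding jacobson_radical_def module_rad_def by auto
  fix z assume z: "z \<in> carrier R"
  let ?y = "\<one> \<ominus> z \<otimes> x"
  have y: "?y \<in> carrier R" using xc z by simp
  \<comment> \<open>The left ideal generated by \<open>?y\<close>, written with the summand {0} so
    that \<open>left_stable_principal_sum\<close> applies.\<close>
  let ?S = "{n \<oplus> u \<otimes> ?y |n u. n \<in> {\<zero>} \<and> u \<in> carrier R}"
  have "left_stable R (carrier R) {\<zero>}" unfolding left_stable_def by auto
  then have S: "left_stable R (carrier R) ?S" by (rule left_stable_principal_sum[OF _ y])
  show "\<exists>u\<in>carrier R. u \<otimes> ?y = \<one>"
  proof (rule ccontr)
    assume neg: "\<not> ?thesis"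
    have "\<one> \<notin> ?S"
    proof
      assume "\<one> \<in> ?S"
      then obtain u where "u \<in> carrier R" "\<one> = \<zero> \<oplus> u \<otimes> ?y" by auto
      then show False using neg y by (metis l_zero m_closed)
    qed
    then obtain N where N: "maximal_submodule (left_ideal R) (carrier R) N" "?S \<subseteq> N"
      using exists_maximal_left_ideal[OF S] by blast
    then have Ns: "left_stable R (carrier R) N" "N \<noteq> carrier R"
      unfolding maximal_submodule_def left_ideal_iff by auto
    have "x \<in> N" using x N unfolding jacobson_radical_def module_rad_def by auto
    then have zx: "z \<otimes> x \<in> N" using Ns z unfolding left_stable_def by auto
    have "?y = \<zero> \<oplus> \<one> \<otimes> ?y" using y by simp
    then have "?y \<in> ?S" using y by blast
    then have "?y \<oplus> z \<otimes> x \<in> N" using N Ns(1) zx unfolding left_stable_def by blast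
    moreover have "?y \<oplus> z \<otimes> x = \<one>" using z xc by (simp add: a_minus_def a_assoc l_neg)
    ultimately show False using left_stable_eq_carrier[OF Ns(1), of \<one> \<one>] Ns(2) by simp
  qed
next
  assume x: "x \<in> carrier R \<and> ?U"
  have "x \<in> N" if N: "maximal_submodule (left_ideal R) (carrier R) N" for N
  proof (rule ccontr)
    assume xN: "x \<notin> N"
    have Ns: "left_stable R (carrier R) N" "N \<subset> carrier R"
      and max: "\<And>L. left_stable R (carrier R) L \<Longrightarrow> N \<subseteq> L \<Longrightarrow> L \<subseteq> carrier R \<Longrightarrow> L = N \<or> L = carrier R"
      using N unfolding maximal_submodule_def left_ideal_iff by auto
    let ?S = "{n \<oplus> z \<otimes> x |n z. n \<in> N \<and> z \<in> carrier R}"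
    have S: "left_stable R (carrier R) ?S" using left_stable_principal_sum Ns x by blast
    have "N \<subseteq> ?S"
    proof
      fix n assume "n \<in> N"
      moreover have "n = n \<oplus> \<zero> \<otimes> x" using x Ns calculation by auto
      ultimately show "n \<in> ?S" by blast
    qed
    moreover have "x \<in> ?S"
    proof -
      have "x = \<zero> \<oplus> \<one> \<otimes> x" "\<zero> \<in> N" using x Ns unfolding left_stable_def by auto
      then show ?thesis by blast
    qed
    moreover have "?S \<subseteq> carrier R" using Ns x by auto
    ultimately have "?S = carrier R" using max[OF S] xN by blast
    then obtain n z where nz: "\<one> = n \<oplus> z \<otimes> x" "n \<in> N" "z \<in> carrier R" using one_closed by blast
    have "\<one> \<ominus> z \<otimes> x = (n \<oplus> z \<otimes> x) \<ominus> z \<otimes> x" using nz(1) by simp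
    also have "\<dots> = n" using nz x Ns by (auto simp: a_minus_def a_assoc r_neg)
    finally obtain u where "u \<in> carrier R" "u \<otimes> n = \<one>" using x nz by metis
    then show False using left_stable_eq_carrier[OF Ns(1)] nz Ns by blast
  qed
  then show "x \<in> jacobson_radical R" using x unfolding jacobson_radical_def module_rad_def by auto
qed

text \<open>A left inverse u of 1 - x satisfies u = 1 - (-u) x, so u has a left inverse too. That
  left inverse must be 1 - x, which makes u two-sided.\<close>

lemma jacobson_radical_quasi_regular:
  assumes "x \<in> jacobson_radical R"
  shows "\<one> \<ominus> x \<in> Units R"
proof -
  have x: "x \<in> carrier R" using assms jacobson_radical_iff by simp
  from assms obtain u where u: "u \<in> carrier R" "u \<otimes> (\<one> \<ominus> x) = \<one>"
    using jacobson_radical_iff[of x] by (metis one_closed l_one)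
  have "u \<otimes> (\<one> \<ominus> x) = u \<ominus> u \<otimes> x" using u x by (simp add: a_minus_def r_distr r_minus)
  then have "u \<ominus> u \<otimes> x = \<one>" using u by simp
  moreover have "(u \<ominus> u \<otimes> x) \<oplus> u \<otimes> x = u" using u x by (simp add: a_minus_def a_assoc l_neg)
  ultimately have "\<one> \<ominus> (\<ominus> u) \<otimes> x = u" using u x by (simp add: a_minus_def l_minus)
  moreover obtain v where v: "v \<in> carrier R" "v \<otimes> (\<one> \<ominus> (\<ominus> u) \<otimes> x) = \<one>"
    using assms jacobson_radical_iff[of x] u by (meson a_inv_closed)
  ultimately have vu: "v \<otimes> u = \<one>" by simp
  have "v = v \<otimes> (u \<otimes> (\<one> \<ominus> x))" using u v by simp
  also have "\<dots> = (v \<otimes> u) \<otimes> (\<one> \<ominus> x)" using u v x by (simp add: m_assoc)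
  also have "\<dots> = \<one> \<ominus> x" using vu x by simp
  finally show ?thesis using vu u x unfolding Units_def by auto
qed

lemma left_stable_jacobson_radical: "left_stable R (carrier R) (jacobson_radical R)"
  unfolding left_stable_def
proof (intro conjI ballI)
  have *: "left_stable R (carrier R) N" if "maximal_submodule (left_ideal R) (carrier R) N" for N
    using that unfolding maximal_submodule_def left_ideal_iff by auto
  show "jacobson_radical R \<subseteq> carrier R" "\<zero> \<in> jacobson_radical R"
    using * unfolding jacobson_radical_def module_rad_def left_stable_def by auto
  fix x assume x: "x \<in> jacobson_radical R"
  show "x \<oplus> y \<in> jacobson_radical R" if "y \<in> jacobson_radical R" for y
    using * x that unfolding jacobson_radical_def module_rad_def left_stable_def by blast
  show "a \<otimes> x \<in> jacobson_radical R" if "a \<in> carrier R" for a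
    using * x that unfolding jacobson_radical_def module_rad_def left_stable_def by blast
qed

text \<open>Closure under right multiplication: a left inverse \<open>u\<close> of \<open>\<one> - y w\<close> gives the left inverse
  \<open>\<one> + w u y\<close> of \<open>\<one> - w y\<close>.\<close>

lemma ideal_jacobson_radical: "ideal (jacobson_radical R) R"
proof (rule idealI)
  let ?J = "jacobson_radical R"
  have J: "?J \<subseteq> carrier R" using left_stable_jacobson_radical unfolding left_stable_def by auto
  have "left_ideal R ?J" using left_ideal_iff left_stable_jacobson_radical by blast
  then show "subgroup ?J (add_monoid R)" unfolding left_ideal_def additive_subgroup_def by auto
  show "y \<otimes> x \<in> ?J" if "x \<in> ?J" "y \<in> carrier R" for x y
    using left_stable_jacobson_radical that unfolding left_stable_def by auto
  show "x \<otimes> y \<in> ?J" if x: "x \<in> ?J" and y: "y \<in> carrier R" for x y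
    unfolding jacobson_radical_iff
  proof (intro conjI ballI)
    have xc: "x \<in> carrier R" using J x by auto
    show "x \<otimes> y \<in> carrier R" using xc y by simp
    fix z assume z: "z \<in> carrier R"
    define w where "w = z \<otimes> x"
    have w: "w \<in> carrier R" unfolding w_def using z xc by simp
    obtain u where u: "u \<in> carrier R" "u \<otimes> (\<one> \<ominus> (y \<otimes> z) \<otimes> x) = \<one>"
      using x y z jacobson_radical_iff by (meson m_closed)
    then have "u \<otimes> (\<one> \<ominus> y \<otimes> w) = \<one>" unfolding w_def using y z xc by (simp add: m_assoc)
    then have 1: "u \<ominus> u \<otimes> y \<otimes> w = \<one>" using u y w by (simp add: a_minus_def r_distr r_minus m_assoc)
    have "(\<one> \<oplus> w \<otimes> u \<otimes> y) \<otimes> (\<one> \<ominus> w \<otimes> y) = \<one> \<ominus> w \<otimes> y \<oplus> w \<otimes> (u \<ominus> u \<otimes> y \<otimes> w) \<otimes> y"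
      using u y w by (simp add: a_minus_def l_distr r_distr r_minus l_minus minus_add m_assoc a_ac)
    also have "\<dots> = \<one>" unfolding 1 using w y by (simp add: a_minus_def a_assoc l_neg)
    finally have "(\<one> \<oplus> w \<otimes> u \<otimes> y) \<otimes> (\<one> \<ominus> z \<otimes> (x \<otimes> y)) = \<one>"
      unfolding w_def using z xc y by (simp add: m_assoc)
    then show "\<exists>u\<in>carrier R. u \<otimes> (\<one> \<ominus> z \<otimes> (x \<otimes> y)) = \<one>" using w u y by blast
  qed
qed (rule ring_axioms)

end

text \<open>A submodule containing every proper one is itself maximal and contains every other
  maximal one. Locality is established below by exhibiting such a submodule.\<close>

lemma unique_maximal_submodule:
  assumes "S N" "N \<subset> M" and "\<And>L. S L \<Longrightarrow> L \<subseteq> M \<Longrightarrow> L \<noteq> M \<Longrightarrow> L \<subseteq> N"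
  shows "local_module S M" and "module_rad S M = N"
proof -
  have *: "maximal_submodule S M L \<longleftrightarrow> L = N" for L
    using assms unfolding maximal_submodule_def by blast
  then show "local_module S M" unfolding local_module_def by auto
  show "module_rad S M = N" unfolding module_rad_def * using assms(2) by auto
qed

section \<open>Finite sums of left ideals, and principal left ideals\<close>

section \<open>Sums of one-sided ideals\<close>

context ring
begin

text \<open>Turns the indexed sum into a recursion on which the inductions over the index set
  rest.\<close>

lemma submodule_sum_insert:
  assumes "finite T" "i \<notin> T" "\<And>j. j \<in> insert i T \<Longrightarrow> N j \<subseteq> carrier R"
  shows "submodule_sum R (insert i T) N = {x \<oplus> y |x y. x \<in> N i \<and> y \<in> submodule_sum R T N}"
proof safe
  fix z assume "z \<in> submodule_sum R (insert i T) N"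
  then obtain f where f: "f \<in> Pi (insert i T) N" "z = finsum R f (insert i T)"
    unfolding submodule_sum_def by auto
  then have "f \<in> T \<rightarrow> carrier R" "f i \<in> carrier R" using assms(3) by blast+
  then have "z = f i \<oplus> finsum R f T" using f assms by simp
  moreover have "finsum R f T \<in> submodule_sum R T N" unfolding submodule_sum_def using f by auto
  ultimately show "\<exists>x y. z = x \<oplus> y \<and> x \<in> N i \<and> y \<in> submodule_sum R T N" using f by blast
next
  fix x y assume x: "x \<in> N i" and "y \<in> submodule_sum R T N"
  then obtain f where f: "f \<in> Pi T N" "y = finsum R f T" unfolding submodule_sum_def by auto
  let ?g = "f(i := x)"
  have g: "?g \<in> Pi (insert i T) N" using f x by auto
  have fc: "f \<in> T \<rightarrow> carrier R" and xc: "x \<in> carrier R" using f x assms(3) by blast+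
  have gf: "finsum R ?g T = finsum R f T" by (rule add.finprod_cong') (use fc assms(2) in auto)
  have "?g \<in> T \<rightarrow> carrier R" using fc xc by auto
  then have "x \<oplus> y = finsum R ?g (insert i T)" using f gf assms xc by simp
  then show "x \<oplus> y \<in> submodule_sum R (insert i T) N" unfolding submodule_sum_def using g by blast
qed

lemma submodule_sum_empty: "submodule_sum R {} N = {\<zero>}"
  unfolding submodule_sum_def by auto

lemma left_stable_submodule_sum:
  assumes "finite T" "\<And>i. i \<in> T \<Longrightarrow> left_stable R A (N i)" "A \<subseteq> carrier R"
  shows "left_stable R A (submodule_sum R T N) \<and> (\<forall>i\<in>T. N i \<subseteq> submodule_sum R T N)"
  using assms(1,2)
proof (induction T rule: finite_induct)
  case empty
  then show ?case using assms(3) by (auto simp: submodule_sum_empty left_stable_def)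
next
  case (insert i T)
  let ?S = "submodule_sum R T N" and ?S' = "submodule_sum R (insert i T) N"
  have S: "left_stable R A ?S" "\<forall>i\<in>T. N i \<subseteq> ?S" and Ni: "left_stable R A (N i)" using insert by auto
  then have c: "?S \<subseteq> carrier R" "N i \<subseteq> carrier R" "\<zero> \<in> ?S" "\<zero> \<in> N i" unfolding left_stable_def by auto
  have eq: "?S' = {x \<oplus> y |x y. x \<in> N i \<and> y \<in> ?S}"
    by (rule submodule_sum_insert) (use insert in \<open>auto simp: left_stable_def\<close>)
  have "left_stable R A ?S'"
    unfolding left_stable_def
  proof (intro conjI ballI)
    show "?S' \<subseteq> carrier R" unfolding eq using c by auto
    have "\<zero> = \<zero> \<oplus> \<zero>" by simp
    then show "\<zero> \<in> ?S'" unfolding eq using c by blast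
    fix x assume "x \<in> ?S'"
    then obtain n s where x: "x = n \<oplus> s" "n \<in> N i" "s \<in> ?S" unfolding eq by auto
    {
      fix y assume "y \<in> ?S'"
      then obtain m t where y: "y = m \<oplus> t" "m \<in> N i" "t \<in> ?S" unfolding eq by auto
      have "x \<oplus> y = (n \<oplus> m) \<oplus> (s \<oplus> t)" using x y c by (simp add: a_ac subset_iff)
      then show "x \<oplus> y \<in> ?S'" unfolding eq using x y S Ni unfolding left_stable_def by blast
    }
    fix a assume a: "a \<in> A"
    then have "a \<otimes> x = a \<otimes> n \<oplus> a \<otimes> s" using x c assms(3) by (simp add: r_distr subset_iff)
    then show "a \<otimes> x \<in> ?S'" unfolding eq using x a S Ni unfolding left_stable_def by blast
  qed
  moreover have "N i \<subseteq> ?S'"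
  proof
    fix n assume "n \<in> N i"
    moreover have "n = n \<oplus> \<zero>" using calculation c by auto
    ultimately show "n \<in> ?S'" unfolding eq using c by blast
  qed
  moreover have "?S \<subseteq> ?S'"
  proof
    fix n assume "n \<in> ?S"
    moreover have "n = \<zero> \<oplus> n" using calculation c by auto
    ultimately show "n \<in> ?S'" unfolding eq using c by blast
  qed
  ultimately show ?case using S by blast
qed

text \<open>\<open>Y\<close> is merely additively closed because the lemma is applied to left ideals
  and also, in \<open>distinct_left\<close>, to an \<open>R\<close>-submodule that is not known to
  be a left ideal.\<close>

lemma submodule_sum_minimal:
  assumes "finite T" "\<And>i. i \<in> T \<Longrightarrow> N i \<subseteq> Y" "Y \<subseteq> carrier R" "\<zero> \<in> Y"
    and "\<And>x y. x \<in> Y \<Longrightarrow> y \<in> Y \<Longrightarrow> x \<oplus> y \<in> Y"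
  shows "submodule_sum R T N \<subseteq> Y"
  using assms(1,2)
proof (induction T rule: finite_induct)
  case empty
  then show ?case using assms by (simp add: submodule_sum_empty)
next
  case (insert i T)
  have eq: "submodule_sum R (insert i T) N = {x \<oplus> y |x y. x \<in> N i \<and> y \<in> submodule_sum R T N}"
  proof (rule submodule_sum_insert[OF insert.hyps])
    show "N j \<subseteq> carrier R" if "j \<in> insert i T" for j using insert.prems[OF that] assms(3) by simp
  qed
  have "N i \<subseteq> Y" "submodule_sum R T N \<subseteq> Y" using insert.prems insert.IH by simp_all
  then show ?case unfolding eq using assms(5) by (auto simp: subset_iff)
qed

lemma left_stable_principal_left:
  assumes "x \<in> carrier R"
  shows "left_stable R (carrier R) (principal_left R x)" "x \<in> principal_left R x"
proof -
  show "left_stable R (carrier R) (principal_left R x)"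
    unfolding left_stable_def principal_left_def
  proof (intro conjI ballI)
    show "(\<lambda>y. y \<otimes> x) ` carrier R \<subseteq> carrier R" using assms by auto
    show "\<zero> \<in> (\<lambda>y. y \<otimes> x) ` carrier R" using assms by (auto intro!: image_eqI[of _ _ \<zero>])
    fix a assume "a \<in> (\<lambda>y. y \<otimes> x) ` carrier R"
    then obtain a' where a: "a = a' \<otimes> x" "a' \<in> carrier R" by auto
    show "a \<oplus> b \<in> (\<lambda>y. y \<otimes> x) ` carrier R" if b: "b \<in> (\<lambda>y. y \<otimes> x) ` carrier R" for b
    proof -
      obtain b' where "b = b' \<otimes> x" "b' \<in> carrier R" using b by blast
      then show ?thesis using a assms by (auto simp: l_distr intro!: image_eqI[of _ _ "a' \<oplus> b'"])
    qed
    show "c \<otimes> a \<in> (\<lambda>y. y \<otimes> x) ` carrier R" if "c \<in> carrier R" for c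
      using a assms that by (auto simp: m_assoc intro!: image_eqI[of _ _ "c \<otimes> a'"])
  qed
  show "x \<in> principal_left R x" unfolding principal_left_def using assms
    by (auto intro!: image_eqI[of _ _ \<one>])
qed

lemma principal_left_minimal:
  "left_stable R (carrier R) L \<Longrightarrow> x \<in> L \<Longrightarrow> principal_left R x \<subseteq> L"
  unfolding principal_left_def left_stable_def by auto

end

section \<open>Local cyclic modules, and the arrow-radical and arrow-distinct conditions on the
  left\<close>

section \<open>Algebras with a split radical quotient\<close>

context assoc_algebra
begin

lemma smult_one_mult: "r \<in> carrier R \<Longrightarrow> x \<in> carrier M \<Longrightarrow> (r \<odot>\<^bsub>M\<^esub> \<one>\<^bsub>M\<^esub>) \<otimes>\<^bsub>M\<^esub> x = r \<odot>\<^bsub>M\<^esub> x"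
  by (simp add: smult_mult_left)

text \<open>The scalar \<open>r\<close> acts as left multiplication by the algebra element r 1, so
  left ideals are \<open>R\<close>-submodules.\<close>

lemma left_stable_smult:
  assumes "left_stable M (carrier M) L" "r \<in> carrier R" "x \<in> L"
  shows "r \<odot>\<^bsub>M\<^esub> x \<in> L"
proof -
  have "x \<in> carrier M" using assms unfolding left_stable_def by auto
  moreover have "(r \<odot>\<^bsub>M\<^esub> \<one>\<^bsub>M\<^esub>) \<otimes>\<^bsub>M\<^esub> x \<in> L" using assms unfolding left_stable_def by simp
  ultimately show ?thesis using smult_one_mult assms by simp
qed

lemma left_stable_submodule: "left_stable M (carrier M) L \<Longrightarrow> submodule L R M"
  by (rule submoduleI') (simp_all add: left_stable_smult, simp_all add: left_stable_def)

end

text \<open>What survives of the hypotheses once the idempotents are lifted.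
  \<open>carrier_span\<close> carries the elementary condition: the classes of the
  \<open>e v\<close> span the quotient by \<open>J\<close> over \<open>R\<close>.
  \<open>smult_in_J\<close> says that the maximal ideal \<open>P\<close> kills this quotient. The
  assumptions pass to the opposite ring, which is how right-sided results are obtained.\<close>

locale split_algebra = assoc_algebra R M for R (structure) and M (structure) +
  fixes P :: "'a set" and J :: "'c set" and V :: "'v set" and e :: "'v \<Rightarrow> 'c"
  assumes noetherian: "noetherian_ring R"
    and finitely_generated: "\<exists>S. finite S \<and> S \<subseteq> carrier M \<and> carrier M \<subseteq> rspan S"
    and Units_if_notin: "r \<in> carrier R \<Longrightarrow> r \<notin> P \<Longrightarrow> r \<in> Units R"
    and smult_in_J: "r \<in> carrier R \<Longrightarrow> r \<in> P \<Longrightarrow> x \<in> carrier M \<Longrightarrow> r \<odot>\<^bsub>M\<^esub> x \<in> J"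
    and J_ideal: "ideal J M"
    and quasi_regular: "x \<in> J \<Longrightarrow> \<one>\<^bsub>M\<^esub> \<ominus>\<^bsub>M\<^esub> x \<in> Units M"
    and finite_V: "finite V"
    and e_closed: "v \<in> V \<Longrightarrow> e v \<in> carrier M"
    and e_mult: "v \<in> V \<Longrightarrow> w \<in> V \<Longrightarrow> e v \<otimes>\<^bsub>M\<^esub> e w = (if v = w then e v else \<zero>\<^bsub>M\<^esub>)"
    and e_nonzero: "v \<in> V \<Longrightarrow> e v \<noteq> \<zero>\<^bsub>M\<^esub>"
    and e_sum: "(\<Oplus>\<^bsub>M\<^esub>v\<in>V. e v) = \<one>\<^bsub>M\<^esub>"
    and carrier_span: "carrier M \<subseteq> rspan (J \<union> e ` V)"
begin

lemma J_subset: "J \<subseteq> carrier M"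
  using J_ideal ideal.axioms(1) additive_subgroup.a_subset by blast

lemma J_closed [simp]: "x \<in> J \<Longrightarrow> x \<in> carrier M"
  using J_subset by auto

lemma J_mult: "x \<in> J \<Longrightarrow> y \<in> carrier M \<Longrightarrow> x \<otimes>\<^bsub>M\<^esub> y \<in> J" "x \<in> J \<Longrightarrow> y \<in> carrier M \<Longrightarrow> y \<otimes>\<^bsub>M\<^esub> x \<in> J"
  using J_ideal by (simp_all add: ideal.I_r_closed ideal.I_l_closed)

lemma left_stable_J: "left_stable M (carrier M) J"
  using J_ideal ideal.axioms(1)[OF J_ideal] J_subset J_mult unfolding left_stable_def
  by (auto simp: additive_subgroup.a_closed additive_subgroup.zero_closed)

lemma submodule_J: "submodule J R M"
  by (rule left_stable_submodule[OF left_stable_J])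

lemma J_add: "x \<in> J \<Longrightarrow> y \<in> J \<Longrightarrow> x \<oplus>\<^bsub>M\<^esub> y \<in> J"
  and J_zero: "\<zero>\<^bsub>M\<^esub> \<in> J"
  and J_smult: "r \<in> carrier R \<Longrightarrow> x \<in> J \<Longrightarrow> r \<odot>\<^bsub>M\<^esub> x \<in> J"
  and J_neg: "x \<in> J \<Longrightarrow> \<ominus>\<^bsub>M\<^esub> x \<in> J"
  using submodule_add submodule_zero submodule_smult submoduleE(3) submodule_J by blast+

lemma quasi_regular_inverse: "x \<in> J \<Longrightarrow> \<exists>u\<in>carrier M. u \<otimes>\<^bsub>M\<^esub> (\<one>\<^bsub>M\<^esub> \<ominus>\<^bsub>M\<^esub> x) = \<one>\<^bsub>M\<^esub>"
  using quasi_regular unfolding Units_def by blast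

lemma carrier_induct:
  assumes "submodule N R M" "J \<subseteq> N" "\<And>v. v \<in> V \<Longrightarrow> e v \<in> N"
  shows "carrier M \<subseteq> N"
  using carrier_span rspan_minimal[OF assms(1), of "J \<union> e ` V"] assms(2,3) by blast

lemma finitely_generated_submodule:
  assumes "submodule N R M"
  shows "\<exists>G. finite G \<and> G \<subseteq> N \<and> N \<subseteq> rspan G"
proof -
  obtain S where S: "finite S" "S \<subseteq> carrier M" "carrier M \<subseteq> rspan S" using finitely_generated by blast
  have "N \<subseteq> rspan S" using submodule_subset[OF assms] S(3) by (rule subset_trans)
  then show ?thesis by (rule noetherian_submodule[OF noetherian S(1,2) assms])
qed

text \<open>Since y = e_v y, each \<open>e w\<close> with w different from v kills \<open>y\<close>,
  while \<open>e v\<close> fixes it; so modulo J y the algebra acts on \<open>y\<close> through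
  scalars of \<open>R\<close>. The \<open>x\<close> of the required form make up a submodule
  containing \<open>J\<close> and all \<open>e w\<close>.\<close>

lemma mult_local_form:
  assumes v: "v \<in> V" and y: "y \<in> carrier M" "e v \<otimes>\<^bsub>M\<^esub> y = y" and x: "x \<in> carrier M"
  shows "\<exists>r\<in>carrier R. \<exists>j\<in>J. x \<otimes>\<^bsub>M\<^esub> y = r \<odot>\<^bsub>M\<^esub> y \<oplus>\<^bsub>M\<^esub> j \<otimes>\<^bsub>M\<^esub> y"
proof -
  let ?D = "{x \<in> carrier M. \<exists>r\<in>carrier R. \<exists>j\<in>J. x \<otimes>\<^bsub>M\<^esub> y = r \<odot>\<^bsub>M\<^esub> y \<oplus>\<^bsub>M\<^esub> j \<otimes>\<^bsub>M\<^esub> y}"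
  have "submodule ?D R M"
  proof (rule submoduleI')
    show "\<zero>\<^bsub>M\<^esub> \<in> ?D" using y by (auto intro!: bexI[of _ \<zero>] bexI[of _ "\<zero>\<^bsub>M\<^esub>"] simp: J_zero)
  next
    fix a b assume "a \<in> ?D" "b \<in> ?D"
    then obtain r j s k where *: "a \<in> carrier M" "b \<in> carrier M" "r \<in> carrier R" "j \<in> J"
      "a \<otimes>\<^bsub>M\<^esub> y = r \<odot>\<^bsub>M\<^esub> y \<oplus>\<^bsub>M\<^esub> j \<otimes>\<^bsub>M\<^esub> y" "s \<in> carrier R" "k \<in> J"
      "b \<otimes>\<^bsub>M\<^esub> y = s \<odot>\<^bsub>M\<^esub> y \<oplus>\<^bsub>M\<^esub> k \<otimes>\<^bsub>M\<^esub> y" by auto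
    then have "(a \<oplus>\<^bsub>M\<^esub> b) \<otimes>\<^bsub>M\<^esub> y = (r \<oplus> s) \<odot>\<^bsub>M\<^esub> y \<oplus>\<^bsub>M\<^esub> (j \<oplus>\<^bsub>M\<^esub> k) \<otimes>\<^bsub>M\<^esub> y"
      using y by (simp add: l_distr smult_l_distr M.a_ac)
    then show "a \<oplus>\<^bsub>M\<^esub> b \<in> ?D" using * J_add by (auto intro!: bexI[of _ "r \<oplus> s"] bexI[of _ "j \<oplus>\<^bsub>M\<^esub> k"])
  next
    fix c a assume c: "c \<in> carrier R" and "a \<in> ?D"
    then obtain r j where *: "a \<in> carrier M" "r \<in> carrier R" "j \<in> J"
      "a \<otimes>\<^bsub>M\<^esub> y = r \<odot>\<^bsub>M\<^esub> y \<oplus>\<^bsub>M\<^esub> j \<otimes>\<^bsub>M\<^esub> y" by auto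
    then have "(c \<odot>\<^bsub>M\<^esub> a) \<otimes>\<^bsub>M\<^esub> y = (c \<otimes> r) \<odot>\<^bsub>M\<^esub> y \<oplus>\<^bsub>M\<^esub> (c \<odot>\<^bsub>M\<^esub> j) \<otimes>\<^bsub>M\<^esub> y"
      using y c by (simp add: smult_r_distr smult_assoc1 smult_mult_left)
    then show "c \<odot>\<^bsub>M\<^esub> a \<in> ?D" using * c J_smult
      by (auto intro!: bexI[of _ "c \<otimes> r"] bexI[of _ "c \<odot>\<^bsub>M\<^esub> j"])
  qed auto
  moreover have "J \<subseteq> ?D"
  proof
    fix x assume "x \<in> J"
    then show "x \<in> ?D" using y by (auto intro!: bexI[of _ \<zero>] bexI[of _ x])
  qed
  moreover have "e w \<in> ?D" if w: "w \<in> V" for w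
  proof -
    have "e w \<otimes>\<^bsub>M\<^esub> y = e w \<otimes>\<^bsub>M\<^esub> (e v \<otimes>\<^bsub>M\<^esub> y)" using y by simp
    also have "\<dots> = (e w \<otimes>\<^bsub>M\<^esub> e v) \<otimes>\<^bsub>M\<^esub> y" using e_closed v w y by (simp add: m_assoc)
    also have "\<dots> = (if w = v then \<one> else \<zero>) \<odot>\<^bsub>M\<^esub> y \<oplus>\<^bsub>M\<^esub> \<zero>\<^bsub>M\<^esub> \<otimes>\<^bsub>M\<^esub> y" using y v w by (simp add: e_mult)
    finally show ?thesis using e_closed[OF w] J_zero by auto
  qed
  ultimately have "carrier M \<subseteq> ?D" by (rule carrier_induct)
  then show ?thesis using x by auto
qed

text \<open>J y is proper because y = j y would give (1 - j) y = 0 with 1 - j invertible. An element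
  r y + j y of \<open>L\<close> is (r 1 + j) y, which is in J y if r lies in \<open>P\<close>;
  otherwise, dividing by r leaves (1 + k) y in \<open>L\<close> with k in \<open>J\<close>, whence y
  is in \<open>L\<close> and \<open>L\<close> is everything.\<close>

lemma largest_submodule_principal:
  assumes v: "v \<in> V" and y: "y \<in> carrier M" "e v \<otimes>\<^bsub>M\<^esub> y = y" "y \<noteq> \<zero>\<^bsub>M\<^esub>"
  defines "N \<equiv> (\<lambda>j. j \<otimes>\<^bsub>M\<^esub> y) ` J"
  shows "left_stable M (carrier M) N" and "N \<subset> principal_left M y"
    and "\<And>L. left_stable M (carrier M) L \<Longrightarrow> L \<subseteq> principal_left M y \<Longrightarrow> L \<noteq> principal_left M y \<Longrightarrow> L \<subseteq> N"
proof -
  show "left_stable M (carrier M) N"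
    unfolding left_stable_def
  proof (intro conjI ballI)
    show "N \<subseteq> carrier M" unfolding N_def using y by auto
    show "\<zero>\<^bsub>M\<^esub> \<in> N" unfolding N_def using J_zero y by (auto intro!: image_eqI[of _ _ "\<zero>\<^bsub>M\<^esub>"])
    fix a assume "a \<in> N"
    then obtain j where a: "j \<in> J" "a = j \<otimes>\<^bsub>M\<^esub> y" unfolding N_def by blast
    {
      fix b assume "b \<in> N"
      then obtain k where b: "k \<in> J" "b = k \<otimes>\<^bsub>M\<^esub> y" unfolding N_def by blast
      have "a \<oplus>\<^bsub>M\<^esub> b = (j \<oplus>\<^bsub>M\<^esub> k) \<otimes>\<^bsub>M\<^esub> y" using a b y by (simp add: l_distr)
      then show "a \<oplus>\<^bsub>M\<^esub> b \<in> N" unfolding N_def using a b J_add by blast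
    }
    fix c assume c: "c \<in> carrier M"
    have "c \<otimes>\<^bsub>M\<^esub> a = (c \<otimes>\<^bsub>M\<^esub> j) \<otimes>\<^bsub>M\<^esub> y" using a c y by (simp add: m_assoc)
    then show "c \<otimes>\<^bsub>M\<^esub> a \<in> N" unfolding N_def using a c J_mult by blast
  qed
  have "y \<notin> N"
  proof
    assume "y \<in> N"
    then obtain j where j: "j \<in> J" "y = j \<otimes>\<^bsub>M\<^esub> y" unfolding N_def by blast
    obtain u where u: "u \<in> carrier M" "u \<otimes>\<^bsub>M\<^esub> (\<one>\<^bsub>M\<^esub> \<ominus>\<^bsub>M\<^esub> j) = \<one>\<^bsub>M\<^esub>" using quasi_regular_inverse j by blast
    have "(\<one>\<^bsub>M\<^esub> \<ominus>\<^bsub>M\<^esub> j) \<otimes>\<^bsub>M\<^esub> y = y \<ominus>\<^bsub>M\<^esub> j \<otimes>\<^bsub>M\<^esub> y" using j(1) y(1) by (simp add: a_minus_def l_distr l_minus)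
    also have "\<dots> = \<zero>\<^bsub>M\<^esub>" using j y by (metis M.r_neg a_minus_def)
    finally have "u \<otimes>\<^bsub>M\<^esub> ((\<one>\<^bsub>M\<^esub> \<ominus>\<^bsub>M\<^esub> j) \<otimes>\<^bsub>M\<^esub> y) = \<zero>\<^bsub>M\<^esub>" using u by simp
    moreover have "u \<otimes>\<^bsub>M\<^esub> ((\<one>\<^bsub>M\<^esub> \<ominus>\<^bsub>M\<^esub> j) \<otimes>\<^bsub>M\<^esub> y) = y" using u y j(1) by (simp flip: m_assoc)
    ultimately show False using y by simp
  qed
  moreover have "N \<subseteq> principal_left M y" unfolding N_def principal_left_def by auto
  ultimately show "N \<subset> principal_left M y" using left_stable_principal_left(2)[OF y(1)] by auto
  fix L assume L: "left_stable M (carrier M) L" "L \<subseteq> principal_left M y" "L \<noteq> principal_left M y"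
  show "L \<subseteq> N"
  proof
    fix z assume z: "z \<in> L"
    then obtain x where x: "z = x \<otimes>\<^bsub>M\<^esub> y" "x \<in> carrier M" using L unfolding principal_left_def by auto
    then obtain r j where rj: "r \<in> carrier R" "j \<in> J" "z = r \<odot>\<^bsub>M\<^esub> y \<oplus>\<^bsub>M\<^esub> j \<otimes>\<^bsub>M\<^esub> y"
      using mult_local_form[OF v y(1,2) x(2)] by blast
    show "z \<in> N"
    proof (cases "r \<in> P")
      case True
      then have "r \<odot>\<^bsub>M\<^esub> \<one>\<^bsub>M\<^esub> \<oplus>\<^bsub>M\<^esub> j \<in> J" using rj smult_in_J J_add by auto
      moreover have "z = (r \<odot>\<^bsub>M\<^esub> \<one>\<^bsub>M\<^esub> \<oplus>\<^bsub>M\<^esub> j) \<otimes>\<^bsub>M\<^esub> y" using rj y by (simp add: l_distr smult_one_mult)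
      ultimately show ?thesis unfolding N_def by blast
    next
      case False
      then obtain s where s: "s \<in> carrier R" "s \<otimes> r = \<one>" using Units_if_notin rj(1) unfolding Units_def by blast
      let ?k = "s \<odot>\<^bsub>M\<^esub> j"
      have k: "?k \<in> J" using J_smult s rj by auto
      have "s \<odot>\<^bsub>M\<^esub> z = y \<oplus>\<^bsub>M\<^esub> ?k \<otimes>\<^bsub>M\<^esub> y"
        using rj s y by (simp add: smult_r_distr smult_mult_left flip: smult_assoc1)
      \<comment> \<open>The sum 1 + k appears as 1 - (-k) to fit
        \<open>quasi_regular_inverse\<close>.\<close>
      also have "\<dots> = (\<one>\<^bsub>M\<^esub> \<ominus>\<^bsub>M\<^esub> (\<ominus>\<^bsub>M\<^esub> ?k)) \<otimes>\<^bsub>M\<^esub> y" using J_closed[OF k] y by (simp add: a_minus_def l_distr)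
      finally have "(\<one>\<^bsub>M\<^esub> \<ominus>\<^bsub>M\<^esub> (\<ominus>\<^bsub>M\<^esub> ?k)) \<otimes>\<^bsub>M\<^esub> y \<in> L" using left_stable_smult[OF L(1) s(1) z] by simp
      moreover obtain u where u: "u \<in> carrier M" "u \<otimes>\<^bsub>M\<^esub> (\<one>\<^bsub>M\<^esub> \<ominus>\<^bsub>M\<^esub> (\<ominus>\<^bsub>M\<^esub> ?k)) = \<one>\<^bsub>M\<^esub>"
        using quasi_regular_inverse J_neg[OF k] by blast
      ultimately have "u \<otimes>\<^bsub>M\<^esub> ((\<one>\<^bsub>M\<^esub> \<ominus>\<^bsub>M\<^esub> (\<ominus>\<^bsub>M\<^esub> ?k)) \<otimes>\<^bsub>M\<^esub> y) \<in> L" using L(1) unfolding left_stable_def by blast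
      moreover have "u \<otimes>\<^bsub>M\<^esub> ((\<one>\<^bsub>M\<^esub> \<ominus>\<^bsub>M\<^esub> (\<ominus>\<^bsub>M\<^esub> ?k)) \<otimes>\<^bsub>M\<^esub> y) = y"
        using u J_closed[OF k] y by (simp flip: m_assoc)
      ultimately have "principal_left M y \<subseteq> L" using principal_left_minimal[OF L(1)] by simp
      then show ?thesis using L by auto
    qed
  qed
qed

lemma module_rad_principal_left:
  assumes "v \<in> V" "y \<in> carrier M" "e v \<otimes>\<^bsub>M\<^esub> y = y" "y \<noteq> \<zero>\<^bsub>M\<^esub>"
  shows "local_module (left_ideal M) (principal_left M y)"
    and "module_rad (left_ideal M) (principal_left M y) = (\<lambda>j. j \<otimes>\<^bsub>M\<^esub> y) ` J"
  using unique_maximal_submodule[of "left_ideal M" "(\<lambda>j. j \<otimes>\<^bsub>M\<^esub> y) ` J" "principal_left M y"]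
    largest_submodule_principal[OF assms] by (auto simp: left_ideal_iff)

end

text \<open>\<open>generating\<close> and \<open>minimal\<close> say that the
  \<open>\<beta> a\<close> generate J/J^2 over \<open>R\<close> and that omitting any one of them
  destroys this. Quantifying over the submodules that contain all products of two elements of
  \<open>J\<close> replaces the formation of J^2.\<close>

locale arrow_algebra = split_algebra R M P J V e for R (structure) and M (structure) and P J V e +
  fixes E :: "'e set" and \<beta> :: "'e \<Rightarrow> 'c" and hd tl :: "'e \<Rightarrow> 'v"
  assumes finite_E: "finite E"
    and arrow_J: "a \<in> E \<Longrightarrow> \<beta> a \<in> J"
    and hd_V: "a \<in> E \<Longrightarrow> hd a \<in> V" and tl_V: "a \<in> E \<Longrightarrow> tl a \<in> V"
    and e_hd: "a \<in> E \<Longrightarrow> e (hd a) \<otimes>\<^bsub>M\<^esub> \<beta> a = \<beta> a"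
    and e_tl: "a \<in> E \<Longrightarrow> \<beta> a \<otimes>\<^bsub>M\<^esub> e (tl a) = \<beta> a"
    and generating: "submodule N R M \<Longrightarrow> (\<And>a. a \<in> E \<Longrightarrow> \<beta> a \<in> N) \<Longrightarrow>
      (\<And>x y. x \<in> J \<Longrightarrow> y \<in> J \<Longrightarrow> x \<otimes>\<^bsub>M\<^esub> y \<in> N) \<Longrightarrow> J \<subseteq> N"
    and minimal: "a \<in> E \<Longrightarrow> \<exists>N. submodule N R M \<and> (\<forall>b\<in>E - {a}. \<beta> b \<in> N) \<and>
      (\<forall>x\<in>J. \<forall>y\<in>J. x \<otimes>\<^bsub>M\<^esub> y \<in> N) \<and> \<not> J \<subseteq> N"
begin

lemma arrow_closed [simp]: "a \<in> E \<Longrightarrow> \<beta> a \<in> carrier M"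
  using arrow_J by auto

text \<open>A zero arrow would be redundant, against \<open>minimal\<close>. This is the source of
  permissibility.\<close>

lemma arrow_nonzero: "a \<in> E \<Longrightarrow> \<beta> a \<noteq> \<zero>\<^bsub>M\<^esub>"
proof
  assume a: "a \<in> E" and 0: "\<beta> a = \<zero>\<^bsub>M\<^esub>"
  obtain N where N: "submodule N R M" "\<forall>b\<in>E - {a}. \<beta> b \<in> N"
    "\<forall>x\<in>J. \<forall>y\<in>J. x \<otimes>\<^bsub>M\<^esub> y \<in> N" "\<not> J \<subseteq> N" using minimal[OF a] by blast
  then have "\<beta> b \<in> N" if "b \<in> E" for b using that 0 submodule_zero[OF N(1)] by (cases "b = a") auto
  then show False using generating[OF N(1)] N by blast
qed

text \<open>Modulo J^2 the algebra acts on an arrow through scalars, by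
  \<open>mult_local_form\<close>. Hence minimality over \<open>R\<close> controls the left ideals
  generated by arrows.\<close>

lemma mult_arrow_in_submodule:
  assumes L: "submodule L R M" and J2: "\<And>x y. x \<in> J \<Longrightarrow> y \<in> J \<Longrightarrow> x \<otimes>\<^bsub>M\<^esub> y \<in> L"
    and a: "a \<in> E" "\<beta> a \<in> L" and x: "x \<in> carrier M"
  shows "x \<otimes>\<^bsub>M\<^esub> \<beta> a \<in> L"
proof -
  obtain r j where "r \<in> carrier R" "j \<in> J" "x \<otimes>\<^bsub>M\<^esub> \<beta> a = r \<odot>\<^bsub>M\<^esub> \<beta> a \<oplus>\<^bsub>M\<^esub> j \<otimes>\<^bsub>M\<^esub> \<beta> a"
    using mult_local_form[OF hd_V[OF a(1)] _ e_hd[OF a(1)] x] a by auto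
  then show ?thesis using submodule_add[OF L] submodule_smult[OF L] J2 arrow_J a by auto
qed

text \<open>Nakayama's lemma for J/(J \<inter> L): \<open>J\<close> is finitely generated over
  \<open>R\<close>, and \<open>generating\<close> places it in L + J J.\<close>

lemma J_generated:
  assumes L: "left_stable M (carrier M) L" and \<beta>: "\<And>a. a \<in> E \<Longrightarrow> \<beta> a \<in> L"
  shows "J \<subseteq> L"
proof -
  obtain G where G: "finite G" "G \<subseteq> J" "J \<subseteq> rspan G" using finitely_generated_submodule[OF submodule_J] by blast
  have "G \<subseteq> L"
  proof (rule nakayama[OF subset_refl left_stable_J J_subset _ _ _ _ G(1) _ L])
    show "G \<subseteq> carrier M" using G J_subset by auto
    fix Y assume Y: "left_stable M (carrier M) Y" "L \<subseteq> Y" and JG: "\<And>p s. p \<in> J \<Longrightarrow> s \<in> G \<Longrightarrow> p \<otimes>\<^bsub>M\<^esub> s \<in> Y"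
    note Ys = left_stable_submodule[OF Y(1)]
    \<comment> \<open>The products p s are known to lie in \<open>Y\<close> only for
      \<open>s\<close> in \<open>G\<close>. The elements \<open>y\<close> with J y inside
      \<open>Y\<close> form an \<open>R\<close>-submodule, so all of J J lies in \<open>Y\<close>
      and \<open>generating\<close> applies to \<open>Y\<close>.\<close>
    let ?Z = "{y \<in> carrier M. \<forall>p\<in>J. p \<otimes>\<^bsub>M\<^esub> y \<in> Y}"
    have "submodule ?Z R M"
      by (rule submoduleI')
        (use submodule_add[OF Ys] submodule_smult[OF Ys] submodule_zero[OF Ys]
          in \<open>auto simp: r_distr smult_mult_right\<close>)
    moreover have "G \<subseteq> ?Z" using G JG by auto
    ultimately have "J \<subseteq> ?Z" using rspan_minimal G by blast
    then have "J \<subseteq> Y" using \<beta> Y by (intro generating[OF Ys]) auto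
    then show "G \<subseteq> Y" using G by auto
  qed (use quasi_regular_inverse in auto)
  then show ?thesis using G rspan_minimal[OF left_stable_submodule[OF L]] by blast
qed

lemma left_stable_sum_arrows:
  assumes "T \<subseteq> E"
  shows "left_stable M (carrier M) (submodule_sum M T (\<lambda>a. principal_left M (\<beta> a)))"
    and "a \<in> T \<Longrightarrow> \<beta> a \<in> submodule_sum M T (\<lambda>a. principal_left M (\<beta> a))"
proof -
  have "finite T" using assms finite_E finite_subset by blast
  then have *: "left_stable M (carrier M) (submodule_sum M T (\<lambda>a. principal_left M (\<beta> a))) \<and>
      (\<forall>a\<in>T. principal_left M (\<beta> a) \<subseteq> submodule_sum M T (\<lambda>a. principal_left M (\<beta> a)))"
    by (rule left_stable_submodule_sum) (use assms left_stable_principal_left in auto)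
  then show "left_stable M (carrier M) (submodule_sum M T (\<lambda>a. principal_left M (\<beta> a)))" by auto
  show "a \<in> T \<Longrightarrow> \<beta> a \<in> submodule_sum M T (\<lambda>a. principal_left M (\<beta> a))"
    using * left_stable_principal_left(2)[OF arrow_closed] assms by blast
qed

text \<open>\<open>J\<close> is the left ideal generated by the arrows, and right multiplication by
  \<open>e v\<close> fixes the arrows with tail \<open>v\<close> and kills the others.\<close>

lemma J_mult_e:
  assumes v: "v \<in> V"
  shows "(\<lambda>j. j \<otimes>\<^bsub>M\<^esub> e v) ` J = submodule_sum M {a \<in> E. tl a = v} (\<lambda>a. principal_left M (\<beta> a))"
    (is "?N = ?S")
proof
  note ev = e_closed[OF v]
  have S: "left_stable M (carrier M) ?S" and \<beta>S: "\<And>a. a \<in> E \<Longrightarrow> tl a = v \<Longrightarrow> \<beta> a \<in> ?S"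
    using left_stable_sum_arrows[of "{a \<in> E. tl a = v}"] by auto
  \<comment> \<open>The preimage of \<open>?S\<close> under right multiplication by
    \<open>e v\<close> is a left ideal, so it contains \<open>J\<close> once it contains the
    arrows.\<close>
  let ?L = "{x \<in> carrier M. x \<otimes>\<^bsub>M\<^esub> e v \<in> ?S}"
  have "left_stable M (carrier M) ?L"
    using S ev unfolding left_stable_def by (auto simp: l_distr m_assoc)
  moreover have "\<beta> a \<in> ?L" if a: "a \<in> E" for a
  proof -
    have "\<beta> a \<otimes>\<^bsub>M\<^esub> e v = (\<beta> a \<otimes>\<^bsub>M\<^esub> e (tl a)) \<otimes>\<^bsub>M\<^esub> e v" using e_tl a by simp
    also have "\<dots> = \<beta> a \<otimes>\<^bsub>M\<^esub> (e (tl a) \<otimes>\<^bsub>M\<^esub> e v)" using a v tl_V by (simp add: m_assoc e_closed)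
    also have "\<dots> = (if tl a = v then \<beta> a else \<zero>\<^bsub>M\<^esub>)" using a v tl_V e_tl[OF a] by (auto simp: e_mult)
    finally show ?thesis using a \<beta>S S unfolding left_stable_def by auto
  qed
  ultimately have "J \<subseteq> ?L" by (rule J_generated)
  then show "?N \<subseteq> ?S" by auto
  have N: "left_stable M (carrier M) ?N"
    using largest_submodule_principal(1)[OF v ev] e_mult[OF v v] e_nonzero[OF v] by simp
  show "?S \<subseteq> ?N"
  proof (rule submodule_sum_minimal)
    show "finite {a \<in> E. tl a = v}" using finite_E by simp
    show "principal_left M (\<beta> a) \<subseteq> ?N" if "a \<in> {a \<in> E. tl a = v}" for a
    proof (rule principal_left_minimal[OF N])
      show "\<beta> a \<in> ?N" using that arrow_J e_tl by (auto intro!: image_eqI[of _ _ "\<beta> a"])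
    qed
  qed (use N in \<open>auto simp: left_stable_def\<close>)
qed

lemma radical_left:
  assumes v: "v \<in> V"
  shows "local_module (left_ideal M) (principal_left M (e v))"
    and "module_rad (left_ideal M) (principal_left M (e v)) =
      submodule_sum M {a \<in> E. tl a = v} (\<lambda>a. principal_left M (\<beta> a))"
  using module_rad_principal_left[OF v e_closed[OF v] _ e_nonzero[OF v]] e_mult[OF v v] J_mult_e[OF v]
  by auto

text \<open>If \<open>z \<in> \<Gamma>\<beta> a\<close> is outside the radical then \<open>\<Gamma>z = \<Gamma>\<beta> a\<close>, so \<open>z \<in> \<Sum>\<Gamma>\<beta> b\<close> makes the arrow \<open>a\<close>
  redundant.\<close>

lemma distinct_left:
  assumes a: "a \<in> E"
  shows "principal_left M (\<beta> a) \<inter> submodule_sum M {b \<in> E. b \<noteq> a \<and> tl b = tl a} (\<lambda>b. principal_left M (\<beta> b))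
    \<subseteq> module_rad (left_ideal M) (principal_left M (\<beta> a))" (is "?A \<inter> ?S \<subseteq> ?N")
proof
  fix z assume z: "z \<in> ?A \<inter> ?S"
  note lp = largest_submodule_principal[OF hd_V[OF a] arrow_closed[OF a] e_hd[OF a] arrow_nonzero[OF a]]
  have N: "?N = (\<lambda>j. j \<otimes>\<^bsub>M\<^esub> \<beta> a) ` J"
    using module_rad_principal_left[OF hd_V[OF a] arrow_closed[OF a] e_hd[OF a] arrow_nonzero[OF a]] by simp
  have S: "left_stable M (carrier M) ?S"
    using left_stable_sum_arrows(1)[of "{b \<in> E. b \<noteq> a \<and> tl b = tl a}"] by auto
  have A: "left_stable M (carrier M) ?A" using left_stable_principal_left(1) a by simp
  show "z \<in> ?N"
  proof (rule ccontr)
    assume zN: "z \<notin> ?N"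
    have "left_stable M (carrier M) (?A \<inter> ?S)" using A S unfolding left_stable_def by auto
    then have sub: "?A \<inter> ?S \<subseteq> ?N" if "?A \<inter> ?S \<noteq> ?A"
      unfolding N by (rule lp(3)) (use that in \<open>simp_all\<close>)
    have AS: "?A \<inter> ?S = ?A"
    proof (rule ccontr)
      assume "?A \<inter> ?S \<noteq> ?A"
      from subsetD[OF sub[OF this] z] zN show False by contradiction
    qed
    have "\<beta> a \<in> ?A \<inter> ?S" unfolding AS using left_stable_principal_left(2) a by simp
    then have aS: "\<beta> a \<in> ?S" by (rule IntD2)
    obtain L where L: "submodule L R M" "\<forall>b\<in>E - {a}. \<beta> b \<in> L"
      "\<forall>x\<in>J. \<forall>y\<in>J. x \<otimes>\<^bsub>M\<^esub> y \<in> L" "\<not> J \<subseteq> L" using minimal[OF a] by blast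
    \<comment> \<open>\<open>L\<close> witnesses minimality at \<open>a\<close>: it contains J^2 and
      the other arrows, hence their left multiples. It would then contain \<open>\<beta> a\<close>
      as well, and so all of \<open>J\<close>.\<close>
    have "?S \<subseteq> L"
    proof (rule submodule_sum_minimal)
      show "finite {b \<in> E. b \<noteq> a \<and> tl b = tl a}" using finite_E by simp
      show "principal_left M (\<beta> b) \<subseteq> L" if "b \<in> {b \<in> E. b \<noteq> a \<and> tl b = tl a}" for b
        using mult_arrow_in_submodule[OF L(1), of b] L that unfolding principal_left_def by blast
    qed (use submodule_subset[OF L(1)] submodule_zero[OF L(1)] submodule_add[OF L(1)] in auto)
    then have "\<beta> b \<in> L" if "b \<in> E" for b using that L(2) aS by (cases "b = a") auto
    then show False using generating[OF L(1)] L by blast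
  qed
qed

end

section \<open>The path algebra as a unital associative algebra\<close>

section \<open>Path algebras\<close>

locale quiver_algebra = R?: cring R + Q?: fin_digraph Q
  for R :: "('r, 'm) ring_scheme" (structure) and Q :: "('v, 'e) pre_digraph"
begin

abbreviation PA :: "('r, ('v, 'e) path \<Rightarrow> 'r) module" where "PA \<equiv> path_algebra R Q"
abbreviation \<delta> :: "('v, 'e) path \<Rightarrow> ('v, 'e) path \<Rightarrow> 'r" where "\<delta> \<equiv> path_basis R"

lemma paths_iff: "p \<in> paths Q \<longleftrightarrow> awalk (fst p) (snd p) (path_head Q p)"
  unfolding paths_def path_head_def by (cases p) auto

lemma path_head_eq: "awalk u p v \<Longrightarrow> path_head Q (u, p) = v"
  unfolding path_head_def by auto

lemma path_head_Nil: "path_head Q (u, []) = u"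
  unfolding path_head_def by simp

lemma path_comp:
  assumes "p \<in> paths Q" "q \<in> paths Q" "path_tail p = path_head Q q"
  shows "path_comp p q \<in> paths Q" "path_head Q (path_comp p q) = path_head Q p"
    "path_tail (path_comp p q) = path_tail q"
proof -
  have "awalk (fst q) (snd q @ snd p) (path_head Q p)"
    using assms awalk_appendI unfolding paths_iff path_tail_def by metis
  then show "path_comp p q \<in> paths Q" "path_head Q (path_comp p q) = path_head Q p"
    unfolding path_comp_def paths_def by (auto simp: path_head_eq)
qed (simp add: path_comp_def path_tail_def)

lemma trivial_path: "(v, []) \<in> paths Q \<longleftrightarrow> v \<in> verts Q"
  unfolding paths_def by (auto simp: awalk_Nil_iff)

lemma path_ends_in_verts: "p \<in> paths Q \<Longrightarrow> path_head Q p \<in> verts Q" "p \<in> paths Q \<Longrightarrow> path_tail p \<in> verts Q"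
  unfolding paths_iff path_tail_def by auto

lemma PA_carrier:
  "f \<in> carrier PA \<longleftrightarrow> (\<forall>p \<in> paths Q. f p \<in> carrier R) \<and> (\<forall>p. p \<notin> paths Q \<longrightarrow> f p = \<zero>) \<and> finite {p. f p \<noteq> \<zero>}"
  unfolding path_algebra_def by simp

lemma PA_simps:
  "f \<oplus>\<^bsub>PA\<^esub> g = (\<lambda>p. f p \<oplus> g p)" "\<zero>\<^bsub>PA\<^esub> = (\<lambda>p. \<zero>)" "r \<odot>\<^bsub>PA\<^esub> f = (\<lambda>p. r \<otimes> f p)"
  "\<one>\<^bsub>PA\<^esub> = (\<lambda>p. if p \<in> paths Q \<and> snd p = [] then \<one> else \<zero>)"
  "f \<otimes>\<^bsub>PA\<^esub> g = (\<lambda>w. \<Oplus>x\<in>factorizations Q w. f (fst x) \<otimes> g (snd x))"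
  unfolding path_algebra_def by simp_all

lemma PA_outside: "f \<in> carrier PA \<Longrightarrow> p \<notin> paths Q \<Longrightarrow> f p = \<zero>"
  by (simp add: PA_carrier del: split_paired_All)

lemma PA_closed [simp]:
  assumes "f \<in> carrier PA"
  shows "f p \<in> carrier R"
proof (cases "p \<in> paths Q")
  case True
  then show ?thesis using assms unfolding PA_carrier by blast
next
  case False
  then show ?thesis using PA_outside[OF assms] by simp
qed

lemma PA_carrierI:
  assumes "\<And>p. f p \<in> carrier R" "{p. f p \<noteq> \<zero>} \<subseteq> A" "finite A" "A \<subseteq> paths Q"
  shows "f \<in> carrier PA"
  using assms finite_subset unfolding PA_carrier by blast

lemma PA_support: "f \<in> carrier PA \<Longrightarrow> finite {p. f p \<noteq> \<zero>}" "f \<in> carrier PA \<Longrightarrow> {p. f p \<noteq> \<zero>} \<subseteq> paths Q"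
  unfolding PA_carrier by auto

lemma module_PA: "module R PA"
proof (rule moduleI)
  show "abelian_group PA"
  proof (rule abelian_groupI)
    fix f g assume fg: "f \<in> carrier PA" "g \<in> carrier PA"
    show "f \<oplus>\<^bsub>PA\<^esub> g \<in> carrier PA"
      by (rule PA_carrierI[where A = "{p. f p \<noteq> \<zero>} \<union> {p. g p \<noteq> \<zero>}"])
        (use fg PA_support in \<open>auto simp: PA_simps\<close>)
    show "f \<oplus>\<^bsub>PA\<^esub> g = g \<oplus>\<^bsub>PA\<^esub> f" using fg by (auto simp: PA_simps R.a_comm)
  next
    fix f assume f: "f \<in> carrier PA"
    show "\<exists>g\<in>carrier PA. g \<oplus>\<^bsub>PA\<^esub> f = \<zero>\<^bsub>PA\<^esub>"
    proof (rule bexI)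
      show "(\<lambda>p. \<ominus> f p) \<oplus>\<^bsub>PA\<^esub> f = \<zero>\<^bsub>PA\<^esub>" using f by (auto simp: PA_simps R.l_neg)
      show "(\<lambda>p. \<ominus> f p) \<in> carrier PA"
        by (rule PA_carrierI[where A = "{p. f p \<noteq> \<zero>}"]) (use f PA_support in auto)
    qed
  qed (auto simp: PA_simps R.a_assoc PA_carrier)
next
  fix r f assume "r \<in> carrier R" "f \<in> carrier PA"
  then show "r \<odot>\<^bsub>PA\<^esub> f \<in> carrier PA"
    by (intro PA_carrierI[where A = "{p. f p \<noteq> \<zero>}"]) (use PA_support in \<open>auto simp: PA_simps\<close>)
qed (auto simp: PA_simps R.l_distr R.r_distr R.m_assoc R.cring_axioms)

sublocale P: module R PA by (rule module_PA)

lemma path_basis_closed: "p \<in> paths Q \<Longrightarrow> \<delta> p \<in> carrier PA"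
  by (rule PA_carrierI[where A = "{p}"]) (auto simp: path_basis_def)

text \<open>An \<open>R\<close>-linear property of elements of the path algebra has to be checked on
  paths only. Multilinear identities are reduced to paths by it, one argument at a time.\<close>

lemma PA_induct:
  assumes N: "submodule N R PA" and basis: "\<And>p. p \<in> paths Q \<Longrightarrow> \<delta> p \<in> N"
  shows "carrier PA \<subseteq> N"
proof -
  have "f \<in> N" if "finite S" "f \<in> carrier PA" "{p. f p \<noteq> \<zero>} \<subseteq> S" for S f
    using that
  proof (induction S arbitrary: f rule: finite_induct)
    case empty
    then have "f = \<zero>\<^bsub>PA\<^esub>" by (auto simp: PA_simps)
    then show ?case using P.submodule_zero[OF N] by simp
  next
    case (insert p S)
    note f = insert.prems(1)
    show ?case
    proof (cases "p \<in> paths Q")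
      case True
      let ?g = "f(p := \<zero>)"
      have g: "?g \<in> carrier PA"
        by (rule PA_carrierI[where A = "{p. f p \<noteq> \<zero>}"]) (use f PA_support in auto)
      then have "?g \<in> N" by (rule insert.IH) (use insert.prems(2) in auto)
      moreover have "f p \<odot>\<^bsub>PA\<^esub> \<delta> p \<in> N" using basis[OF True] P.submodule_smult[OF N] f by simp
      moreover have "f = f p \<odot>\<^bsub>PA\<^esub> \<delta> p \<oplus>\<^bsub>PA\<^esub> ?g"
        using f by (auto simp: PA_simps path_basis_def fun_eq_iff)
      ultimately show ?thesis using P.submodule_add[OF N] by metis
    next
      case False
      then have "f p = \<zero>" using f PA_outside by blast
      then show ?thesis using insert by (intro insert.IH) auto
    qed
  qed
  then show ?thesis using PA_support(1) by blast
qed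

text \<open>The support of a product lies in the finite set of composites of a path in the support
  of \<open>f\<close> with one in the support of \<open>g\<close>.\<close>

lemma PA_mult_closed:
  assumes "f \<in> carrier PA" "g \<in> carrier PA"
  shows "f \<otimes>\<^bsub>PA\<^esub> g \<in> carrier PA"
proof (rule PA_carrierI)
  let ?A = "{path_comp p q |p q. p \<in> {p. f p \<noteq> \<zero>} \<and> q \<in> {q. g q \<noteq> \<zero>} \<and> path_tail p = path_head Q q}"
  have "?A \<subseteq> (\<lambda>(p, q). path_comp p q) ` ({p. f p \<noteq> \<zero>} \<times> {q. g q \<noteq> \<zero>})" by auto
  then show "finite ?A" using PA_support(1) assms finite_subset by (metis (no_types, lifting) finite_SigmaI finite_imageI)
  show "?A \<subseteq> paths Q" using path_comp(1) PA_support(2) assms by blast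
  show "(f \<otimes>\<^bsub>PA\<^esub> g) w \<in> carrier R" for w using assms by (auto simp: PA_simps intro!: R.finsum_closed)
  show "{w. (f \<otimes>\<^bsub>PA\<^esub> g) w \<noteq> \<zero>} \<subseteq> ?A"
  proof
    fix w assume w: "w \<in> {w. (f \<otimes>\<^bsub>PA\<^esub> g) w \<noteq> \<zero>}"
    show "w \<in> ?A"
    proof (rule ccontr)
      assume n: "w \<notin> ?A"
      have "f (fst x) \<otimes> g (snd x) = \<zero>" if "x \<in> factorizations Q w" for x
      proof (rule ccontr)
        assume "f (fst x) \<otimes> g (snd x) \<noteq> \<zero>"
        then have "f (fst x) \<noteq> \<zero>" "g (snd x) \<noteq> \<zero>" using assms by auto
        moreover have "path_comp (fst x) (snd x) = w" "path_tail (fst x) = path_head Q (snd x)"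
          using that unfolding factorizations_def by auto
        ultimately show False using n by blast
      qed
      then have "(f \<otimes>\<^bsub>PA\<^esub> g) w = \<zero>" by (simp add: PA_simps R.add.finprod_one_eqI)
      then show False using w by simp
    qed
  qed
qed

lemma PA_distrib:
  assumes "f \<in> carrier PA" "g \<in> carrier PA" "h \<in> carrier PA"
  shows "(f \<oplus>\<^bsub>PA\<^esub> g) \<otimes>\<^bsub>PA\<^esub> h = f \<otimes>\<^bsub>PA\<^esub> h \<oplus>\<^bsub>PA\<^esub> g \<otimes>\<^bsub>PA\<^esub> h"
    and "h \<otimes>\<^bsub>PA\<^esub> (f \<oplus>\<^bsub>PA\<^esub> g) = h \<otimes>\<^bsub>PA\<^esub> f \<oplus>\<^bsub>PA\<^esub> h \<otimes>\<^bsub>PA\<^esub> g"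
  using assms by (auto simp: PA_simps R.l_distr R.r_distr fun_eq_iff intro!: R.finsum_addf)

lemma PA_smult_mult:
  assumes "r \<in> carrier R" "f \<in> carrier PA" "g \<in> carrier PA"
  shows "(r \<odot>\<^bsub>PA\<^esub> f) \<otimes>\<^bsub>PA\<^esub> g = r \<odot>\<^bsub>PA\<^esub> (f \<otimes>\<^bsub>PA\<^esub> g)"
    and "f \<otimes>\<^bsub>PA\<^esub> (r \<odot>\<^bsub>PA\<^esub> g) = r \<odot>\<^bsub>PA\<^esub> (f \<otimes>\<^bsub>PA\<^esub> g)"
  using assms finite_factorizations[of Q]
  by (auto simp: PA_simps R.finsum_rdistr R.m_assoc R.m_lcomm fun_eq_iff intro!: R.finsum_cong')

lemma PA_mult_zero:
  assumes "f \<in> carrier PA"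
  shows "\<zero>\<^bsub>PA\<^esub> \<otimes>\<^bsub>PA\<^esub> f = \<zero>\<^bsub>PA\<^esub>" "f \<otimes>\<^bsub>PA\<^esub> \<zero>\<^bsub>PA\<^esub> = \<zero>\<^bsub>PA\<^esub>"
  using assms by (auto simp: PA_simps)

lemma finsum_unique:
  assumes "finite A" "\<And>x. x \<in> A \<Longrightarrow> f x \<in> carrier R" "\<And>x. x \<in> A \<Longrightarrow> x \<noteq> a \<Longrightarrow> f x = \<zero>"
  shows "(\<Oplus>x\<in>A. f x) = (if a \<in> A then f a else \<zero>)"
proof (cases "a \<in> A")
  case True
  have "(\<Oplus>x\<in>A. f x) = (\<Oplus>x\<in>A. if a = x then f x else \<zero>)"
    by (rule R.finsum_cong') (use assms True in auto)
  then show ?thesis using R.add.finprod_singleton[OF True assms(1), of f] assms True by auto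
next
  case False
  then have "\<And>x. x \<in> A \<Longrightarrow> f x = \<zero>" using assms(3) by blast
  then show ?thesis using False by (simp add: R.add.finprod_one_eqI)
qed

text \<open>The only term of the convolution sum at \<open>w\<close> that can be nonzero is the one
  at (p, q), present exactly when \<open>p\<close> and \<open>q\<close> compose to
  \<open>w\<close>.\<close>

lemma path_basis_mult:
  assumes "p \<in> paths Q" "q \<in> paths Q"
  shows "\<delta> p \<otimes>\<^bsub>PA\<^esub> \<delta> q = (if path_tail p = path_head Q q then \<delta> (path_comp p q) else \<zero>\<^bsub>PA\<^esub>)"
proof
  fix w
  have "(\<delta> p \<otimes>\<^bsub>PA\<^esub> \<delta> q) w = (if (p, q) \<in> factorizations Q w then \<one> else \<zero>)"
    unfolding PA_simps
    by (subst finsum_unique[OF finite_factorizations, where a = "(p, q)"]) (auto simp: path_basis_def)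
  then show "(\<delta> p \<otimes>\<^bsub>PA\<^esub> \<delta> q) w = (if path_tail p = path_head Q q then \<delta> (path_comp p q) else \<zero>\<^bsub>PA\<^esub>) w"
    using assms by (auto simp: factorizations_def PA_simps path_basis_def)
qed

text \<open>The identity holds on paths and is extended linearly in the third, then the second, then
  the first argument.\<close>

lemma PA_assoc:
  assumes "f \<in> carrier PA" "g \<in> carrier PA" "h \<in> carrier PA"
  shows "(f \<otimes>\<^bsub>PA\<^esub> g) \<otimes>\<^bsub>PA\<^esub> h = f \<otimes>\<^bsub>PA\<^esub> (g \<otimes>\<^bsub>PA\<^esub> h)"
proof -
  note simps = PA_mult_closed path_basis_closed PA_distrib PA_smult_mult PA_mult_zero
  have 1: "(\<delta> p \<otimes>\<^bsub>PA\<^esub> \<delta> q) \<otimes>\<^bsub>PA\<^esub> \<delta> r = \<delta> p \<otimes>\<^bsub>PA\<^esub> (\<delta> q \<otimes>\<^bsub>PA\<^esub> \<delta> r)"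
    if pqr: "p \<in> paths Q" "q \<in> paths Q" "r \<in> paths Q" for p q r
    using pqr by (auto simp: path_basis_mult path_comp simps) (auto simp: path_comp_def)
  have 2: "(\<delta> p \<otimes>\<^bsub>PA\<^esub> \<delta> q) \<otimes>\<^bsub>PA\<^esub> h = \<delta> p \<otimes>\<^bsub>PA\<^esub> (\<delta> q \<otimes>\<^bsub>PA\<^esub> h)"
    if pq: "p \<in> paths Q" "q \<in> paths Q" and h: "h \<in> carrier PA" for p q h
  proof -
    let ?N = "{h \<in> carrier PA. (\<delta> p \<otimes>\<^bsub>PA\<^esub> \<delta> q) \<otimes>\<^bsub>PA\<^esub> h = \<delta> p \<otimes>\<^bsub>PA\<^esub> (\<delta> q \<otimes>\<^bsub>PA\<^esub> h)}"
    have "submodule ?N R PA" by (rule P.submoduleI') (use pq in \<open>auto simp: simps\<close>)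
    then have "carrier PA \<subseteq> ?N" by (rule PA_induct) (use 1 pq path_basis_closed in auto)
    then show ?thesis using h by auto
  qed
  have 3: "(\<delta> p \<otimes>\<^bsub>PA\<^esub> g) \<otimes>\<^bsub>PA\<^esub> h = \<delta> p \<otimes>\<^bsub>PA\<^esub> (g \<otimes>\<^bsub>PA\<^esub> h)"
    if p: "p \<in> paths Q" and gh: "g \<in> carrier PA" "h \<in> carrier PA" for p g h
  proof -
    let ?N = "{g \<in> carrier PA. (\<delta> p \<otimes>\<^bsub>PA\<^esub> g) \<otimes>\<^bsub>PA\<^esub> h = \<delta> p \<otimes>\<^bsub>PA\<^esub> (g \<otimes>\<^bsub>PA\<^esub> h)}"
    have "submodule ?N R PA" by (rule P.submoduleI') (use p gh in \<open>auto simp: simps\<close>)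
    then have "carrier PA \<subseteq> ?N" by (rule PA_induct) (use 2 p gh path_basis_closed in auto)
    then show ?thesis using gh by auto
  qed
  let ?N = "{f \<in> carrier PA. (f \<otimes>\<^bsub>PA\<^esub> g) \<otimes>\<^bsub>PA\<^esub> h = f \<otimes>\<^bsub>PA\<^esub> (g \<otimes>\<^bsub>PA\<^esub> h)}"
  have "submodule ?N R PA" by (rule P.submoduleI') (use assms in \<open>auto simp: simps\<close>)
  then have "carrier PA \<subseteq> ?N" by (rule PA_induct) (use 3 assms path_basis_closed in auto)
  then show ?thesis using assms by auto
qed

text \<open>A path \<open>w\<close> has exactly one factorization with trivial left factor, the
  trivial path at its head, and exactly one with trivial right factor, the trivial path at its
  tail.\<close>

lemma PA_one:
  shows "\<one>\<^bsub>PA\<^esub> \<in> carrier PA"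
    and "f \<in> carrier PA \<Longrightarrow> \<one>\<^bsub>PA\<^esub> \<otimes>\<^bsub>PA\<^esub> f = f" and "f \<in> carrier PA \<Longrightarrow> f \<otimes>\<^bsub>PA\<^esub> \<one>\<^bsub>PA\<^esub> = f"
proof -
  show "\<one>\<^bsub>PA\<^esub> \<in> carrier PA"
    by (rule PA_carrierI[where A = "(\<lambda>v. (v, [])) ` verts Q"])
      (auto simp: PA_simps paths_def awalk_Nil_iff)
  assume f: "f \<in> carrier PA"
  have comp_w: "w = path_comp p q" "p \<in> paths Q" "q \<in> paths Q" "path_tail p = path_head Q q"
    if "(p, q) \<in> factorizations Q w" for p q w using that unfolding factorizations_def by auto
  show "\<one>\<^bsub>PA\<^esub> \<otimes>\<^bsub>PA\<^esub> f = f"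
  proof
    fix w :: "('v, 'e) path"
    let ?a = "((path_head Q w, []) :: ('v, 'e) path, w)"
    have unique: "x = ?a" if x: "x \<in> factorizations Q w" "snd (fst x) = []" for x
    proof -
      obtain p q where Pair: "x = (p, q)" by (metis surj_pair)
      then have "p = (path_head Q q, [])" using comp_w(4)[of p q w] x by (cases p) (auto simp: path_tail_def)
      then show ?thesis using comp_w(1)[of p q w] x Pair by (cases q) (auto simp: path_comp_def)
    qed
    have a: "?a \<in> factorizations Q w \<longleftrightarrow> w \<in> paths Q"
      using path_ends_in_verts(1)[of w]
      by (auto simp: factorizations_def trivial_path path_tail_def path_comp_def)
    let ?g = "\<lambda>x. \<one>\<^bsub>PA\<^esub> (fst x) \<otimes> f (snd x)"
    have "(\<Oplus>x\<in>factorizations Q w. ?g x) = (if ?a \<in> factorizations Q w then ?g ?a else \<zero>)"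
    proof (rule finsum_unique[OF finite_factorizations, where a = ?a and f = ?g])
      show "\<one>\<^bsub>PA\<^esub> (fst x) \<otimes> f (snd x) = \<zero>" if "x \<in> factorizations Q w" "x \<noteq> ?a" for x
      proof -
        have "snd (fst x) \<noteq> []" using unique that by blast
        then show ?thesis using f by (simp add: PA_simps(4))
      qed
    qed (use f in \<open>simp add: PA_simps(4)\<close>)
    then have "(\<one>\<^bsub>PA\<^esub> \<otimes>\<^bsub>PA\<^esub> f) w = (if w \<in> paths Q then f w else \<zero>)"
      unfolding a using f path_ends_in_verts(1)[of w] by (simp add: PA_simps(4,5) trivial_path)
    then show "(\<one>\<^bsub>PA\<^esub> \<otimes>\<^bsub>PA\<^esub> f) w = f w" using PA_outside[OF f] by simp
  qed
  show "f \<otimes>\<^bsub>PA\<^esub> \<one>\<^bsub>PA\<^esub> = f"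
  proof
    fix w :: "('v, 'e) path"
    let ?a = "(w, (fst w, []) :: ('v, 'e) path)"
    have unique: "x = ?a" if x: "x \<in> factorizations Q w" "snd (snd x) = []" for x
    proof -
      obtain p q where Pair: "x = (p, q)" by (metis surj_pair)
      then have "fst p = path_head Q (fst q, [])" using comp_w(4)[of p q w] x by (cases q) (auto simp: path_tail_def)
      then show ?thesis using comp_w(1)[of p q w] x Pair
        by (cases p; cases q) (auto simp: path_comp_def path_head_Nil)
    qed
    have a: "?a \<in> factorizations Q w \<longleftrightarrow> w \<in> paths Q"
      using path_ends_in_verts(2)[of w]
      by (auto simp: factorizations_def trivial_path path_tail_def path_comp_def path_head_Nil)
    let ?g = "\<lambda>x. f (fst x) \<otimes> \<one>\<^bsub>PA\<^esub> (snd x)"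
    have "(\<Oplus>x\<in>factorizations Q w. ?g x) = (if ?a \<in> factorizations Q w then ?g ?a else \<zero>)"
    proof (rule finsum_unique[OF finite_factorizations, where a = ?a and f = ?g])
      show "f (fst x) \<otimes> \<one>\<^bsub>PA\<^esub> (snd x) = \<zero>" if "x \<in> factorizations Q w" "x \<noteq> ?a" for x
      proof -
        have "snd (snd x) \<noteq> []" using unique that by blast
        then show ?thesis using f by (simp add: PA_simps(4))
      qed
    qed (use f in \<open>simp add: PA_simps(4)\<close>)
    then have "(f \<otimes>\<^bsub>PA\<^esub> \<one>\<^bsub>PA\<^esub>) w = (if w \<in> paths Q then f w else \<zero>)"
      unfolding a using f path_ends_in_verts(2)[of w] by (simp add: PA_simps(4,5) trivial_path path_tail_def)
    then show "(f \<otimes>\<^bsub>PA\<^esub> \<one>\<^bsub>PA\<^esub>) w = f w" using PA_outside[OF f] by simp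
  qed
qed

lemma ring_PA: "ring PA"
proof (rule ringI)
  show "abelian_group PA" by (rule P.M.abelian_group_axioms)
  show "monoid PA" by (rule monoidI) (auto simp: PA_mult_closed PA_one PA_assoc)
qed (auto simp: PA_distrib)

lemma assoc_algebra_PA: "assoc_algebra R PA"
  by (intro assoc_algebra.intro module_PA ring_PA assoc_algebra_axioms.intro PA_smult_mult)

end

section \<open>The homomorphism out of the path algebra determined by vertices and arrows\<close>

section \<open>Representations of path algebras\<close>

text \<open>The data of the universal property of the path algebra: orthogonal idempotents with sum
  1 for the vertices, and for each arrow an element of the Peirce component given by its head and
  tail.\<close>

locale path_representation = assoc_algebra R M + quiver_algebra R Q
  for R :: "('r, 'm) ring_scheme" (structure) and M :: "('r, 'c, 'n) module_scheme" (structure)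
    and Q :: "('v, 'e) pre_digraph" +
  fixes e :: "'v \<Rightarrow> 'c" and \<beta> :: "'e \<Rightarrow> 'c"
  assumes e_closed: "v \<in> verts Q \<Longrightarrow> e v \<in> carrier M"
    and e_mult: "v \<in> verts Q \<Longrightarrow> w \<in> verts Q \<Longrightarrow> e v \<otimes>\<^bsub>M\<^esub> e w = (if v = w then e v else \<zero>\<^bsub>M\<^esub>)"
    and e_sum: "(\<Oplus>\<^bsub>M\<^esub>v\<in>verts Q. e v) = \<one>\<^bsub>M\<^esub>"
    and arrow_closed: "a \<in> arcs Q \<Longrightarrow> \<beta> a \<in> carrier M"
    and e_head: "a \<in> arcs Q \<Longrightarrow> e (head Q a) \<otimes>\<^bsub>M\<^esub> \<beta> a = \<beta> a"
    and e_tail: "a \<in> arcs Q \<Longrightarrow> \<beta> a \<otimes>\<^bsub>M\<^esub> e (tail Q a) = \<beta> a"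
begin

text \<open>Lists follow the order of traversal whereas products are written from right to left, so
  the first arrow becomes the rightmost factor. The leftmost factor is the idempotent at the head of
  the walk, which \<open>e_head\<close> absorbs for nontrivial walks.\<close>

primrec walk_prod :: "'v \<Rightarrow> 'e list \<Rightarrow> 'c" where
  "walk_prod u [] = e u"
| "walk_prod u (a # p) = walk_prod (head Q a) p \<otimes>\<^bsub>M\<^esub> \<beta> a"

lemma walk_prod:
  assumes "awalk u p v"
  shows "walk_prod u p \<in> carrier M" "e v \<otimes>\<^bsub>M\<^esub> walk_prod u p = walk_prod u p"
    "walk_prod u p \<otimes>\<^bsub>M\<^esub> e u = walk_prod u p"
proof -
  have "walk_prod u p \<in> carrier M \<and> e v \<otimes>\<^bsub>M\<^esub> walk_prod u p = walk_prod u p \<and>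
    walk_prod u p \<otimes>\<^bsub>M\<^esub> e u = walk_prod u p" using assms
  proof (induction p arbitrary: u)
    case Nil
    then show ?case by (auto simp: awalk_Nil_iff e_closed e_mult)
  next
    case (Cons a p)
    then have a: "a \<in> arcs Q" "u = tail Q a" "awalk (head Q a) p v" by (auto simp: awalk_Cons_iff)
    then have "v \<in> verts Q" "u \<in> verts Q" by auto
    with a Cons.IH[OF a(3)] show ?case
      by (simp add: arrow_closed e_closed m_assoc e_tail) (simp add: arrow_closed e_closed flip: m_assoc)
  qed
  then show "walk_prod u p \<in> carrier M" "e v \<otimes>\<^bsub>M\<^esub> walk_prod u p = walk_prod u p"
    "walk_prod u p \<otimes>\<^bsub>M\<^esub> e u = walk_prod u p" by auto
qed

lemma walk_prod_append:
  assumes "awalk u p v" "awalk v q w"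
  shows "walk_prod u (p @ q) = walk_prod v q \<otimes>\<^bsub>M\<^esub> walk_prod u p"
  using assms(1)
proof (induction p arbitrary: u)
  case Nil
  then show ?case using walk_prod[OF assms(2)] by (auto simp: awalk_Nil_iff)
next
  case (Cons a p)
  then have a: "a \<in> arcs Q" "u = tail Q a" "awalk (head Q a) p v" by (auto simp: awalk_Cons_iff)
  then show ?case using Cons.IH[OF a(3)] walk_prod(1)[OF assms(2)] walk_prod(1)[OF a(3)]
    by (simp add: m_assoc arrow_closed)
qed

definition path_val :: "('v, 'e) path \<Rightarrow> 'c" where
  "path_val p = walk_prod (fst p) (snd p)"

lemma path_val_closed: "p \<in> paths Q \<Longrightarrow> path_val p \<in> carrier M"
  unfolding path_val_def paths_iff by (rule walk_prod(1))

text \<open>For paths that do not compose, the product contains the factor e_v e_w with v different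
  from w.\<close>

lemma path_val_mult:
  assumes p: "p \<in> paths Q" and q: "q \<in> paths Q"
  shows "path_val p \<otimes>\<^bsub>M\<^esub> path_val q =
    (if path_tail p = path_head Q q then path_val (path_comp p q) else \<zero>\<^bsub>M\<^esub>)"
proof (cases "path_tail p = path_head Q q")
  case True
  then show ?thesis
    using walk_prod_append[of "fst q" "snd q" "path_head Q q" "snd p" "path_head Q p"] p q
    unfolding path_val_def path_comp_def path_tail_def paths_iff by simp
next
  case False
  note cl = path_val_closed[OF p] path_val_closed[OF q]
  note v = path_ends_in_verts(2)[OF p] path_ends_in_verts(1)[OF q]
  have 1: "path_val p = path_val p \<otimes>\<^bsub>M\<^esub> e (path_tail p)" "path_val q = e (path_head Q q) \<otimes>\<^bsub>M\<^esub> path_val q"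
    using walk_prod p q unfolding path_val_def path_tail_def paths_iff by simp_all
  have "path_val p \<otimes>\<^bsub>M\<^esub> path_val q =
      (path_val p \<otimes>\<^bsub>M\<^esub> e (path_tail p)) \<otimes>\<^bsub>M\<^esub> (e (path_head Q q) \<otimes>\<^bsub>M\<^esub> path_val q)"
    using 1 by simp
  also have "\<dots> = path_val p \<otimes>\<^bsub>M\<^esub> ((e (path_tail p) \<otimes>\<^bsub>M\<^esub> e (path_head Q q)) \<otimes>\<^bsub>M\<^esub> path_val q)"
    using cl e_closed v by (simp add: m_assoc)
  also have "\<dots> = \<zero>\<^bsub>M\<^esub>" using False cl v by (simp add: e_mult)
  finally show ?thesis using False by simp
qed

definition rep :: "(('v, 'e) path \<Rightarrow> 'r) \<Rightarrow> 'c" where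
  "rep f = (\<Oplus>\<^bsub>M\<^esub>p\<in>{p. f p \<noteq> \<zero>}. f p \<odot>\<^bsub>M\<^esub> path_val p)"

text \<open>Permits any finite set of paths containing the support as index set, so that two
  elements can be summed over a common one.\<close>

lemma rep_eq:
  assumes "f \<in> carrier PA" "finite A" "{p. f p \<noteq> \<zero>} \<subseteq> A" "A \<subseteq> paths Q"
  shows "rep f = (\<Oplus>\<^bsub>M\<^esub>p\<in>A. f p \<odot>\<^bsub>M\<^esub> path_val p)"
  unfolding rep_def
proof (rule M.add.finprod_mono_neutral_cong_left[OF assms(2,3)])
  have v: "path_val p \<in> carrier M" if "p \<in> A" for p
    using path_val_closed subsetD[OF assms(4) that] by blast
  then show "(\<lambda>p. f p \<odot>\<^bsub>M\<^esub> path_val p) \<in> A \<rightarrow> carrier M" using assms(1) by simp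
  show "f p \<odot>\<^bsub>M\<^esub> path_val p = \<zero>\<^bsub>M\<^esub>" if "p \<in> A - {p. f p \<noteq> \<zero>}" for p
    using that v[of p] by simp
qed simp

lemma rep_closed:
  assumes "f \<in> carrier PA"
  shows "rep f \<in> carrier M"
  unfolding rep_def
proof (rule M.finsum_closed)
  have "path_val p \<in> carrier M" if "f p \<noteq> \<zero>" for p
    using path_val_closed PA_support(2)[OF assms] that by blast
  then show "(\<lambda>p. f p \<odot>\<^bsub>M\<^esub> path_val p) \<in> {p. f p \<noteq> \<zero>} \<rightarrow> carrier M" using assms by simp
qed

lemma rep_add:
  assumes fg: "f \<in> carrier PA" "g \<in> carrier PA"
  shows "rep (f \<oplus>\<^bsub>PA\<^esub> g) = rep f \<oplus>\<^bsub>M\<^esub> rep g"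
proof -
  let ?A = "{p. f p \<noteq> \<zero>} \<union> {p. g p \<noteq> \<zero>}"
  have A: "finite ?A" "?A \<subseteq> paths Q" using PA_support fg by auto
  have v: "path_val p \<in> carrier M" if "p \<in> ?A" for p
    using path_val_closed subsetD[OF A(2) that] by blast
  have "rep (f \<oplus>\<^bsub>PA\<^esub> g) = (\<Oplus>\<^bsub>M\<^esub>p\<in>?A. (f \<oplus>\<^bsub>PA\<^esub> g) p \<odot>\<^bsub>M\<^esub> path_val p)"
    by (rule rep_eq[OF P.M.add.m_closed[OF fg] A(1) _ A(2)]) (auto simp: PA_simps)
  also have "\<dots> = (\<Oplus>\<^bsub>M\<^esub>p\<in>?A. f p \<odot>\<^bsub>M\<^esub> path_val p \<oplus>\<^bsub>M\<^esub> g p \<odot>\<^bsub>M\<^esub> path_val p)"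
    by (rule M.finsum_cong') (use fg v in \<open>auto simp: PA_simps smult_l_distr\<close>)
  also have "\<dots> = (\<Oplus>\<^bsub>M\<^esub>p\<in>?A. f p \<odot>\<^bsub>M\<^esub> path_val p) \<oplus>\<^bsub>M\<^esub> (\<Oplus>\<^bsub>M\<^esub>p\<in>?A. g p \<odot>\<^bsub>M\<^esub> path_val p)"
    by (rule M.finsum_addf) (use fg v in auto)
  also have "\<dots> = rep f \<oplus>\<^bsub>M\<^esub> rep g" using rep_eq[of f ?A] rep_eq[of g ?A] fg A by auto
  finally show ?thesis .
qed

lemma rep_smult:
  assumes r: "r \<in> carrier R" and f: "f \<in> carrier PA"
  shows "rep (r \<odot>\<^bsub>PA\<^esub> f) = r \<odot>\<^bsub>M\<^esub> rep f"
proof -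
  let ?A = "{p. f p \<noteq> \<zero>}"
  have A: "finite ?A" "?A \<subseteq> paths Q" using PA_support f by auto
  have v: "path_val p \<in> carrier M" if "p \<in> ?A" for p
    using path_val_closed subsetD[OF A(2) that] by blast
  have "rep (r \<odot>\<^bsub>PA\<^esub> f) = (\<Oplus>\<^bsub>M\<^esub>p\<in>?A. (r \<odot>\<^bsub>PA\<^esub> f) p \<odot>\<^bsub>M\<^esub> path_val p)"
    by (rule rep_eq[OF P.smult_closed[OF r f] A(1) _ A(2)]) (use r in \<open>auto simp: PA_simps\<close>)
  also have "\<dots> = (\<Oplus>\<^bsub>M\<^esub>p\<in>?A. r \<odot>\<^bsub>M\<^esub> (f p \<odot>\<^bsub>M\<^esub> path_val p))"
    by (rule M.finsum_cong') (use r f v in \<open>auto simp: PA_simps smult_assoc1\<close>)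
  also have "\<dots> = r \<odot>\<^bsub>M\<^esub> rep f"
    unfolding rep_def by (rule finsum_smult_ldistr[symmetric]) (use r f v A in auto)
  finally show ?thesis .
qed

lemma rep_basis:
  assumes "p \<in> paths Q"
  shows "rep (\<delta> p) = path_val p"
proof -
  have "rep (\<delta> p) = (\<Oplus>\<^bsub>M\<^esub>q\<in>{p}. \<delta> p q \<odot>\<^bsub>M\<^esub> path_val q)"
    by (rule rep_eq[OF path_basis_closed[OF assms]]) (use assms in \<open>auto simp: path_basis_def\<close>)
  then show ?thesis using path_val_closed[OF assms] by (simp add: path_basis_def)
qed

lemma rep_zero: "rep \<zero>\<^bsub>PA\<^esub> = \<zero>\<^bsub>M\<^esub>"
  unfolding rep_def by (simp add: PA_simps)

lemma rep_one: "rep \<one>\<^bsub>PA\<^esub> = \<one>\<^bsub>M\<^esub>"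
proof -
  let ?A = "(\<lambda>v. (v, [])) ` verts Q"
  have "rep \<one>\<^bsub>PA\<^esub> = (\<Oplus>\<^bsub>M\<^esub>p\<in>?A. \<one>\<^bsub>PA\<^esub> p \<odot>\<^bsub>M\<^esub> path_val p)"
    by (rule rep_eq[OF PA_one(1)]) (auto simp: PA_simps paths_def awalk_Nil_iff)
  also have "\<dots> = (\<Oplus>\<^bsub>M\<^esub>v\<in>verts Q. \<one>\<^bsub>PA\<^esub> (v, []) \<odot>\<^bsub>M\<^esub> path_val (v, []))"
    by (rule M.add.finprod_reindex)
      (auto simp: inj_on_def PA_simps trivial_path path_val_def e_closed)
  also have "\<dots> = (\<Oplus>\<^bsub>M\<^esub>v\<in>verts Q. e v)"
    by (rule M.finsum_cong') (auto simp: PA_simps trivial_path path_val_def e_closed)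
  finally show ?thesis using e_sum by simp
qed

text \<open>Both sides are bilinear, so \<open>PA_induct\<close> reduces first the right and then
  the left argument to paths.\<close>

lemma rep_mult:
  assumes "f \<in> carrier PA" "g \<in> carrier PA"
  shows "rep (f \<otimes>\<^bsub>PA\<^esub> g) = rep f \<otimes>\<^bsub>M\<^esub> rep g"
proof -
  note simps = PA_mult_closed path_basis_closed PA_distrib PA_smult_mult PA_mult_zero
    rep_closed rep_add rep_smult rep_zero l_distr r_distr smult_mult_left smult_mult_right
  have 1: "rep (\<delta> p \<otimes>\<^bsub>PA\<^esub> \<delta> q) = rep (\<delta> p) \<otimes>\<^bsub>M\<^esub> rep (\<delta> q)" if "p \<in> paths Q" "q \<in> paths Q" for p q
    using that by (simp add: path_basis_mult rep_basis path_val_mult path_comp rep_zero)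
  have 2: "rep (\<delta> p \<otimes>\<^bsub>PA\<^esub> g) = rep (\<delta> p) \<otimes>\<^bsub>M\<^esub> rep g" if p: "p \<in> paths Q" and g: "g \<in> carrier PA" for p g
  proof -
    let ?N = "{g \<in> carrier PA. rep (\<delta> p \<otimes>\<^bsub>PA\<^esub> g) = rep (\<delta> p) \<otimes>\<^bsub>M\<^esub> rep g}"
    have "submodule ?N R PA" by (rule P.submoduleI') (use p in \<open>auto simp: simps\<close>)
    then have "carrier PA \<subseteq> ?N" by (rule PA_induct) (use 1 p path_basis_closed in auto)
    then show ?thesis using g by auto
  qed
  let ?N = "{f \<in> carrier PA. rep (f \<otimes>\<^bsub>PA\<^esub> g) = rep f \<otimes>\<^bsub>M\<^esub> rep g}"
  have "submodule ?N R PA" by (rule P.submoduleI') (use assms in \<open>auto simp: simps\<close>)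
  then have "carrier PA \<subseteq> ?N" by (rule PA_induct) (use 2 assms path_basis_closed in auto)
  then show ?thesis using assms by auto
qed

lemma rep_hom: "ring_hom_ring PA M rep"
  by (intro ring_hom_ringI ring_PA ring_axioms rep_closed rep_mult rep_add rep_one)

lemma rep_vertex: "v \<in> verts Q \<Longrightarrow> rep (vertex_elem R v) = e v"
  unfolding vertex_elem_def by (subst rep_basis) (auto simp: trivial_path path_val_def)

lemma arrow_path: "a \<in> arcs Q \<Longrightarrow> (tail Q a, [a]) \<in> paths Q"
  unfolding paths_def using arc_implies_awalk by auto

lemma rep_arrow: "a \<in> arcs Q \<Longrightarrow> rep (arrow_elem R Q a) = \<beta> a"
  unfolding arrow_elem_def using arrow_path
  by (subst rep_basis) (auto simp: path_val_def e_head)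

end

section \<open>Exchange of left and right\<close>

section \<open>Opposite rings\<close>

text \<open>A record update keeps all further fields, in particular the scalar multiplication, so
  the opposite of an algebra is an algebra of the same type.\<close>

definition op_ring :: "('a, 'm) ring_scheme \<Rightarrow> ('a, 'm) ring_scheme" where
  "op_ring A = A\<lparr>monoid.mult := \<lambda>x y. y \<otimes>\<^bsub>A\<^esub> x\<rparr>"

lemma op_ring_simps [simp]:
  "carrier (op_ring A) = carrier A" "\<one>\<^bsub>op_ring A\<^esub> = \<one>\<^bsub>A\<^esub>" "\<zero>\<^bsub>op_ring A\<^esub> = \<zero>\<^bsub>A\<^esub>"
  "add (op_ring A) = add A" "x \<otimes>\<^bsub>op_ring A\<^esub> y = y \<otimes>\<^bsub>A\<^esub> x"
  "add_monoid (op_ring A) = add_monoid A"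
  by (simp_all add: op_ring_def)

lemma smult_op_ring [simp]: "module.smult (op_ring M) = module.smult M"
  by (simp add: op_ring_def)

lemma finsum_op_ring [simp]: "finsum (op_ring A) f S = finsum A f S"
  by (simp add: finsum_def)

lemma a_minus_op_ring [simp]: "x \<ominus>\<^bsub>op_ring A\<^esub> y = x \<ominus>\<^bsub>A\<^esub> y"
  by (simp add: a_minus_def a_inv_def)

lemma Units_op_ring [simp]: "Units (op_ring A) = Units A"
  by (auto simp: Units_def)

lemma ring_op_ring: "ring A \<Longrightarrow> ring (op_ring A)"
proof -
  assume "ring A"
  then interpret ring A .
  show ?thesis
  proof (rule ringI)
    show "abelian_group (op_ring A)"
      by (rule abelian_groupI) (auto simp: a_ac intro: bexI[of _ "\<ominus>\<^bsub>A\<^esub> x" for x] l_neg)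
    show "monoid (op_ring A)" by (rule monoidI) (auto simp: m_assoc)
  qed (auto simp: l_distr r_distr)
qed

lemma left_ideal_op_ring: "left_ideal (op_ring A) = right_ideal A"
  by (auto simp: left_ideal_def right_ideal_def additive_subgroup_def fun_eq_iff)

lemma principal_left_op_ring: "principal_left (op_ring A) x = principal_right A x"
  by (simp add: principal_left_def principal_right_def)

lemma submodule_sum_op_ring: "submodule_sum (op_ring A) T N = submodule_sum A T N"
  by (simp add: submodule_sum_def)

lemma submodule_op_ring: "submodule N R (op_ring M) = submodule N R M"
  by (simp add: submodule_def submodule_axioms_def)

lemma assoc_algebra_op_ring:
  assumes "assoc_algebra R M"
  shows "assoc_algebra R (op_ring M)"
proof -
  interpret assoc_algebra R M by fact
  have "ring (op_ring M)" by (rule ring_op_ring) (rule ring_axioms)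
  moreover from this have "module R (op_ring M)"
    by (intro moduleI R.cring_axioms ring.is_abelian_group)
      (auto simp: smult_l_distr smult_r_distr smult_assoc1)
  ultimately show ?thesis
    by (auto intro!: assoc_algebra.intro assoc_algebra_axioms.intro simp: smult_mult_left smult_mult_right)
qed

lemma (in assoc_algebra) rspan_op_ring: "module.rspan R (op_ring M) S = rspan S"
proof -
  interpret op: assoc_algebra R "op_ring M" by (rule assoc_algebra_op_ring) (rule assoc_algebra_axioms)
  show ?thesis unfolding rspan_def op.rspan_def submodule_op_ring ..
qed

lemma (in split_algebra) split_algebra_op_ring: "split_algebra R (op_ring M) P J V e"
proof -
  interpret op: assoc_algebra R "op_ring M" by (rule assoc_algebra_op_ring) (rule assoc_algebra_axioms)
  have J: "ideal J (op_ring M)"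
  proof (rule idealI)
    show "subgroup J (add_monoid (op_ring M))"
      using ideal.axioms(1)[OF J_ideal] by (simp add: additive_subgroup_def)
  qed (use op.ring_axioms J_mult in auto)
  show ?thesis
  proof (intro split_algebra.intro split_algebra_axioms.intro)
    show "\<exists>S. finite S \<and> S \<subseteq> carrier (op_ring M) \<and> carrier (op_ring M) \<subseteq> op.rspan S"
      using finitely_generated by (simp add: rspan_op_ring)
    show "carrier (op_ring M) \<subseteq> op.rspan (J \<union> e ` V)" using carrier_span by (simp add: rspan_op_ring)
  qed (use op.assoc_algebra_axioms noetherian J J_mult smult_in_J Units_if_notin quasi_regular finite_V e_closed e_mult e_nonzero e_sum in auto)
qed

text \<open>Reversing the multiplication exchanges heads and tails. The set of products of two
  elements of \<open>J\<close> in \<open>generating\<close> and \<open>minimal\<close> stays the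
  same.\<close>

lemma (in arrow_algebra) arrow_algebra_op_ring: "arrow_algebra R (op_ring M) P J V e E \<beta> tl hd"
proof -
  interpret op: split_algebra R "op_ring M" P J V e by (rule split_algebra_op_ring)
  show ?thesis
  proof
    show "J \<subseteq> N" if "submodule N R (op_ring M)" "\<And>a. a \<in> E \<Longrightarrow> \<beta> a \<in> N"
      "\<And>x y. x \<in> J \<Longrightarrow> y \<in> J \<Longrightarrow> x \<otimes>\<^bsub>op_ring M\<^esub> y \<in> N" for N
      using that by (intro generating) (auto simp: submodule_op_ring)
    show "\<exists>N. submodule N R (op_ring M) \<and> (\<forall>b\<in>E - {a}. \<beta> b \<in> N) \<and>
      (\<forall>x\<in>J. \<forall>y\<in>J. x \<otimes>\<^bsub>op_ring M\<^esub> y \<in> N) \<and> \<not> J \<subseteq> N" if "a \<in> E" for a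
      using minimal[OF that] by (auto simp: submodule_op_ring)
  qed (use finite_E arrow_J hd_V tl_V e_hd e_tl in auto)
qed

section \<open>Invariance of radicals, locality and sums of left ideals under isomorphism\<close>

section \<open>Transport along ring isomorphisms\<close>

lemma inj_on_image_subset_iff:
  assumes "inj_on f C" "A \<subseteq> C" "B \<subseteq> C"
  shows "f ` A \<subseteq> f ` B \<longleftrightarrow> A \<subseteq> B"
proof
  assume "f ` A \<subseteq> f ` B"
  then show "A \<subseteq> B" using inj_on_image_mem_iff[OF assms(1) _ assms(3)] assms(2) by blast
qed auto

text \<open>\<open>S\<close> and \<open>T\<close> are arbitrary predicates matched by an injective
  map. The radical and locality thus transport together, for whichever kind of one-sided ideal is
  meant.\<close>

lemma maximal_submodule_image:
  assumes inj: "inj_on \<psi> C" and S: "\<And>L. S L \<Longrightarrow> L \<subseteq> C"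
    and T: "\<And>L. L \<subseteq> C \<Longrightarrow> T (\<psi> ` L) \<longleftrightarrow> S L" and M: "M \<subseteq> C" and N: "N \<subseteq> C"
  shows "maximal_submodule T (\<psi> ` M) (\<psi> ` N) \<longleftrightarrow> maximal_submodule S M N"
proof -
  have eq: "\<psi> ` L = \<psi> ` L' \<longleftrightarrow> L = L'" if "L \<subseteq> C" "L' \<subseteq> C" for L L'
    using inj_on_image_eq_iff[OF inj that] .
  have sub: "\<psi> ` L \<subseteq> \<psi> ` L' \<longleftrightarrow> L \<subseteq> L'" if "L \<subseteq> C" "L' \<subseteq> C" for L L'
    using inj_on_image_subset_iff[OF inj that] .
  have "(\<forall>L. T L \<and> \<psi> ` N \<subseteq> L \<and> L \<subseteq> \<psi> ` M \<longrightarrow> L = \<psi> ` N \<or> L = \<psi> ` M) \<longleftrightarrow>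
    (\<forall>L. S L \<and> N \<subseteq> L \<and> L \<subseteq> M \<longrightarrow> L = N \<or> L = M)" (is "?l \<longleftrightarrow> ?r")
  proof
    assume l: ?l
    show ?r
    proof (intro allI impI)
      fix L assume L: "S L \<and> N \<subseteq> L \<and> L \<subseteq> M"
      then have "L \<subseteq> C" using M by auto
      moreover have "\<psi> ` L = \<psi> ` N \<or> \<psi> ` L = \<psi> ` M"
        using l L T[OF \<open>L \<subseteq> C\<close>] by (meson image_mono)
      ultimately show "L = N \<or> L = M" using eq M N by simp
    qed
  next
    assume r: ?r
    show ?l
    proof (intro allI impI)
      fix L assume L: "T L \<and> \<psi> ` N \<subseteq> L \<and> L \<subseteq> \<psi> ` M"
      then obtain L' where L': "L' \<subseteq> M" "L = \<psi> ` L'" by (meson subset_imageE)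
      then have "L' \<subseteq> C" using M by auto
      then have "L' = N \<or> L' = M" using r L L' T sub[OF N \<open>L' \<subseteq> C\<close>] by auto
      then show "L = \<psi> ` N \<or> L = \<psi> ` M" using L' by auto
    qed
  qed
  then show ?thesis unfolding maximal_submodule_def psubset_eq using eq sub T M N by simp
qed

lemma
  assumes inj: "inj_on \<psi> C" and S: "\<And>L. S L \<Longrightarrow> L \<subseteq> C"
    and T: "\<And>L. L \<subseteq> C \<Longrightarrow> T (\<psi> ` L) \<longleftrightarrow> S L" and M: "M \<subseteq> C"
  shows local_module_image: "local_module T (\<psi> ` M) \<longleftrightarrow> local_module S M"
    and module_rad_image: "module_rad T (\<psi> ` M) = \<psi> ` module_rad S M"
proof -
  have max: "maximal_submodule T (\<psi> ` M) (\<psi> ` N) \<longleftrightarrow> maximal_submodule S M N" if "N \<subseteq> C" for N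
    by (rule maximal_submodule_image[OF inj _ _ M that]) (fact S T)+
  have SC: "N \<subseteq> C" if "maximal_submodule S M N" for N
    using that S unfolding maximal_submodule_def by auto
  have preimage: "\<exists>N. maximal_submodule S M N \<and> N' = \<psi> ` N" if "maximal_submodule T (\<psi> ` M) N'" for N'
  proof -
    have "N' \<subseteq> \<psi> ` M" using that unfolding maximal_submodule_def by auto
    then obtain N where N: "N \<subseteq> M" "N' = \<psi> ` N" by (meson subset_imageE)
    then show ?thesis using max[of N] that M by auto
  qed
  have eq: "\<psi> ` L = \<psi> ` L' \<longleftrightarrow> L = L'" if "L \<subseteq> C" "L' \<subseteq> C" for L L'
    using inj_on_image_eq_iff[OF inj that] .
  show "local_module T (\<psi> ` M) \<longleftrightarrow> local_module S M"
  proof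
    assume "local_module T (\<psi> ` M)"
    then obtain N' where N': "maximal_submodule T (\<psi> ` M) N'"
      and un: "\<And>L. maximal_submodule T (\<psi> ` M) L \<Longrightarrow> L = N'" unfolding local_module_def by auto
    obtain N where N: "maximal_submodule S M N" "N' = \<psi> ` N" using preimage[OF N'] by auto
    have eqN: "L = N" if "maximal_submodule S M L" for L
    proof -
      have "\<psi> ` L = \<psi> ` N" using un[of "\<psi> ` L"] max[OF SC[OF that]] that N(2) by simp
      then show ?thesis using eq[OF SC[OF that] SC[OF N(1)]] by simp
    qed
    show "local_module S M" unfolding local_module_def
    proof (rule ex1I)
      show "maximal_submodule S M N" by (rule N(1))
    qed (rule eqN)
  next
    assume "local_module S M"
    then obtain N where N: "maximal_submodule S M N"
      and un: "\<And>L. maximal_submodule S M L \<Longrightarrow> L = N" unfolding local_module_def by auto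
    have "maximal_submodule T (\<psi> ` M) (\<psi> ` N)" using max[OF SC[OF N]] N by simp
    moreover have "L = \<psi> ` N" if "maximal_submodule T (\<psi> ` M) L" for L using preimage[OF that] un by auto
    ultimately show "local_module T (\<psi> ` M)" unfolding local_module_def by (rule ex1I)
  qed
  show "module_rad T (\<psi> ` M) = \<psi> ` module_rad S M"
  proof
    show "module_rad T (\<psi> ` M) \<subseteq> \<psi> ` module_rad S M"
    proof
      fix y assume y: "y \<in> module_rad T (\<psi> ` M)"
      then obtain x where x: "x \<in> M" "y = \<psi> x" unfolding module_rad_def by auto
      have "x \<in> N" if N: "maximal_submodule S M N" for N
    proof -
        have "\<psi> x \<in> \<psi> ` N" using y x max[OF SC[OF N]] N unfolding module_rad_def by auto
        then show ?thesis using inj_on_image_mem_iff[OF inj _ SC[OF N]] x M by auto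
      qed
      then show "y \<in> \<psi> ` module_rad S M" using x unfolding module_rad_def by auto
    qed
    show "\<psi> ` module_rad S M \<subseteq> module_rad T (\<psi> ` M)"
    proof
      fix y assume "y \<in> \<psi> ` module_rad S M"
      then obtain x where x: "x \<in> M" "y = \<psi> x" "\<And>N. maximal_submodule S M N \<Longrightarrow> x \<in> N"
        unfolding module_rad_def by auto
      have "y \<in> N'" if "maximal_submodule T (\<psi> ` M) N'" for N' using preimage[OF that] x by auto
      then show "y \<in> module_rad T (\<psi> ` M)" using x unfolding module_rad_def by auto
    qed
  qed
qed

locale ring_isomorphism = A: ring A + B: ring B
  for A :: "('a, 'm) ring_scheme" and B :: "('b, 'n) ring_scheme" +
  fixes \<psi> :: "'a \<Rightarrow> 'b"
  assumes iso: "\<psi> \<in> ring_iso A B"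
begin

lemma \<psi>_simps:
  "x \<in> carrier A \<Longrightarrow> \<psi> x \<in> carrier B"
  "x \<in> carrier A \<Longrightarrow> y \<in> carrier A \<Longrightarrow> \<psi> (x \<otimes>\<^bsub>A\<^esub> y) = \<psi> x \<otimes>\<^bsub>B\<^esub> \<psi> y"
  "x \<in> carrier A \<Longrightarrow> y \<in> carrier A \<Longrightarrow> \<psi> (x \<oplus>\<^bsub>A\<^esub> y) = \<psi> x \<oplus>\<^bsub>B\<^esub> \<psi> y"
  using iso unfolding ring_iso_def ring_hom_def by auto

lemma \<psi>_inj: "inj_on \<psi> (carrier A)" and \<psi>_image: "\<psi> ` carrier A = carrier B"
  using iso unfolding ring_iso_def bij_betw_def by auto

lemma \<psi>_zero: "\<psi> \<zero>\<^bsub>A\<^esub> = \<zero>\<^bsub>B\<^esub>"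
  using \<psi>_simps(3)[of "\<zero>\<^bsub>A\<^esub>" "\<zero>\<^bsub>A\<^esub>"] \<psi>_simps(1)[of "\<zero>\<^bsub>A\<^esub>"]
  by (metis A.zero_closed A.l_zero B.add.r_cancel_one')

lemma left_ideal_image:
  assumes L: "L \<subseteq> carrier A"
  shows "left_ideal B (\<psi> ` L) \<longleftrightarrow> left_ideal A L"
proof -
  have mem: "\<psi> x \<in> \<psi> ` L \<longleftrightarrow> x \<in> L" if "x \<in> carrier A" for x
    using inj_on_image_mem_iff[OF \<psi>_inj that L] .
  have 1: "\<psi> x \<oplus>\<^bsub>B\<^esub> \<psi> y \<in> \<psi> ` L \<longleftrightarrow> x \<oplus>\<^bsub>A\<^esub> y \<in> L" if "x \<in> L" "y \<in> L" for x y
    using mem[of "x \<oplus>\<^bsub>A\<^esub> y"] that L by (simp add: \<psi>_simps(3) subset_iff)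
  have 2: "\<psi> a \<otimes>\<^bsub>B\<^esub> \<psi> x \<in> \<psi> ` L \<longleftrightarrow> a \<otimes>\<^bsub>A\<^esub> x \<in> L" if "a \<in> carrier A" "x \<in> L" for a x
    using mem[of "a \<otimes>\<^bsub>A\<^esub> x"] that L by (simp add: \<psi>_simps(2) subset_iff)
  have 3: "\<zero>\<^bsub>B\<^esub> \<in> \<psi> ` L \<longleftrightarrow> \<zero>\<^bsub>A\<^esub> \<in> L" using mem[of "\<zero>\<^bsub>A\<^esub>"] \<psi>_zero by simp
  have 4: "(\<forall>b\<in>carrier B. F b) \<longleftrightarrow> (\<forall>a\<in>carrier A. F (\<psi> a))" for F
    unfolding \<psi>_image[symmetric] by simp
  have "\<psi> ` L \<subseteq> carrier B" using L \<psi>_simps(1) by auto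
  then show ?thesis
    unfolding A.left_ideal_iff B.left_ideal_iff left_stable_def 4
    using L by (simp add: 1 2 3)
qed

lemma principal_left_image: "x \<in> carrier A \<Longrightarrow> principal_left B (\<psi> x) = \<psi> ` principal_left A x"
  unfolding principal_left_def \<psi>_image[symmetric] image_image by (rule image_cong) (simp_all add: \<psi>_simps)

lemma submodule_sum_image:
  assumes "finite T" "\<And>i. i \<in> T \<Longrightarrow> N i \<subseteq> carrier A"
  shows "submodule_sum B T (\<lambda>i. \<psi> ` N i) = \<psi> ` submodule_sum A T N \<and> submodule_sum A T N \<subseteq> carrier A"
  using assms
proof (induction T rule: finite_induct)
  case empty
  then show ?case by (simp add: A.submodule_sum_empty B.submodule_sum_empty \<psi>_zero)
next
  case (insert i T)
  then have IH: "submodule_sum B T (\<lambda>i. \<psi> ` N i) = \<psi> ` submodule_sum A T N"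
    "submodule_sum A T N \<subseteq> carrier A" by auto
  have A: "submodule_sum A (insert i T) N = {x \<oplus>\<^bsub>A\<^esub> y |x y. x \<in> N i \<and> y \<in> submodule_sum A T N}"
    by (rule A.submodule_sum_insert[OF insert.hyps insert.prems])
  have B: "submodule_sum B (insert i T) (\<lambda>i. \<psi> ` N i)
      = {x \<oplus>\<^bsub>B\<^esub> y |x y. x \<in> \<psi> ` N i \<and> y \<in> submodule_sum B T (\<lambda>i. \<psi> ` N i)}"
    by (rule B.submodule_sum_insert[OF insert.hyps]) (use insert.prems \<psi>_simps(1) in blast)
  have Ni: "N i \<subseteq> carrier A" using insert.prems by auto
  have "\<psi> ` {x \<oplus>\<^bsub>A\<^esub> y |x y. x \<in> N i \<and> y \<in> submodule_sum A T N}
      = {x \<oplus>\<^bsub>B\<^esub> y |x y. x \<in> \<psi> ` N i \<and> y \<in> \<psi> ` submodule_sum A T N}" (is "\<psi> ` ?l = ?r")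
  proof
    show "\<psi> ` ?l \<subseteq> ?r"
    proof
      fix z assume "z \<in> \<psi> ` ?l"
      then obtain x y where *: "z = \<psi> (x \<oplus>\<^bsub>A\<^esub> y)" "x \<in> N i" "y \<in> submodule_sum A T N" by auto
      then have "z = \<psi> x \<oplus>\<^bsub>B\<^esub> \<psi> y" using Ni IH(2) \<psi>_simps(3)[of x y] by (simp add: subset_iff)
      then show "z \<in> ?r" using * by blast
    qed
    show "?r \<subseteq> \<psi> ` ?l"
    proof
      fix z assume "z \<in> ?r"
      then obtain x y where *: "z = \<psi> x \<oplus>\<^bsub>B\<^esub> \<psi> y" "x \<in> N i" "y \<in> submodule_sum A T N" by auto
      then have "z = \<psi> (x \<oplus>\<^bsub>A\<^esub> y)" using Ni IH(2) \<psi>_simps(3)[of x y] by (simp add: subset_iff)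
      then show "z \<in> \<psi> ` ?l" using * by blast
    qed
  qed
  moreover have "submodule_sum A (insert i T) N \<subseteq> carrier A" unfolding A using Ni IH(2) by auto
  ultimately show ?case unfolding A B IH by simp
qed

lemma principal_left_subset: "x \<in> carrier A \<Longrightarrow> principal_left A x \<subseteq> carrier A"
  unfolding principal_left_def by auto

lemma left_ideal_subset: "left_ideal A L \<Longrightarrow> L \<subseteq> carrier A"
  unfolding left_ideal_def by (auto simp: additive_subgroup.a_Hcarr)

lemma submodule_sum_principal_left_image:
  assumes "finite T" "\<And>a. a \<in> T \<Longrightarrow> \<alpha> a \<in> carrier A"
  shows "submodule_sum B T (\<lambda>a. principal_left B (\<psi> (\<alpha> a))) = \<psi> ` submodule_sum A T (\<lambda>a. principal_left A (\<alpha> a))"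
    and "submodule_sum A T (\<lambda>a. principal_left A (\<alpha> a)) \<subseteq> carrier A"
proof -
  have *: "submodule_sum B T (\<lambda>a. \<psi> ` principal_left A (\<alpha> a)) = \<psi> ` submodule_sum A T (\<lambda>a. principal_left A (\<alpha> a))
    \<and> submodule_sum A T (\<lambda>a. principal_left A (\<alpha> a)) \<subseteq> carrier A"
    by (rule submodule_sum_image) (use assms principal_left_subset in auto)
  then show "submodule_sum A T (\<lambda>a. principal_left A (\<alpha> a)) \<subseteq> carrier A" by simp
  have "(\<Pi> a\<in>T. principal_left B (\<psi> (\<alpha> a))) = (\<Pi> a\<in>T. \<psi> ` principal_left A (\<alpha> a))"
    by (auto simp: Pi_def assms principal_left_image)
  then show "submodule_sum B T (\<lambda>a. principal_left B (\<psi> (\<alpha> a))) = \<psi> ` submodule_sum A T (\<lambda>a. principal_left A (\<alpha> a))"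
    using * unfolding submodule_sum_def by simp
qed

lemma local_principal_left_iff:
  assumes "x \<in> carrier A"
  shows "local_module (left_ideal B) (principal_left B (\<psi> x)) \<longleftrightarrow> local_module (left_ideal A) (principal_left A x)"
  unfolding principal_left_image[OF assms]
  by (rule local_module_image[where S = "left_ideal A" and T = "left_ideal B", OF \<psi>_inj left_ideal_subset left_ideal_image principal_left_subset[OF assms]])

lemma module_rad_principal_left_image:
  assumes "x \<in> carrier A"
  shows "module_rad (left_ideal B) (principal_left B (\<psi> x)) = \<psi> ` module_rad (left_ideal A) (principal_left A x)"
  unfolding principal_left_image[OF assms]
  by (rule module_rad_image[where S = "left_ideal A" and T = "left_ideal B", OF \<psi>_inj left_ideal_subset left_ideal_image principal_left_subset[OF assms]])

lemma module_rad_subset: "x \<in> carrier A \<Longrightarrow> module_rad S (principal_left A x) \<subseteq> carrier A"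
  unfolding module_rad_def using principal_left_subset by auto

lemma module_rad_eq_iff:
  assumes x: "x \<in> carrier A" and T: "finite T" "\<And>a. a \<in> T \<Longrightarrow> \<alpha> a \<in> carrier A"
  shows "module_rad (left_ideal B) (principal_left B (\<psi> x)) = submodule_sum B T (\<lambda>a. principal_left B (\<psi> (\<alpha> a)))
    \<longleftrightarrow> module_rad (left_ideal A) (principal_left A x) = submodule_sum A T (\<lambda>a. principal_left A (\<alpha> a))"
proof -
  have s1: "submodule_sum B T (\<lambda>a. principal_left B (\<psi> (\<alpha> a))) = \<psi> ` submodule_sum A T (\<lambda>a. principal_left A (\<alpha> a))"
    by (rule submodule_sum_principal_left_image(1)) (fact T)+
  have s2: "submodule_sum A T (\<lambda>a. principal_left A (\<alpha> a)) \<subseteq> carrier A"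
    by (rule submodule_sum_principal_left_image(2)) (fact T)+
  show ?thesis unfolding module_rad_principal_left_image[OF x] s1
    by (rule inj_on_image_eq_iff[OF \<psi>_inj module_rad_subset[OF x] s2])
qed

lemma distinct_iff:
  assumes x: "x \<in> carrier A" and T: "finite T" "\<And>a. a \<in> T \<Longrightarrow> \<alpha> a \<in> carrier A"
  shows "principal_left B (\<psi> x) \<inter> submodule_sum B T (\<lambda>a. principal_left B (\<psi> (\<alpha> a)))
      \<subseteq> module_rad (left_ideal B) (principal_left B (\<psi> x))
    \<longleftrightarrow> principal_left A x \<inter> submodule_sum A T (\<lambda>a. principal_left A (\<alpha> a))
      \<subseteq> module_rad (left_ideal A) (principal_left A x)"
proof -
  have s1: "submodule_sum B T (\<lambda>a. principal_left B (\<psi> (\<alpha> a))) = \<psi> ` submodule_sum A T (\<lambda>a. principal_left A (\<alpha> a))"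
    by (rule submodule_sum_principal_left_image(1)) (fact T)+
  have s2: "submodule_sum A T (\<lambda>a. principal_left A (\<alpha> a)) \<subseteq> carrier A"
    by (rule submodule_sum_principal_left_image(2)) (fact T)+
  note p = principal_left_subset[OF x]
  have "principal_left A x \<inter> submodule_sum A T (\<lambda>a. principal_left A (\<alpha> a)) \<subseteq> carrier A" using p by auto
  then show ?thesis
    unfolding s1 principal_left_image[OF x] module_rad_principal_left_image[OF x, unfolded principal_left_image[OF x]]
      inj_on_image_Int[OF \<psi>_inj p s2, symmetric]
    by (rule inj_on_image_subset_iff[OF \<psi>_inj _ module_rad_subset[OF x]])
qed

text \<open>Yields the transport of right ideals from that of left ideals.\<close>

lemma op: "ring_isomorphism (op_ring A) (op_ring B) \<psi>"
  by (intro ring_isomorphism.intro ring_op_ring A.ring_axioms B.ring_axioms ring_isomorphism_axioms.intro)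
    (use iso in \<open>auto simp: ring_iso_def ring_hom_def\<close>)

end

section \<open>A subalgebra containing all vertices and arrows is everything\<close>

section \<open>Generation by vertices and arrows\<close>

context arrow_algebra
begin

lemma right_stable_contains_J:
  assumes "left_stable (op_ring M) (carrier M) L" "\<And>a. a \<in> E \<Longrightarrow> \<beta> a \<in> L"
  shows "J \<subseteq> L"
proof -
  interpret op: arrow_algebra R "op_ring M" P J V e E \<beta> tl hd by (rule arrow_algebra_op_ring)
  show ?thesis by (rule op.J_generated) (use assms in simp_all)
qed

text \<open>If \<open>y\<close> is the inverse of an element \<open>q\<close> of a subalgebra \<open>A\<close>, then the chain
  \<open>A \<subseteq> y A \<subseteq> y\<^sup>2 A \<subseteq> \<dots>\<close> stabilises.\<close>

lemma inverse_in_subalgebra: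
  assumes A: "submodule A R M" "\<one>\<^bsub>M\<^esub> \<in> A" "\<And>a b. a \<in> A \<Longrightarrow> b \<in> A \<Longrightarrow> a \<otimes>\<^bsub>M\<^esub> b \<in> A"
    and q: "q \<in> A" and y: "y \<in> carrier M" "y \<otimes>\<^bsub>M\<^esub> q = \<one>\<^bsub>M\<^esub>" "q \<otimes>\<^bsub>M\<^esub> y = \<one>\<^bsub>M\<^esub>"
  shows "y \<in> A"
proof -
  have Ac: "A \<subseteq> carrier M" by (rule submodule_subset[OF A(1)])
  then have qc: "q \<in> carrier M" using q by auto
  define F where "F n = (\<lambda>a. y [^]\<^bsub>M\<^esub> n \<otimes>\<^bsub>M\<^esub> a) ` A" for n :: nat
  have yn: "y [^]\<^bsub>M\<^esub> n \<in> carrier M" for n :: nat using y by simp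
  have F: "submodule (F n) R M" for n
  proof (rule submoduleI')
    show "F n \<subseteq> carrier M" unfolding F_def using Ac yn[of n] by auto
    show "\<zero>\<^bsub>M\<^esub> \<in> F n" unfolding F_def using submodule_zero[OF A(1)] yn[of n]
      by (auto intro!: image_eqI[of _ _ "\<zero>\<^bsub>M\<^esub>"])
    fix x assume "x \<in> F n"
    then obtain a where a: "a \<in> A" "x = y [^]\<^bsub>M\<^esub> n \<otimes>\<^bsub>M\<^esub> a" unfolding F_def by blast
    then have ac: "a \<in> carrier M" using Ac by auto
    {
      fix z assume "z \<in> F n"
      then obtain b where b: "b \<in> A" "z = y [^]\<^bsub>M\<^esub> n \<otimes>\<^bsub>M\<^esub> b" unfolding F_def by blast
      then have "x \<oplus>\<^bsub>M\<^esub> z = y [^]\<^bsub>M\<^esub> n \<otimes>\<^bsub>M\<^esub> (a \<oplus>\<^bsub>M\<^esub> b)" using a ac Ac yn[of n] by (simp add: r_distr subset_iff)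
      then show "x \<oplus>\<^bsub>M\<^esub> z \<in> F n" unfolding F_def using submodule_add[OF A(1)] a b by blast
    }
    fix r assume r: "r \<in> carrier R"
    then have "r \<odot>\<^bsub>M\<^esub> x = y [^]\<^bsub>M\<^esub> n \<otimes>\<^bsub>M\<^esub> (r \<odot>\<^bsub>M\<^esub> a)" using a ac yn[of n] by (simp add: smult_mult_right)
    then show "r \<odot>\<^bsub>M\<^esub> x \<in> F n" unfolding F_def using submodule_smult[OF A(1)] a r by blast
  qed
  have step: "F n \<subseteq> F (Suc n)" for n
  proof
    fix x assume "x \<in> F n"
    then obtain a where a: "a \<in> A" "x = y [^]\<^bsub>M\<^esub> n \<otimes>\<^bsub>M\<^esub> a" unfolding F_def by blast
    then have ac: "a \<in> carrier M" using Ac by auto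
    have "y [^]\<^bsub>M\<^esub> Suc n \<otimes>\<^bsub>M\<^esub> (q \<otimes>\<^bsub>M\<^esub> a) = y [^]\<^bsub>M\<^esub> n \<otimes>\<^bsub>M\<^esub> ((y \<otimes>\<^bsub>M\<^esub> q) \<otimes>\<^bsub>M\<^esub> a)"
      using y(1) qc ac yn[of n] by (simp add: m_assoc)
    then have "x = y [^]\<^bsub>M\<^esub> Suc n \<otimes>\<^bsub>M\<^esub> (q \<otimes>\<^bsub>M\<^esub> a)" using a y(2) ac by simp
    then show "x \<in> F (Suc n)" unfolding F_def using A(3)[OF q a(1)] by blast
  qed
  then have mono: "F m \<subseteq> F n" if "m \<le> n" for m n using that lift_Suc_mono_le[of F] by blast
  \<comment> \<open>The union of the chain is finitely generated over \<open>R\<close>, and its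
    finitely many generators already occur at one stage, where the chain stops.\<close>
  let ?U = "\<Union>n. F n"
  have "submodule ?U R M"
  proof (rule submoduleI')
    show "?U \<subseteq> carrier M" "\<zero>\<^bsub>M\<^esub> \<in> ?U" using submodule_subset[OF F] submodule_zero[OF F] by auto
    fix x assume "x \<in> ?U"
    then obtain m where m: "x \<in> F m" by auto
    show "x \<oplus>\<^bsub>M\<^esub> z \<in> ?U" if "z \<in> ?U" for z
    proof -
      obtain n where "z \<in> F n" using \<open>z \<in> ?U\<close> by auto
      then have "x \<in> F (max m n)" "z \<in> F (max m n)" using m mono[of m "max m n"] mono[of n "max m n"] by auto
      then show ?thesis using submodule_add[OF F] by blast
    qed
    show "r \<odot>\<^bsub>M\<^esub> x \<in> ?U" if "r \<in> carrier R" for r using submodule_smult[OF F that m] by auto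
  qed
  then obtain G where G: "finite G" "G \<subseteq> ?U" "?U \<subseteq> rspan G" using finitely_generated_submodule by blast
  have "\<exists>n. G \<subseteq> F n" using G(1,2)
  proof (induction G rule: finite_induct)
    case (insert g G)
    then obtain m n where "g \<in> F m" "G \<subseteq> F n" by auto
    then have "insert g G \<subseteq> F (max m n)" using mono[of m "max m n"] mono[of n "max m n"] by auto
    then show ?case by blast
  qed simp
  then obtain n where "G \<subseteq> F n" by blast
  then have U: "?U \<subseteq> F n" using G(3) rspan_minimal[OF F] by blast
  \<comment> \<open>Stability puts y^(n+1) = y^n y into y^n A. Multiplying on the left by q^n
    cancels y^n and leaves \<open>y\<close> in \<open>A\<close>.\<close>
  have "y [^]\<^bsub>M\<^esub> Suc n \<otimes>\<^bsub>M\<^esub> \<one>\<^bsub>M\<^esub> \<in> F (Suc n)" unfolding F_def using A(2) by blast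
  then have "y [^]\<^bsub>M\<^esub> Suc n \<otimes>\<^bsub>M\<^esub> \<one>\<^bsub>M\<^esub> \<in> F n" using U by blast
  then have "y [^]\<^bsub>M\<^esub> n \<otimes>\<^bsub>M\<^esub> y \<in> F n" using y(1) by simp
  then obtain a where a: "a \<in> A" "y [^]\<^bsub>M\<^esub> n \<otimes>\<^bsub>M\<^esub> y = y [^]\<^bsub>M\<^esub> n \<otimes>\<^bsub>M\<^esub> a" unfolding F_def by blast
  have qy: "q [^]\<^bsub>M\<^esub> k \<otimes>\<^bsub>M\<^esub> (y [^]\<^bsub>M\<^esub> k \<otimes>\<^bsub>M\<^esub> z) = z" if "z \<in> carrier M" for k :: nat and z
    using that
  proof (induction k arbitrary: z)
    case (Suc k)
    have "q [^]\<^bsub>M\<^esub> Suc k \<otimes>\<^bsub>M\<^esub> (y [^]\<^bsub>M\<^esub> Suc k \<otimes>\<^bsub>M\<^esub> z)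
        = q [^]\<^bsub>M\<^esub> k \<otimes>\<^bsub>M\<^esub> (q \<otimes>\<^bsub>M\<^esub> ((y \<otimes>\<^bsub>M\<^esub> y [^]\<^bsub>M\<^esub> k) \<otimes>\<^bsub>M\<^esub> z))"
      using Suc.prems y(1) qc by (simp add: m_assoc flip: nat_pow_Suc2)
    also have "\<dots> = q [^]\<^bsub>M\<^esub> k \<otimes>\<^bsub>M\<^esub> ((q \<otimes>\<^bsub>M\<^esub> y) \<otimes>\<^bsub>M\<^esub> (y [^]\<^bsub>M\<^esub> k \<otimes>\<^bsub>M\<^esub> z))"
      using Suc.prems y(1) qc by (simp add: m_assoc)
    also have "\<dots> = z" using Suc y by simp
    finally show ?case .
  qed simp
  have "y = a" using qy[of y n] qy[of a n] a Ac y(1) by auto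
  then show ?thesis using a by simp
qed

text \<open>The arrows lie in \<open>A \<inter> J\<close> and generate \<open>J\<close> as a right
  ideal, and modulo \<open>J\<close> the algebra is spanned by the \<open>e v\<close> in
  \<open>A\<close>; so A + (A \<inter> J) M is everything. Nakayama's lemma over \<open>A\<close>
  then applies with \<open>N\<close> taken to be \<open>A\<close> itself.\<close>

lemma subalgebra_eq_carrier:
  assumes A: "submodule A R M" "\<one>\<^bsub>M\<^esub> \<in> A" "\<And>a b. a \<in> A \<Longrightarrow> b \<in> A \<Longrightarrow> a \<otimes>\<^bsub>M\<^esub> b \<in> A"
    and eA: "\<And>v. v \<in> V \<Longrightarrow> e v \<in> A" and \<beta>A: "\<And>a. a \<in> E \<Longrightarrow> \<beta> a \<in> A"
  shows "A = carrier M"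
proof -
  have Ac: "A \<subseteq> carrier M" by (rule submodule_subset[OF A(1)])
  obtain S where S: "finite S" "S \<subseteq> carrier M" "carrier M \<subseteq> rspan S" using finitely_generated by blast
  have AA: "left_stable M A A"
    unfolding left_stable_def using Ac submodule_zero[OF A(1)] submodule_add[OF A(1)] A(3) by blast
  have "S \<subseteq> A"
  proof (rule nakayama[OF Ac, of "A \<inter> J"])
    show "left_stable M A (A \<inter> J)"
      using AA left_stable_J Ac unfolding left_stable_def by blast
    fix p assume p: "p \<in> A \<inter> J"
    obtain y where y: "y \<in> carrier M" "y \<otimes>\<^bsub>M\<^esub> (\<one>\<^bsub>M\<^esub> \<ominus>\<^bsub>M\<^esub> p) = \<one>\<^bsub>M\<^esub>" "(\<one>\<^bsub>M\<^esub> \<ominus>\<^bsub>M\<^esub> p) \<otimes>\<^bsub>M\<^esub> y = \<one>\<^bsub>M\<^esub>"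
      using quasi_regular[of p] p unfolding Units_def by blast
    have "\<one>\<^bsub>M\<^esub> \<ominus>\<^bsub>M\<^esub> p \<in> A" using submodule_minus[OF A(1,2)] p by blast
    from inverse_in_subalgebra[OF A this y] show "\<exists>u\<in>A. u \<otimes>\<^bsub>M\<^esub> (\<one>\<^bsub>M\<^esub> \<ominus>\<^bsub>M\<^esub> p) = \<one>\<^bsub>M\<^esub>" using y by blast
  next
    fix Y assume Y: "left_stable M A Y" "A \<subseteq> Y" and PS: "\<And>p s. p \<in> A \<inter> J \<Longrightarrow> s \<in> S \<Longrightarrow> p \<otimes>\<^bsub>M\<^esub> s \<in> Y"
    have Yc: "Y \<subseteq> carrier M" using Y unfolding left_stable_def by auto
    \<comment> \<open>\<open>Y\<close> is stable only under \<open>A\<close>, but the scalar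
      \<open>r\<close> acts as the element r 1 of \<open>A\<close>.\<close>
    have Ys: "submodule Y R M"
    proof (rule submoduleI'[OF Yc])
      show "r \<odot>\<^bsub>M\<^esub> x \<in> Y" if "r \<in> carrier R" "x \<in> Y" for r x
      proof -
        have "(r \<odot>\<^bsub>M\<^esub> \<one>\<^bsub>M\<^esub>) \<otimes>\<^bsub>M\<^esub> x \<in> Y"
          using Y(1) submodule_smult[OF A(1) that(1) A(2)] that(2) unfolding left_stable_def by blast
        then show ?thesis using smult_one_mult[of r x] that Yc by auto
      qed
    qed (use Y(1) in \<open>auto simp: left_stable_def\<close>)
    \<comment> \<open>\<open>PS\<close> concerns the generators in \<open>S\<close>; linearity over
      \<open>R\<close> extends it to the whole algebra.\<close>
    have PM: "p \<otimes>\<^bsub>M\<^esub> x \<in> Y" if p: "p \<in> A \<inter> J" and x: "x \<in> carrier M" for p x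
    proof -
      let ?Z = "{x \<in> carrier M. p \<otimes>\<^bsub>M\<^esub> x \<in> Y}"
      have pc: "p \<in> carrier M" using p by auto
      have "submodule ?Z R M"
        by (rule submoduleI') (use pc submodule_zero[OF Ys] submodule_add[OF Ys] submodule_smult[OF Ys]
            in \<open>auto simp: r_distr smult_mult_right\<close>)
      moreover have "S \<subseteq> ?Z" using S PS p by auto
      ultimately have "carrier M \<subseteq> ?Z" using rspan_minimal S(3) by blast
      then show ?thesis using x by auto
    qed
    \<comment> \<open>The \<open>x\<close> whose right multiples all lie in \<open>Y\<close> form a
      right ideal containing the arrows, hence containing \<open>J\<close>. Taking z = 1 gives
      \<open>J\<close> inside \<open>Y\<close>.\<close>
    let ?L = "{x \<in> carrier M. \<forall>z\<in>carrier M. x \<otimes>\<^bsub>M\<^esub> z \<in> Y}"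
    have "left_stable (op_ring M) (carrier M) ?L"
      unfolding left_stable_def op_ring_simps
      using submodule_zero[OF Ys] submodule_add[OF Ys] by (auto simp: l_distr m_assoc)
    moreover have "\<beta> a \<in> ?L" if "a \<in> E" for a using PM \<beta>A[OF that] arrow_J[OF that] by auto
    ultimately have "J \<subseteq> ?L" by (rule right_stable_contains_J)
    then have "J \<subseteq> Y" by force
    then have "carrier M \<subseteq> Y" by (rule carrier_induct[OF Ys]) (use eA Y in auto)
    then show "S \<subseteq> Y" using S by auto
  qed (use A S AA submodule_add[OF A(1)] in auto)
  then show ?thesis using S(3) rspan_minimal[OF A(1)] Ac by blast
qed

end

section \<open>The kernel of the representation and the induced isomorphism\<close>

section \<open>Presentation by a quiver\<close>

lemma submodule_sum_cong:
  assumes "\<And>i. i \<in> T \<Longrightarrow> N i = N' i"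
  shows "submodule_sum A T N = submodule_sum A T N'"
proof -
  have "Pi T N = Pi T N'" using assms by (auto simp: Pi_def)
  then show ?thesis unfolding submodule_sum_def by simp
qed

lemma ring_quot_algebra:
  assumes "ring (A Quot I)"
  shows "ring (quot_algebra A I)"
proof -
  interpret Q: ring "A Quot I" by fact
  show ?thesis unfolding quot_algebra_def
  proof (rule ringI)
    show "abelian_group (ring.extend (A Quot I) m)" for m
      by (rule abelian_groupI)
        (auto simp: ring.defs Q.a_ac intro: bexI[of _ "\<ominus>\<^bsub>A Quot I\<^esub> x" for x] Q.l_neg)
    show "monoid (ring.extend (A Quot I) m)" for m
      by (rule monoidI) (auto simp: ring.defs Q.m_assoc)
  qed (auto simp: ring.defs Q.l_distr Q.r_distr)
qed

lemma ring_iso_quot_algebra_iff: "h \<in> ring_iso (quot_algebra A I) B \<longleftrightarrow> h \<in> ring_iso (A Quot I) B"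
  by (simp add: ring_iso_def ring_hom_def quot_algebra_def ring.defs)

lemma quot_algebra_simps:
  "carrier (quot_algebra A I) = carrier (A Quot I)"
  "r \<odot>\<^bsub>quot_algebra A I\<^esub> C = (\<Union>x\<in>C. I +>\<^bsub>A\<^esub> (r \<odot>\<^bsub>A\<^esub> x))"
  by (simp_all add: quot_algebra_def ring.defs module.defs)

text \<open>The scalar action is defined as a union over a coset. All cosets in this union coincide,
  because multiplication by r 1 maps the ideal \<open>I\<close> into itself.\<close>

lemma (in assoc_algebra) smult_quot_algebra:
  assumes I: "ideal I M" and r: "r \<in> carrier R" and x: "x \<in> carrier M"
  shows "r \<odot>\<^bsub>quot_algebra M I\<^esub> (I +>\<^bsub>M\<^esub> x) = I +>\<^bsub>M\<^esub> (r \<odot>\<^bsub>M\<^esub> x)"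
proof -
  interpret I: ideal I M by fact
  have "I +>\<^bsub>M\<^esub> (r \<odot>\<^bsub>M\<^esub> y) = I +>\<^bsub>M\<^esub> (r \<odot>\<^bsub>M\<^esub> x)" if y: "y \<in> I +>\<^bsub>M\<^esub> x" for y
  proof -
    have yc: "y \<in> carrier M" by (rule I.a_elemrcos_carrier[OF x y])
    have "y \<ominus>\<^bsub>M\<^esub> x \<in> I"
      using quotient_eq_iff_same_a_r_cos[OF I yc x] I.a_repr_independence'[OF y x] by simp
    then have "(r \<odot>\<^bsub>M\<^esub> \<one>\<^bsub>M\<^esub>) \<otimes>\<^bsub>M\<^esub> (y \<ominus>\<^bsub>M\<^esub> x) \<in> I" using r by (simp add: I.I_l_closed)
    moreover have "(r \<odot>\<^bsub>M\<^esub> \<one>\<^bsub>M\<^esub>) \<otimes>\<^bsub>M\<^esub> (y \<ominus>\<^bsub>M\<^esub> x) = r \<odot>\<^bsub>M\<^esub> y \<ominus>\<^bsub>M\<^esub> r \<odot>\<^bsub>M\<^esub> x"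
      using r x yc by (simp add: a_minus_def smult_mult_left smult_r_distr smult_r_minus)
    ultimately show ?thesis using quotient_eq_iff_same_a_r_cos[OF I] r x yc by simp
  qed
  moreover have "I +>\<^bsub>M\<^esub> x \<noteq> {}" using I.a_rcos_self[OF x] by blast
  ultimately show ?thesis unfolding quot_algebra_simps by (intro SUP_eq_const)
qed

context arrow_algebra
begin

definition quiver :: "('v, 'e) pre_digraph" where
  "quiver = \<lparr>verts = V, arcs = E, tail = tl, head = hd\<rparr>"

lemma quiver_simps [simp]:
  "verts quiver = V" "arcs quiver = E" "tail quiver = tl" "head quiver = hd"
  by (simp_all add: quiver_def)

lemma fin_digraph_quiver: "fin_digraph quiver"
  by unfold_locales (simp_all add: hd_V tl_V finite_V finite_E)

lemma path_representation_quiver: "path_representation R M quiver e \<beta>"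
  by (intro path_representation.intro path_representation_axioms.intro quiver_algebra.intro
      assoc_algebra_axioms R.cring_axioms fin_digraph_quiver)
    (simp_all add: e_closed e_mult e_sum e_hd e_tl)

text \<open>The ideal is the kernel of the representation, and \<open>subalgebra_eq_carrier\<close>
  makes the representation surjective. The conditions hold in \<open>M\<close> for the
  \<open>e v\<close> and \<open>\<beta> a\<close> and are pulled back along the induced isomorphism
  \<open>\<psi>\<close>; the right-sided ones are pulled back along \<open>\<psi>\<close> between
  the opposite rings.\<close>

theorem quiver_presentation:
  "\<exists>I. ideal I (path_algebra R quiver) \<and> permissible R quiver I \<and> arrow_radical R quiver I \<and>
    arrow_distinct R quiver I \<and> algebra_isomorphic R M (quot_algebra (path_algebra R quiver) I)"
proof -
  interpret rep: path_representation R M quiver e \<beta> by (rule path_representation_quiver)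
  let ?PA = "path_algebra R quiver"
  interpret h: ring_hom_ring ?PA M rep.rep by (rule rep.rep_hom)
  define I where "I = a_kernel ?PA M rep.rep"
  define \<Lambda> where "\<Lambda> = quot_algebra ?PA I"
  \<comment> \<open>The representation is constant on cosets of its kernel, so the image of a coset
    is a singleton.\<close>
  define \<psi> where "\<psi> C = the_elem (rep.rep ` C)" for C
  have idI: "ideal I ?PA" unfolding I_def by (rule h.kernel_is_ideal)
  have vert: "vertex_elem R v \<in> carrier ?PA" if "v \<in> V" for v
    unfolding vertex_elem_def using that by (intro rep.path_basis_closed) (simp add: rep.trivial_path)
  have arr: "arrow_elem R quiver a \<in> carrier ?PA" if "a \<in> E" for a
    unfolding arrow_elem_def by (intro rep.path_basis_closed rep.arrow_path) (simp add: that)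
  have im: "x \<in> rep.rep ` carrier ?PA" if "f \<in> carrier ?PA" "rep.rep f = x" for f x using that by blast
  have "rep.rep ` carrier ?PA = carrier M"
  proof (rule subalgebra_eq_carrier)
    show "submodule (rep.rep ` carrier ?PA) R M"
    proof (rule submoduleI')
      show "rep.rep ` carrier ?PA \<subseteq> carrier M" using rep.rep_closed by auto
      show "\<zero>\<^bsub>M\<^esub> \<in> rep.rep ` carrier ?PA" by (rule im[OF _ rep.rep_zero]) simp
      fix x assume "x \<in> rep.rep ` carrier ?PA"
      then obtain f where f: "f \<in> carrier ?PA" "x = rep.rep f" by blast
      show "x \<oplus>\<^bsub>M\<^esub> y \<in> rep.rep ` carrier ?PA" if y: "y \<in> rep.rep ` carrier ?PA" for y
      proof -
        obtain g where g: "g \<in> carrier ?PA" "y = rep.rep g" using y by blast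
        then show ?thesis using f by (intro im[of "f \<oplus>\<^bsub>?PA\<^esub> g"]) simp_all
      qed
      show "r \<odot>\<^bsub>M\<^esub> x \<in> rep.rep ` carrier ?PA" if "r \<in> carrier R" for r
        using rep.rep_smult[OF that f(1)] f that by (intro im[of "r \<odot>\<^bsub>?PA\<^esub> f"]) simp_all
    qed
    show "\<one>\<^bsub>M\<^esub> \<in> rep.rep ` carrier ?PA" by (rule im[OF _ rep.rep_one]) simp
    show "x \<otimes>\<^bsub>M\<^esub> y \<in> rep.rep ` carrier ?PA"
      if xy: "x \<in> rep.rep ` carrier ?PA" "y \<in> rep.rep ` carrier ?PA" for x y
    proof -
      obtain f g where fg: "f \<in> carrier ?PA" "x = rep.rep f" "g \<in> carrier ?PA" "y = rep.rep g"
        using xy by blast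
      then show ?thesis by (intro im[of "f \<otimes>\<^bsub>?PA\<^esub> g"]) simp_all
    qed
    show "e v \<in> rep.rep ` carrier ?PA" if "v \<in> V" for v
      using rep.rep_vertex[of v] that vert[OF that] by (intro im[of "vertex_elem R v"]) simp_all
    show "\<beta> a \<in> rep.rep ` carrier ?PA" if "a \<in> E" for a
      using rep.rep_arrow[of a] that arr[OF that] by (intro im[of "arrow_elem R quiver a"]) simp_all
  qed
  then have iso: "\<psi> \<in> ring_iso \<Lambda> M"
    unfolding \<Lambda>_def ring_iso_quot_algebra_iff \<psi>_def I_def by (rule h.FactRing_iso_set)
  have ring\<Lambda>: "ring \<Lambda>" unfolding \<Lambda>_def by (rule ring_quot_algebra[OF ideal.quotient_is_ring[OF idI]])
  interpret T: ring_isomorphism \<Lambda> M \<psi>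
    by (intro ring_isomorphism.intro ring\<Lambda> ring_axioms ring_isomorphism_axioms.intro iso)
  interpret opT: ring_isomorphism "op_ring \<Lambda>" "op_ring M" \<psi> by (rule T.op)
  interpret op: arrow_algebra R "op_ring M" P J V e E \<beta> tl hd by (rule arrow_algebra_op_ring)
  define q where "q f = I +>\<^bsub>?PA\<^esub> f" for f
  have carrier\<Lambda>: "carrier \<Lambda> = q ` carrier ?PA"
    unfolding \<Lambda>_def quot_algebra_simps q_def FactRing_def A_RCOSETS_def' by auto
  have q: "q f \<in> carrier \<Lambda>" if "f \<in> carrier ?PA" for f using that carrier\<Lambda> by blast
  have \<psi>q: "\<psi> (q f) = rep.rep f" if "f \<in> carrier ?PA" for f
    unfolding \<psi>_def q_def I_def by (rule h.the_elem_simp[OF that])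
  have qe: "q (vertex_elem R v) \<in> carrier \<Lambda>" "\<psi> (q (vertex_elem R v)) = e v" if "v \<in> V" for v
    using vert[OF that] q \<psi>q rep.rep_vertex that by auto
  have qa: "q (arrow_elem R quiver a) \<in> carrier \<Lambda>" "\<psi> (q (arrow_elem R quiver a)) = \<beta> a" if "a \<in> E" for a
    using arr[OF that] q \<psi>q rep.rep_arrow that by auto
  let ?\<alpha> = "\<lambda>a. q (arrow_elem R quiver a)"
  have sumT: "submodule_sum M S (\<lambda>a. principal_left M (\<psi> (?\<alpha> a))) = submodule_sum M S (\<lambda>a. principal_left M (\<beta> a))" if S: "S \<subseteq> E" for S
    by (rule submodule_sum_cong) (use qa(2) S in auto)
  have sum_op: "submodule_sum (op_ring M) S (\<lambda>a. principal_left (op_ring M) (\<psi> (?\<alpha> a))) =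
      submodule_sum (op_ring M) S (\<lambda>a. principal_left (op_ring M) (\<beta> a))" if S: "S \<subseteq> E" for S
    by (rule submodule_sum_cong) (use qa(2) S in auto)
  have "permissible R quiver I"
    unfolding permissible_def
  proof
    fix a assume "a \<in> arcs quiver"
    then show "arrow_elem R quiver a \<notin> I"
      using rep.rep_arrow[of a] arrow_nonzero[of a] unfolding I_def a_kernel_def' by auto
  qed
  moreover have "arrow_radical R quiver I"
    unfolding arrow_radical_def Let_def
  proof (fold q_def \<Lambda>_def, intro ballI conjI)
    fix v assume "v \<in> verts quiver"
    then have v: "v \<in> V" by simp
    have fin: "finite {a \<in> arcs quiver. tail quiver a = v}" "finite {a \<in> arcs quiver. head quiver a = v}"
      using finite_E by simp_all
    show "local_module (left_ideal \<Lambda>) (principal_left \<Lambda> (q (vertex_elem R v)))"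
      using T.local_principal_left_iff[OF qe(1)[OF v]] radical_left(1)[OF v] qe(2)[OF v] by simp
    show "local_module (right_ideal \<Lambda>) (principal_right \<Lambda> (q (vertex_elem R v)))"
      using opT.local_principal_left_iff[unfolded op_ring_simps, OF qe(1)[OF v]] op.radical_left(1)[OF v] qe(2)[OF v]
      by (simp add: left_ideal_op_ring principal_left_op_ring)
    have "module_rad (left_ideal M) (principal_left M (\<psi> (q (vertex_elem R v)))) =
      submodule_sum M {a \<in> arcs quiver. tail quiver a = v} (\<lambda>a. principal_left M (\<psi> (?\<alpha> a)))"
      using radical_left(2)[OF v] qe(2)[OF v] sumT[of "{a \<in> E. tl a = v}"] by simp
    then show "module_rad (left_ideal \<Lambda>) (principal_left \<Lambda> (q (vertex_elem R v))) =
      submodule_sum \<Lambda> {a \<in> arcs quiver. tail quiver a = v} (\<lambda>a. principal_left \<Lambda> (?\<alpha> a))"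
      by (subst (asm) T.module_rad_eq_iff) (use qe(1)[OF v] fin qa(1) in simp_all)
    have "module_rad (left_ideal (op_ring M)) (principal_left (op_ring M) (\<psi> (q (vertex_elem R v)))) =
      submodule_sum (op_ring M) {a \<in> arcs quiver. head quiver a = v} (\<lambda>a. principal_left (op_ring M) (\<psi> (?\<alpha> a)))"
      using op.radical_left(2)[OF v] qe(2)[OF v] sum_op[of "{a \<in> E. hd a = v}"] by simp
    then have "module_rad (left_ideal (op_ring \<Lambda>)) (principal_left (op_ring \<Lambda>) (q (vertex_elem R v))) =
      submodule_sum (op_ring \<Lambda>) {a \<in> arcs quiver. head quiver a = v} (\<lambda>a. principal_left (op_ring \<Lambda>) (?\<alpha> a))"
      by (subst (asm) opT.module_rad_eq_iff) (use qe(1)[OF v] fin qa(1) in simp_all)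
    then show "module_rad (right_ideal \<Lambda>) (principal_right \<Lambda> (q (vertex_elem R v))) =
      submodule_sum \<Lambda> {a \<in> arcs quiver. head quiver a = v} (\<lambda>a. principal_right \<Lambda> (?\<alpha> a))"
      by (simp only: left_ideal_op_ring principal_left_op_ring submodule_sum_op_ring)
  qed
  moreover have "arrow_distinct R quiver I"
    unfolding arrow_distinct_def Let_def
  proof (fold q_def \<Lambda>_def, intro ballI conjI)
    fix a assume "a \<in> arcs quiver"
    then have a: "a \<in> E" by simp
    let ?S = "{b \<in> arcs quiver. b \<noteq> a \<and> tail quiver b = tail quiver a}"
    let ?S' = "{b \<in> arcs quiver. b \<noteq> a \<and> head quiver b = head quiver a}"
    have fin: "finite ?S" "finite ?S'" using finite_E by simp_all
    have "principal_left M (\<psi> (?\<alpha> a)) \<inter> submodule_sum M ?S (\<lambda>b. principal_left M (\<psi> (?\<alpha> b)))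
      \<subseteq> module_rad (left_ideal M) (principal_left M (\<psi> (?\<alpha> a)))"
      using distinct_left[OF a] qa(2)[OF a] sumT[of "{b \<in> E. b \<noteq> a \<and> tl b = tl a}"] by simp
    then show "principal_left \<Lambda> (?\<alpha> a) \<inter> submodule_sum \<Lambda> ?S (\<lambda>b. principal_left \<Lambda> (?\<alpha> b))
      \<subseteq> module_rad (left_ideal \<Lambda>) (principal_left \<Lambda> (?\<alpha> a))"
      by (subst (asm) T.distinct_iff) (use qa(1) a fin in simp_all)
    have "principal_left (op_ring M) (\<psi> (?\<alpha> a)) \<inter>
        submodule_sum (op_ring M) ?S' (\<lambda>b. principal_left (op_ring M) (\<psi> (?\<alpha> b)))
      \<subseteq> module_rad (left_ideal (op_ring M)) (principal_left (op_ring M) (\<psi> (?\<alpha> a)))"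
      using op.distinct_left[OF a] qa(2)[OF a] sum_op[of "{b \<in> E. b \<noteq> a \<and> hd b = hd a}"] by simp
    then have "principal_left (op_ring \<Lambda>) (?\<alpha> a) \<inter>
        submodule_sum (op_ring \<Lambda>) ?S' (\<lambda>b. principal_left (op_ring \<Lambda>) (?\<alpha> b))
      \<subseteq> module_rad (left_ideal (op_ring \<Lambda>)) (principal_left (op_ring \<Lambda>) (?\<alpha> a))"
      by (subst (asm) opT.distinct_iff) (use qa(1) a fin in simp_all)
    then show "principal_right \<Lambda> (?\<alpha> a) \<inter> submodule_sum \<Lambda> ?S' (\<lambda>b. principal_right \<Lambda> (?\<alpha> b))
      \<subseteq> module_rad (right_ideal \<Lambda>) (principal_right \<Lambda> (?\<alpha> a))"
      by (simp only: left_ideal_op_ring principal_left_op_ring submodule_sum_op_ring)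
  qed
  moreover have "algebra_isomorphic R M \<Lambda>"
    unfolding algebra_isomorphic_def
  proof (intro bexI ballI)
    let ?h = "inv_into (carrier \<Lambda>) \<psi>"
    show "?h \<in> ring_iso M \<Lambda>" by (rule ring_iso_set_sym[OF ring\<Lambda> iso])
    fix r x assume r: "r \<in> carrier R" and x: "x \<in> carrier M"
    have hx: "?h x \<in> carrier \<Lambda>" "\<psi> (?h x) = x"
      using x T.\<psi>_image inv_into_into[of x \<psi> "carrier \<Lambda>"] f_inv_into_f[of x \<psi> "carrier \<Lambda>"] by auto
    then obtain f where f: "f \<in> carrier ?PA" "?h x = q f" using carrier\<Lambda> by auto
    have rf: "r \<odot>\<^bsub>?PA\<^esub> f \<in> carrier ?PA" using r f by simp
    have "r \<odot>\<^bsub>\<Lambda>\<^esub> q f = q (r \<odot>\<^bsub>?PA\<^esub> f)" unfolding \<Lambda>_def q_def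
      by (rule assoc_algebra.smult_quot_algebra[OF rep.assoc_algebra_PA idI r f(1)])
    moreover have "\<psi> (q (r \<odot>\<^bsub>?PA\<^esub> f)) = r \<odot>\<^bsub>M\<^esub> x"
      using \<psi>q[OF rf] \<psi>q[OF f(1)] rep.rep_smult[OF r f(1)] hx f by simp
    ultimately show "?h (r \<odot>\<^bsub>M\<^esub> x) = r \<odot>\<^bsub>\<Lambda>\<^esub> ?h x"
      using inv_into_f_f[OF T.\<psi>_inj q[OF rf]] f by simp
  qed
  ultimately show ?thesis using idI unfolding \<Lambda>_def by blast
qed

end

section \<open>Peirce components and the choice of the arrows\<close>

section \<open>Minimal systems of arrows\<close>

context split_algebra
begin

text \<open>The idempotents sum to 1, so \<open>x\<close> is the sum of all its components e_v x
  e_w.\<close>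

lemma peirce_decomposition:
  assumes N: "submodule N R M" and x: "x \<in> carrier M"
    and *: "\<And>v w. v \<in> V \<Longrightarrow> w \<in> V \<Longrightarrow> e v \<otimes>\<^bsub>M\<^esub> x \<otimes>\<^bsub>M\<^esub> e w \<in> N"
  shows "x \<in> N"
proof -
  have ec: "e \<in> V \<rightarrow> carrier M" using e_closed by auto
  have "e v \<otimes>\<^bsub>M\<^esub> x \<in> N" if v: "v \<in> V" for v
  proof -
    have c: "e v \<otimes>\<^bsub>M\<^esub> x \<in> carrier M" using e_closed[OF v] x by simp
    have "e v \<otimes>\<^bsub>M\<^esub> x = e v \<otimes>\<^bsub>M\<^esub> x \<otimes>\<^bsub>M\<^esub> (\<Oplus>\<^bsub>M\<^esub>w\<in>V. e w)" using c by (simp add: e_sum)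
    also have "\<dots> = (\<Oplus>\<^bsub>M\<^esub>w\<in>V. e v \<otimes>\<^bsub>M\<^esub> x \<otimes>\<^bsub>M\<^esub> e w)" by (rule finsum_rdistr[OF finite_V c ec])
    also have "\<dots> \<in> N" by (rule submodule_finsum[OF N finite_V]) (use * v in auto)
    finally show ?thesis .
  qed
  moreover have "x = (\<Oplus>\<^bsub>M\<^esub>v\<in>V. e v) \<otimes>\<^bsub>M\<^esub> x" using x by (simp add: e_sum)
  moreover have "\<dots> = (\<Oplus>\<^bsub>M\<^esub>v\<in>V. e v \<otimes>\<^bsub>M\<^esub> x)" by (rule finsum_ldistr[OF finite_V x ec])
  ultimately show ?thesis using submodule_finsum[OF N finite_V, of "\<lambda>v. e v \<otimes>\<^bsub>M\<^esub> x"] by auto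
qed

text \<open>The Peirce components of finitely many \<open>R\<close>-generators of \<open>J\<close>
  form a finite set \<open>B0\<close> that generates \<open>J\<close> modulo J^2 (this is
  \<open>gen\<close>). An inclusion-minimal generating subset of \<open>B0\<close> provides the
  arrows; as Peirce components its members come with a head and a tail.\<close>

lemma exists_arrows: "\<exists>(E :: nat set) \<beta> hd tl. arrow_algebra R M P J V e E \<beta> hd tl"
proof -
  define gen where "gen B \<longleftrightarrow> (\<forall>N. submodule N R M \<longrightarrow> B \<subseteq> N \<longrightarrow>
    (\<forall>x\<in>J. \<forall>y\<in>J. x \<otimes>\<^bsub>M\<^esub> y \<in> N) \<longrightarrow> J \<subseteq> N)" for B
  obtain G where G: "finite G" "G \<subseteq> J" "J \<subseteq> rspan G" using finitely_generated_submodule[OF submodule_J] by blast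
  define B0 where "B0 = (\<lambda>(v, g, w). e v \<otimes>\<^bsub>M\<^esub> g \<otimes>\<^bsub>M\<^esub> e w) ` (V \<times> G \<times> V)"
  have B0: "finite B0" unfolding B0_def using finite_V G by simp
  have "gen B0" unfolding gen_def
  proof (intro allI impI)
    fix N assume N: "submodule N R M" "B0 \<subseteq> N"
    have "G \<subseteq> N"
    proof
      fix g assume g: "g \<in> G"
      show "g \<in> N"
      proof (rule peirce_decomposition[OF N(1)])
        show "g \<in> carrier M" using g G J_subset by auto
        fix v w assume "v \<in> V" "w \<in> V"
        then have "e v \<otimes>\<^bsub>M\<^esub> g \<otimes>\<^bsub>M\<^esub> e w \<in> B0" unfolding B0_def using g by force
        then show "e v \<otimes>\<^bsub>M\<^esub> g \<otimes>\<^bsub>M\<^esub> e w \<in> N" using N(2) by auto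
      qed
    qed
    then show "J \<subseteq> N" using rspan_minimal[OF N(1)] G(3) by blast
  qed
  then have "{B. B \<subseteq> B0 \<and> gen B} \<noteq> {}" by auto
  moreover have "finite {B. B \<subseteq> B0 \<and> gen B}" using B0 by simp
  ultimately obtain B where B: "B \<subseteq> B0" "gen B" and min: "\<And>B'. B' \<subseteq> B0 \<Longrightarrow> gen B' \<Longrightarrow> B' \<subseteq> B \<Longrightarrow> B = B'"
    using finite_has_minimal[of "{B. B \<subseteq> B0 \<and> gen B}"] by auto
  have finB: "finite B" using B(1) B0 finite_subset by blast
  have BJ: "b \<in> J" and ends: "\<exists>v\<in>V. \<exists>w\<in>V. e v \<otimes>\<^bsub>M\<^esub> b = b \<and> b \<otimes>\<^bsub>M\<^esub> e w = b" if b: "b \<in> B" for b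
  proof -
    obtain v g w where vgw: "b = e v \<otimes>\<^bsub>M\<^esub> g \<otimes>\<^bsub>M\<^esub> e w" "v \<in> V" "w \<in> V" "g \<in> G"
      using subsetD[OF B(1) b] unfolding B0_def by auto
    have gJ: "g \<in> J" using vgw G by auto
    then have c: "g \<in> carrier M" "e v \<in> carrier M" "e w \<in> carrier M" using vgw e_closed by auto
    show "b \<in> J" using gJ c vgw J_mult by simp
    have "e v \<otimes>\<^bsub>M\<^esub> b = (e v \<otimes>\<^bsub>M\<^esub> e v) \<otimes>\<^bsub>M\<^esub> g \<otimes>\<^bsub>M\<^esub> e w" unfolding vgw(1) using c by (simp add: m_assoc)
    moreover have "b \<otimes>\<^bsub>M\<^esub> e w = e v \<otimes>\<^bsub>M\<^esub> g \<otimes>\<^bsub>M\<^esub> (e w \<otimes>\<^bsub>M\<^esub> e w)" unfolding vgw(1) using c by (simp add: m_assoc)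
    ultimately have "e v \<otimes>\<^bsub>M\<^esub> b = b" "b \<otimes>\<^bsub>M\<^esub> e w = b" using e_mult vgw by simp_all
    then show "\<exists>v\<in>V. \<exists>w\<in>V. e v \<otimes>\<^bsub>M\<^esub> b = b \<and> b \<otimes>\<^bsub>M\<^esub> e w = b" using vgw by blast
  qed
  obtain hd' tl' where ht: "\<And>b. b \<in> B \<Longrightarrow> hd' b \<in> V \<and> tl' b \<in> V \<and> e (hd' b) \<otimes>\<^bsub>M\<^esub> b = b \<and> b \<otimes>\<^bsub>M\<^esub> e (tl' b) = b"
    using ends by metis
  obtain \<beta> where "bij_betw \<beta> {0..<card B} B" using ex_bij_betw_nat_finite[OF finB] by blast
  then have \<beta>: "inj_on \<beta> {0..<card B}" "\<beta> ` {0..<card B} = B" unfolding bij_betw_def by auto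
  then have \<beta>B: "\<beta> a \<in> B" if "a \<in> {0..<card B}" for a using that by blast
  have "arrow_algebra R M P J V e {0..<card B} \<beta> (hd' \<circ> \<beta>) (tl' \<circ> \<beta>)"
  proof (intro arrow_algebra.intro split_algebra_axioms arrow_algebra_axioms.intro)
    fix N assume N: "submodule N R M" "\<And>a. a \<in> {0..<card B} \<Longrightarrow> \<beta> a \<in> N"
      "\<And>x y. x \<in> J \<Longrightarrow> y \<in> J \<Longrightarrow> x \<otimes>\<^bsub>M\<^esub> y \<in> N"
    have "B \<subseteq> N"
    proof
      fix b assume "b \<in> B"
      then have "b \<in> \<beta> ` {0..<card B}" by (simp only: \<beta>(2))
      then show "b \<in> N" using N(2) by auto
    qed
    then show "J \<subseteq> N" using B(2) N(1,3) unfolding gen_def by blast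
  next
    fix a assume a: "a \<in> {0..<card B}"
    have "\<not> gen (B - {\<beta> a})"
    proof
      assume "gen (B - {\<beta> a})"
      then have "B = B - {\<beta> a}" using min[of "B - {\<beta> a}"] B(1) by blast
      then show False using \<beta>B[OF a] by blast
    qed
    then obtain N where N: "submodule N R M" "B - {\<beta> a} \<subseteq> N" "\<forall>x\<in>J. \<forall>y\<in>J. x \<otimes>\<^bsub>M\<^esub> y \<in> N" "\<not> J \<subseteq> N"
      unfolding gen_def by blast
    have "\<beta> b \<in> N" if b: "b \<in> {0..<card B} - {a}" for b
    proof -
      have "\<beta> b \<in> B" using b \<beta>B by simp
      \<comment> \<open>Injectivity of the numbering matters: if two indices named the same element,
        deleting one of them would not shrink the generating set.\<close>
      moreover have "\<beta> b \<noteq> \<beta> a" using b a inj_onD[OF \<beta>(1), of b a] by auto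
      ultimately show ?thesis using N(2) by blast
    qed
    then show "\<exists>N. submodule N R M \<and> (\<forall>b\<in>{0..<card B} - {a}. \<beta> b \<in> N) \<and>
      (\<forall>x\<in>J. \<forall>y\<in>J. x \<otimes>\<^bsub>M\<^esub> y \<in> N) \<and> \<not> J \<subseteq> N" using N by blast
  qed (use BJ ht \<beta>B in auto)
  then show ?thesis by blast
qed

end

section \<open>Idempotents modulo an ideal J with 1 - x a unit for all x in J\<close>

section \<open>Lifting orthogonal idempotents\<close>

lemma zero_Quot: "\<zero>\<^bsub>A Quot I\<^esub> = I"
  by (simp add: FactRing_def)

text \<open>The element u = 1 - g f is a unit congruent to 1, and g u f = g f - g g f = 0. Hence the
  conjugate d of \<open>g\<close> by u is an idempotent congruent to \<open>g\<close> with d f = 0.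
  Subtracting f d kills the product with \<open>f\<close> on the other side as well, and d f = 0
  keeps the result idempotent.\<close>

lemma (in ring) lift_orthogonal_idempotent:
  assumes J: "ideal J R" and quasi: "\<And>x. x \<in> J \<Longrightarrow> \<one> \<ominus> x \<in> Units R"
    and f: "f \<in> carrier R" "f \<otimes> f = f" and g: "g \<in> carrier R" "g \<otimes> g = g" and gf: "g \<otimes> f \<in> J"
  shows "\<exists>e\<in>carrier R. e \<otimes> e = e \<and> e \<otimes> f = \<zero> \<and> f \<otimes> e = \<zero> \<and> J +> e = J +> (g \<ominus> f \<otimes> g)"
proof -
  interpret J: ideal J R by fact
  interpret \<pi>: ring_hom_ring R "R Quot J" "(+>) J" by (rule J.rcos_ring_hom_ring)
  define u where "u = \<one> \<ominus> g \<otimes> f"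
  obtain w where w: "w \<in> carrier R" "w \<otimes> u = \<one>" "u \<otimes> w = \<one>" using quasi[OF gf] unfolding Units_def u_def by blast
  have u: "u \<in> carrier R" unfolding u_def using f g by simp
  define d where "d = w \<otimes> g \<otimes> u"
  have dc: "d \<in> carrier R" unfolding d_def using w u g by simp
  have "u \<otimes> f = f \<ominus> g \<otimes> (f \<otimes> f)" using f(1) g by (simp add: u_def a_minus_def l_distr l_minus m_assoc)
  then have uf: "u \<otimes> f = f \<ominus> g \<otimes> f" using f by simp
  have "g \<otimes> (f \<ominus> g \<otimes> f) = g \<otimes> f \<ominus> (g \<otimes> g) \<otimes> f" using f(1) g(1) by (simp add: a_minus_def r_distr r_minus m_assoc)
  also have "\<dots> = \<zero>" using f g by (simp add: r_right_minus_eq)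
  finally have "g \<otimes> (u \<otimes> f) = \<zero>" using uf by simp
  then have df: "d \<otimes> f = \<zero>" unfolding d_def using w(1) u g(1) f(1) by (simp add: m_assoc)
  have "d \<otimes> d = w \<otimes> (g \<otimes> ((u \<otimes> w) \<otimes> (g \<otimes> u)))" unfolding d_def using w(1) u g(1) by (simp add: m_assoc)
  also have "\<dots> = w \<otimes> ((g \<otimes> g) \<otimes> u)" using w u g(1) by (simp add: m_assoc)
  finally have dd: "d \<otimes> d = d" unfolding d_def using w(1) u g by (simp add: m_assoc)
  have "u \<ominus> \<one> = \<ominus> (g \<otimes> f)" using f g by (simp add: u_def a_minus_def a_ac r_neg1 r_neg2)
  then have "u \<ominus> \<one> \<in> J" using gf J.a_inv_closed by simp
  then have "J +> u = J +> \<one>" using quotient_eq_iff_same_a_r_cos[OF J u one_closed] by simp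
  then have \<pi>u: "J +> u = \<one>\<^bsub>R Quot J\<^esub>" by simp
  have "(J +> w) \<otimes>\<^bsub>R Quot J\<^esub> (J +> u) = \<one>\<^bsub>R Quot J\<^esub>" using \<pi>.hom_mult[OF w(1) u] w(2) by simp
  then have \<pi>w: "J +> w = \<one>\<^bsub>R Quot J\<^esub>" unfolding \<pi>u using w(1) by simp
  have \<pi>d: "J +> d = J +> g" unfolding d_def using w(1) u g \<pi>u \<pi>w by simp
  have "d \<ominus> f \<otimes> d \<in> carrier R" using dc f by simp
  moreover have "(d \<ominus> f \<otimes> d) \<otimes> f = \<zero>"
    using dc f(1) df by (simp add: a_minus_def l_distr l_minus m_assoc)
  moreover have "f \<otimes> (d \<ominus> f \<otimes> d) = f \<otimes> d \<ominus> (f \<otimes> f) \<otimes> d"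
    using dc f(1) by (simp add: a_minus_def r_distr r_minus m_assoc)
  then have "f \<otimes> (d \<ominus> f \<otimes> d) = \<zero>" using dc f by (simp add: r_right_minus_eq)
  moreover have "(d \<ominus> f \<otimes> d) \<otimes> (d \<ominus> f \<otimes> d) = (d \<ominus> f \<otimes> d) \<otimes> d \<ominus> ((d \<ominus> f \<otimes> d) \<otimes> f) \<otimes> d"
    using dc f(1) by (simp add: a_minus_def r_distr r_minus m_assoc)
  then have "(d \<ominus> f \<otimes> d) \<otimes> (d \<ominus> f \<otimes> d) = d \<otimes> d \<ominus> f \<otimes> (d \<otimes> d)"
    unfolding calculation(2) using dc f(1) by (simp add: a_minus_def l_distr l_minus m_assoc)
  then have "(d \<ominus> f \<otimes> d) \<otimes> (d \<ominus> f \<otimes> d) = d \<ominus> f \<otimes> d" unfolding dd .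
  moreover have "J +> (d \<ominus> f \<otimes> d) = J +> (g \<ominus> f \<otimes> g)"
    using dc f(1) g(1) by (simp add: a_minus_def \<pi>d)
  ultimately show ?thesis by blast
qed

text \<open>The induction carries the sum \<open>f\<close> of the idempotents lifted so far, so that
  each new one has to be made orthogonal to \<open>f\<close> alone. By the last clause the class of
  \<open>f\<close> annihilates the \<open>\<epsilon> j\<close> still to come; so g f is in
  \<open>J\<close> for a lift g of the next one, and \<open>lift_orthogonal_idempotent\<close>
  applies.\<close>

lemma (in ring) lift_orthogonal_family:
  fixes n N :: nat
  assumes J: "ideal J R" and quasi: "\<And>x. x \<in> J \<Longrightarrow> \<one> \<ominus> x \<in> Units R"
    and lift: "\<And>x. x \<in> carrier (R Quot J) \<Longrightarrow> x \<otimes>\<^bsub>R Quot J\<^esub> x = x \<Longrightarrow> \<exists>f\<in>carrier R. f \<otimes> f = f \<and> J +> f = x"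
    and \<epsilon>: "\<And>i. i < N \<Longrightarrow> \<epsilon> i \<in> carrier (R Quot J)"
    and \<epsilon>_mult: "\<And>i j. i < N \<Longrightarrow> j < N \<Longrightarrow>
      \<epsilon> i \<otimes>\<^bsub>R Quot J\<^esub> \<epsilon> j = (if i = j then \<epsilon> i else \<zero>\<^bsub>R Quot J\<^esub>)"
    and "n \<le> N"
  shows "\<exists>e f. (\<forall>i<n. e i \<in> carrier R \<and> J +> e i = \<epsilon> i) \<and>
    (\<forall>i<n. \<forall>j<n. e i \<otimes> e j = (if i = j then e i else \<zero>)) \<and>
    f \<in> carrier R \<and> f \<otimes> f = f \<and> f = (\<Oplus>i\<in>{..<n}. e i) \<and> (\<forall>i<n. f \<otimes> e i = e i \<and> e i \<otimes> f = e i) \<and>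
    (\<forall>j. n \<le> j \<longrightarrow> j < N \<longrightarrow> (J +> f) \<otimes>\<^bsub>R Quot J\<^esub> \<epsilon> j = \<zero>\<^bsub>R Quot J\<^esub> \<and> \<epsilon> j \<otimes>\<^bsub>R Quot J\<^esub> (J +> f) = \<zero>\<^bsub>R Quot J\<^esub>)"
  using \<open>n \<le> N\<close>
proof (induction n)
  interpret J: ideal J R by fact
  interpret \<pi>: ring_hom_ring R "R Quot J" "(+>) J" by (rule J.rcos_ring_hom_ring)
  {
    case 0
    then show ?case using \<epsilon> \<pi>.hom_zero by (intro exI[of _ "\<lambda>_. \<zero>"] exI[of _ \<zero>]) simp
  next
    case (Suc n)
    then have n: "n < N" by simp
    from Suc.IH[OF less_imp_le[OF n]] obtain e f where IH: "\<forall>i<n. e i \<in> carrier R \<and> J +> e i = \<epsilon> i"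
      "\<forall>i<n. \<forall>j<n. e i \<otimes> e j = (if i = j then e i else \<zero>)" "\<forall>i<n. f \<otimes> e i = e i \<and> e i \<otimes> f = e i"
      "\<forall>j. n \<le> j \<longrightarrow> j < N \<longrightarrow>
        (J +> f) \<otimes>\<^bsub>R Quot J\<^esub> \<epsilon> j = \<zero>\<^bsub>R Quot J\<^esub> \<and> \<epsilon> j \<otimes>\<^bsub>R Quot J\<^esub> (J +> f) = \<zero>\<^bsub>R Quot J\<^esub>"
      and f: "f \<in> carrier R" "f \<otimes> f = f" "f = (\<Oplus>i\<in>{..<n}. e i)"
      by (elim exE conjE) (rule that)
    have e: "e i \<in> carrier R" "J +> e i = \<epsilon> i" "f \<otimes> e i = e i" "e i \<otimes> f = e i" if "i < n" for i
      using IH(1,3) that by blast+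
    have ee: "e i \<otimes> e j = (if i = j then e i else \<zero>)" if "i < n" "j < n" for i j
      using IH(2) that by blast
    have f\<epsilon>: "(J +> f) \<otimes>\<^bsub>R Quot J\<^esub> \<epsilon> j = \<zero>\<^bsub>R Quot J\<^esub>" "\<epsilon> j \<otimes>\<^bsub>R Quot J\<^esub> (J +> f) = \<zero>\<^bsub>R Quot J\<^esub>"
      if "n \<le> j" "j < N" for j
      using IH(4) that by blast+
    obtain g where g: "g \<in> carrier R" "g \<otimes> g = g" "J +> g = \<epsilon> n"
      using lift[OF \<epsilon>[OF n]] \<epsilon>_mult[OF n n] by auto
    have "J +> (g \<otimes> f) = \<epsilon> n \<otimes>\<^bsub>R Quot J\<^esub> (J +> f)" using \<pi>.hom_mult[OF g(1) f(1)] g(3) by simp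
    also have "\<dots> = J" unfolding f\<epsilon>(2)[OF order_refl n] by (rule zero_Quot)
    finally have "J +> (g \<otimes> f) = J" .
    then have "g \<otimes> f \<in> J" by (rule J.rcos_const_imp_mem[OF m_closed[OF g(1) f(1)]])
    then obtain d where d: "d \<in> carrier R" "d \<otimes> d = d" "d \<otimes> f = \<zero>" "f \<otimes> d = \<zero>" "J +> d = J +> (g \<ominus> f \<otimes> g)"
      using lift_orthogonal_idempotent[OF J quasi f(1,2) g(1,2)] by blast
    \<comment> \<open>The class of \<open>f\<close> annihilates \<open>\<epsilon> n\<close>, so the
      correction f g vanishes modulo \<open>J\<close> and \<open>d\<close> still lifts
      \<open>\<epsilon> n\<close>.\<close>
    have \<pi>d: "J +> d = \<epsilon> n"
      using d(5) f(1) g(1) f\<epsilon>(1)[OF order_refl n] \<epsilon>[OF n] by (simp add: a_minus_def g(3))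
    \<comment> \<open>Orthogonality to the sum \<open>f\<close> passes to each \<open>e i\<close>,
      because \<open>f\<close> fixes \<open>e i\<close> on both sides.\<close>
    have de: "d \<otimes> e i = \<zero>" "e i \<otimes> d = \<zero>" if i: "i < n" for i
    proof -
      have "d \<otimes> e i = (d \<otimes> f) \<otimes> e i" using e(3)[OF i] d(1) f(1) e(1)[OF i] by (simp add: m_assoc)
      then show "d \<otimes> e i = \<zero>" using d(3) e(1)[OF i] by simp
      have "e i \<otimes> d = e i \<otimes> (f \<otimes> d)" using e(4)[OF i] d(1) f(1) e(1)[OF i] by (simp flip: m_assoc)
      then show "e i \<otimes> d = \<zero>" using d(4) e(1)[OF i] by simp
    qed
    let ?e = "e(n := d)"
    have sum: "f \<oplus> d = (\<Oplus>i\<in>{..<Suc n}. ?e i)"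
    proof -
      have ec: "?e \<in> {..<n} \<rightarrow> carrier R" using e(1) by auto
      have "(\<Oplus>i\<in>{..<Suc n}. ?e i) = ?e n \<oplus> (\<Oplus>i\<in>{..<n}. ?e i)"
        unfolding lessThan_Suc by (rule finsum_insert) (use ec d in auto)
      also have "(\<Oplus>i\<in>{..<n}. ?e i) = f"
        unfolding f(3) by (rule finsum_cong') (use e(1) in auto)
      finally show ?thesis using d(1) f(1) by (simp add: a_comm)
    qed
    show ?case
    proof (intro exI[of _ ?e] exI[of _ "f \<oplus> d"] conjI allI impI)
      fix i assume i: "i < Suc n"
      show "?e i \<in> carrier R" "J +> ?e i = \<epsilon> i" using i e(1,2) d(1) \<pi>d by (auto simp: less_Suc_eq)
      show "(f \<oplus> d) \<otimes> ?e i = ?e i" "?e i \<otimes> (f \<oplus> d) = ?e i"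
        using i e(1,3,4) d f(1) de by (auto simp: less_Suc_eq l_distr r_distr)
      fix j assume "j < Suc n"
      then show "?e i \<otimes> ?e j = (if i = j then ?e i else \<zero>)"
        using i ee d(2) de by (auto simp: less_Suc_eq)
    next
      show "f \<oplus> d \<in> carrier R" "(f \<oplus> d) \<otimes> (f \<oplus> d) = f \<oplus> d" using f(1,2) d by (simp_all add: l_distr r_distr)
      show "f \<oplus> d = (\<Oplus>i\<in>{..<Suc n}. ?e i)" by (rule sum)
    next
      fix j assume j: "Suc n \<le> j" "j < N"
      have "(J +> (f \<oplus> d)) = (J +> f) \<oplus>\<^bsub>R Quot J\<^esub> \<epsilon> n" using f(1) d(1) \<pi>d by simp
      then show "(J +> (f \<oplus> d)) \<otimes>\<^bsub>R Quot J\<^esub> \<epsilon> j = \<zero>\<^bsub>R Quot J\<^esub>" "\<epsilon> j \<otimes>\<^bsub>R Quot J\<^esub> (J +> (f \<oplus> d)) = \<zero>\<^bsub>R Quot J\<^esub>"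
        using f\<epsilon>[of j] j \<epsilon>_mult[OF n j(2)] \<epsilon>_mult[OF j(2) n] \<epsilon>[OF n] \<epsilon>[OF j(2)] \<pi>.hom_closed[OF f(1)]
        by (simp_all add: \<pi>.S.l_distr \<pi>.S.r_distr)
    qed
  }
qed

section \<open>Coordinate idempotents and finiteness of the index set\<close>

section \<open>Coordinates on a product ring\<close>

locale product_coordinates = B: ring B + K: ring K
  for B :: "('b, 'm) ring_scheme" and K :: "('k, 'n) ring_scheme" +
  fixes T :: "'i set" and h :: "'b \<Rightarrow> 'i \<Rightarrow> 'k"
  assumes nontrivial: "\<one>\<^bsub>K\<^esub> \<noteq> \<zero>\<^bsub>K\<^esub>" and iso: "h \<in> ring_iso B (product_ring T (\<lambda>_. K))"
begin

lemma h_simps: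
  assumes "x \<in> carrier B" "t \<in> T"
  shows "h x t \<in> carrier K"
    "y \<in> carrier B \<Longrightarrow> h (x \<otimes>\<^bsub>B\<^esub> y) t = h x t \<otimes>\<^bsub>K\<^esub> h y t"
    "y \<in> carrier B \<Longrightarrow> h (x \<oplus>\<^bsub>B\<^esub> y) t = h x t \<oplus>\<^bsub>K\<^esub> h y t"
  using iso assms unfolding ring_iso_def ring_hom_def product_ring_def by (auto simp: Pi_iff PiE_iff)

lemma h_one: "t \<in> T \<Longrightarrow> h \<one>\<^bsub>B\<^esub> t = \<one>\<^bsub>K\<^esub>"
  using iso unfolding ring_iso_def ring_hom_def product_ring_def by auto

lemma h_zero: "t \<in> T \<Longrightarrow> h \<zero>\<^bsub>B\<^esub> t = \<zero>\<^bsub>K\<^esub>"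
  using h_simps(3)[of "\<zero>\<^bsub>B\<^esub>" t "\<zero>\<^bsub>B\<^esub>"] h_simps(1)[of "\<zero>\<^bsub>B\<^esub>" t] by (simp add: K.add.l_cancel_one')

lemma h_eqI:
  assumes "x \<in> carrier B" "y \<in> carrier B" "\<And>t. t \<in> T \<Longrightarrow> h x t = h y t"
  shows "x = y"
proof -
  have c: "h x \<in> (\<Pi>\<^sub>E t\<in>T. carrier K)" "h y \<in> (\<Pi>\<^sub>E t\<in>T. carrier K)"
    using iso assms unfolding ring_iso_def ring_hom_def product_ring_def by auto
  have "h x = h y" by (rule PiE_ext[OF c assms(3)])
  moreover have "inj_on h (carrier B)" using iso unfolding ring_iso_def bij_betw_def by auto
  ultimately show ?thesis using assms by (auto dest: inj_onD)
qed

lemma exists_unit_vector: "\<exists>x\<in>carrier B. \<forall>t\<in>T. h x t = (if t = s then \<one>\<^bsub>K\<^esub> else \<zero>\<^bsub>K\<^esub>)"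
proof -
  have "(\<lambda>t\<in>T. if t = s then \<one>\<^bsub>K\<^esub> else \<zero>\<^bsub>K\<^esub>) \<in> carrier (product_ring T (\<lambda>_. K))"
    unfolding product_ring_def by auto
  then have "(\<lambda>t\<in>T. if t = s then \<one>\<^bsub>K\<^esub> else \<zero>\<^bsub>K\<^esub>) \<in> h ` carrier B"
    using iso unfolding ring_iso_def bij_betw_def by auto
  then obtain x where "x \<in> carrier B" "(\<lambda>t\<in>T. if t = s then \<one>\<^bsub>K\<^esub> else \<zero>\<^bsub>K\<^esub>) = h x" by blast
  then show ?thesis by (intro bexI[of _ x]) (auto simp flip: \<open>_ = h x\<close>)
qed

text \<open>For \<open>s\<close> outside \<open>T\<close> all coordinates vanish and this is zero,
  so \<open>unit_vector_mult\<close> holds for arbitrary indices.\<close>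

definition unit_vector :: "'i \<Rightarrow> 'b" where
  "unit_vector s = (SOME x. x \<in> carrier B \<and> (\<forall>t\<in>T. h x t = (if t = s then \<one>\<^bsub>K\<^esub> else \<zero>\<^bsub>K\<^esub>)))"

lemma unit_vector:
  "unit_vector s \<in> carrier B" "t \<in> T \<Longrightarrow> h (unit_vector s) t = (if t = s then \<one>\<^bsub>K\<^esub> else \<zero>\<^bsub>K\<^esub>)"
proof -
  have "\<exists>x. x \<in> carrier B \<and> (\<forall>t\<in>T. h x t = (if t = s then \<one>\<^bsub>K\<^esub> else \<zero>\<^bsub>K\<^esub>))"
    using exists_unit_vector by blast
  from someI_ex[OF this] show "unit_vector s \<in> carrier B"
    "t \<in> T \<Longrightarrow> h (unit_vector s) t = (if t = s then \<one>\<^bsub>K\<^esub> else \<zero>\<^bsub>K\<^esub>)"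
    unfolding unit_vector_def by auto
qed

lemma unit_vector_mult:
  "unit_vector s \<otimes>\<^bsub>B\<^esub> unit_vector t = (if s = t then unit_vector s else \<zero>\<^bsub>B\<^esub>)"
proof (rule h_eqI)
  show "h (unit_vector s \<otimes>\<^bsub>B\<^esub> unit_vector t) u = h (if s = t then unit_vector s else \<zero>\<^bsub>B\<^esub>) u" if "u \<in> T" for u
    using that by (simp add: h_simps unit_vector h_zero)
qed (simp_all add: unit_vector)

text \<open>Given infinitely many coordinates, the left ideals of elements vanishing on the first n
  terms of an injective sequence of indices descend strictly: the unit vector at the n-th index
  leaves at the next stage. Finiteness of the vertex set comes from here.\<close>

lemma finite_index:
  assumes "artinian_ring B"
  shows "finite T"
proof (rule ccontr)
  assume "infinite T"
  then obtain \<tau> :: "nat \<Rightarrow> 'i" where \<tau>: "inj \<tau>" "range \<tau> \<subseteq> T" using infinite_countable_subset by blast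
  have \<tau>T: "\<tau> i \<in> T" for i using \<tau>(2) by auto
  define L where "L n = {x \<in> carrier B. \<forall>i<n. h x (\<tau> i) = \<zero>\<^bsub>K\<^esub>}" for n :: nat
  have "left_ideal B (L n)" for n
    unfolding B.left_ideal_iff left_stable_def L_def by (auto simp: h_zero h_simps \<tau>T)
  moreover have "L (Suc n) \<subseteq> L n" for n unfolding L_def by auto
  ultimately obtain n where n: "\<And>m. m \<ge> n \<Longrightarrow> L m = L n" using assms unfolding artinian_ring_def by blast
  have "unit_vector (\<tau> n) \<in> L n" unfolding L_def
    using unit_vector \<tau>T by (auto simp: inj_eq[OF \<tau>(1)])
  then have "unit_vector (\<tau> n) \<in> L (Suc n)" using n[of "Suc n"] by simp
  then show False unfolding L_def using unit_vector(2)[OF \<tau>T] nontrivial by auto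
qed

end

section \<open>From an elementary algebra to lifted idempotents, and the final assembly\<close>

section \<open>Splitting an elementary algebra\<close>

text \<open>A nonunit generates a proper ideal, which lies in a maximal left ideal; by commutativity
  that is a maximal ideal, hence equal to \<open>P\<close>.\<close>

lemma (in cring) local_ring_Units:
  assumes "local_ring R P" "r \<in> carrier R" "r \<notin> P"
  shows "r \<in> Units R"
proof (rule ccontr)
  assume r: "r \<notin> Units R"
  note L = left_stable_principal_left[OF assms(2)]
  have "\<one> \<notin> principal_left R r"
  proof
    assume "\<one> \<in> principal_left R r"
    then obtain s where "s \<in> carrier R" "\<one> = s \<otimes> r" unfolding principal_left_def by auto
    then have "r \<in> Units R" unfolding Units_def using assms(2) by (auto intro!: bexI[of _ s] simp: m_comm)
    then show False using r by simp
  qed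
  then obtain N where N: "maximal_submodule (left_ideal R) (carrier R) N" "principal_left R r \<subseteq> N"
    using exists_maximal_left_ideal[OF L(1)] by blast
  have Ns: "left_stable R (carrier R) N" "left_ideal R N" "N \<subset> carrier R"
    and max: "\<And>L. left_ideal R L \<Longrightarrow> N \<subseteq> L \<Longrightarrow> L \<subseteq> carrier R \<Longrightarrow> L = N \<or> L = carrier R"
    using N(1) unfolding maximal_submodule_def left_ideal_iff by auto
  have ideal_left: "left_ideal R L" if "ideal L R" for L
    using that unfolding left_ideal_def by (simp add: ideal.axioms(1) ideal.I_l_closed)
  have "maximalideal N R"
  proof (rule maximalidealI)
    show "ideal N R"
    proof (rule idealI[OF ring_axioms])
      show "subgroup N (add_monoid R)" using Ns(2) unfolding left_ideal_def additive_subgroup_def by simp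
      show "x \<otimes> a \<in> N" if "a \<in> N" "x \<in> carrier R" for a x using Ns(1) that unfolding left_stable_def by auto
      then show "a \<otimes> x \<in> N" if "a \<in> N" "x \<in> carrier R" for a x
        using that Ns(3) by (metis m_comm psubset_imp_subset subsetD)
    qed
    show "carrier R \<noteq> N" using Ns by auto
    show "J = N \<or> J = carrier R" if "ideal J R" "N \<subseteq> J" "J \<subseteq> carrier R" for J
      using max ideal_left that by blast
  qed
  then have "N = P" using assms(1) unfolding local_ring_def by auto
  then show False using N L assms(3) by auto
qed

lemma ring_iso_product_algebra_iff:
  "h \<in> ring_iso (quot_algebra A I) (product_algebra T (\<lambda>_. residue_algebra R P)) \<longleftrightarrow>
    h \<in> ring_iso (A Quot I) (product_ring T (\<lambda>_. R Quot P))"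
  by (simp add: ring_iso_quot_algebra_iff)
    (simp add: ring_iso_def ring_hom_def product_algebra_def product_ring_def residue_algebra_def ring.defs)

lemma smult_product_algebra:
  "t \<in> T \<Longrightarrow> (r \<odot>\<^bsub>product_algebra T (\<lambda>_. residue_algebra R P)\<^esub> f) t = (P +>\<^bsub>R\<^esub> r) \<otimes>\<^bsub>R Quot P\<^esub> f t"
  by (simp add: product_algebra_def residue_algebra_def ring.defs module.defs)

lemma carrier_Quot: "carrier (A Quot I) = (\<lambda>x. I +>\<^bsub>A\<^esub> x) ` carrier A"
  by (auto simp: FactRing_def A_RCOSETS_def')

text \<open>By \<open>h_smult'\<close> the ring \<open>R\<close> acts on each coordinate of the
  quotient by \<open>J\<close> through the residue map. Consequently the maximal ideal carries the
  algebra into \<open>J\<close>, and every coordinate of a class is realised by a scalar of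
  \<open>R\<close>.\<close>

theorem (in assoc_algebra) exists_split_algebra:
  assumes R: "noetherian_ring R" "local_ring R P"
    and M: "semiperfect M" "module_finite R M" "elementary R P M"
  shows "\<exists>n (e :: nat \<Rightarrow> 'c). split_algebra R M P (jacobson_radical M) {..<n} e"
proof -
  define J where "J = jacobson_radical M"
  have J: "ideal J M" unfolding J_def by (rule ideal_jacobson_radical)
  interpret J: ideal J M by (rule J)
  interpret \<pi>: ring_hom_ring M "M Quot J" "(+>\<^bsub>M\<^esub>) J" by (rule J.rcos_ring_hom_ring)
  have quasi: "\<one>\<^bsub>M\<^esub> \<ominus>\<^bsub>M\<^esub> x \<in> Units M" if "x \<in> J" for x
    using jacobson_radical_quasi_regular that unfolding J_def by blast
  have P: "maximalideal P R" using R(2) unfolding local_ring_def by auto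
  interpret P: maximalideal P R by (rule P)
  let ?K = "R Quot P"
  have K: "ring ?K" by (rule P.quotient_is_ring)
  have art: "artinian_ring (M Quot J)"
    and lift: "\<And>x. x \<in> carrier (M Quot J) \<Longrightarrow> x \<otimes>\<^bsub>M Quot J\<^esub> x = x \<Longrightarrow>
      \<exists>f\<in>carrier M. f \<otimes>\<^bsub>M\<^esub> f = f \<and> J +>\<^bsub>M\<^esub> f = x"
    using M(1) unfolding semiperfect_def Let_def J_def by auto
  obtain T :: "'c set set" and h where
    h_iso: "h \<in> ring_iso (quot_algebra M J) (product_algebra T (\<lambda>_. residue_algebra R P))"
    and h_smult: "\<And>r C. r \<in> carrier R \<Longrightarrow> C \<in> carrier (quot_algebra M J) \<Longrightarrow>
      h (r \<odot>\<^bsub>quot_algebra M J\<^esub> C) = r \<odot>\<^bsub>product_algebra T (\<lambda>_. residue_algebra R P)\<^esub> h C"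
    using M(3) unfolding elementary_def algebra_isomorphic_def J_def by blast
  have "\<one>\<^bsub>?K\<^esub> \<noteq> \<zero>\<^bsub>?K\<^esub>"
  proof
    assume "\<one>\<^bsub>?K\<^esub> = \<zero>\<^bsub>?K\<^esub>"
    then have "P +> \<one> = P" by (simp add: FactRing_def)
    then have "\<one> \<in> P" by (rule P.rcos_const_imp_mem[OF R.one_closed])
    then show False using P.one_imp_carrier P.I_notcarr by simp
  qed
  then interpret C: product_coordinates "M Quot J" ?K T h
    using h_iso unfolding ring_iso_product_algebra_iff
    by (intro product_coordinates.intro product_coordinates_axioms.intro J.quotient_is_ring K)
  have h_smult': "h (J +>\<^bsub>M\<^esub> (r \<odot>\<^bsub>M\<^esub> x)) t = (P +> r) \<otimes>\<^bsub>?K\<^esub> h (J +>\<^bsub>M\<^esub> x) t"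
    if "r \<in> carrier R" "x \<in> carrier M" "t \<in> T" for r x t
    using h_smult[of r "J +>\<^bsub>M\<^esub> x"] that
    by (simp add: smult_quot_algebra[OF J] smult_product_algebra quot_algebra_simps(1) \<pi>.hom_closed)
  have finT: "finite T" by (rule C.finite_index[OF art])
  define n where "n = card T"
  obtain \<tau> where "bij_betw \<tau> {0..<n} T" unfolding n_def using ex_bij_betw_nat_finite[OF finT] by blast
  then have \<tau>_inj: "\<And>i j. i < n \<Longrightarrow> j < n \<Longrightarrow> \<tau> i = \<tau> j \<longleftrightarrow> i = j" and \<tau>_image: "\<tau> ` {0..<n} = T"
    unfolding bij_betw_def inj_on_def by auto
  then have \<tau>T: "\<tau> i \<in> T" if "i < n" for i using that by auto
  define \<epsilon> where "\<epsilon> i = C.unit_vector (\<tau> i)" for i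
  have \<epsilon>: "\<epsilon> i \<in> carrier (M Quot J)" for i unfolding \<epsilon>_def by (rule C.unit_vector(1))
  have \<epsilon>_mult: "\<epsilon> i \<otimes>\<^bsub>M Quot J\<^esub> \<epsilon> j = (if i = j then \<epsilon> i else \<zero>\<^bsub>M Quot J\<^esub>)" if "i < n" "j < n" for i j
    unfolding \<epsilon>_def C.unit_vector_mult using \<tau>_inj that by simp
  have "\<exists>e f. (\<forall>i<n. e i \<in> carrier M \<and> J +>\<^bsub>M\<^esub> e i = \<epsilon> i) \<and>
    (\<forall>i<n. \<forall>j<n. e i \<otimes>\<^bsub>M\<^esub> e j = (if i = j then e i else \<zero>\<^bsub>M\<^esub>)) \<and>
    f \<in> carrier M \<and> f \<otimes>\<^bsub>M\<^esub> f = f \<and> f = (\<Oplus>\<^bsub>M\<^esub>i\<in>{..<n}. e i) \<and>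
    (\<forall>i<n. f \<otimes>\<^bsub>M\<^esub> e i = e i \<and> e i \<otimes>\<^bsub>M\<^esub> f = e i) \<and>
    (\<forall>j. n \<le> j \<longrightarrow> j < n \<longrightarrow> (J +>\<^bsub>M\<^esub> f) \<otimes>\<^bsub>M Quot J\<^esub> \<epsilon> j = \<zero>\<^bsub>M Quot J\<^esub> \<and>
      \<epsilon> j \<otimes>\<^bsub>M Quot J\<^esub> (J +>\<^bsub>M\<^esub> f) = \<zero>\<^bsub>M Quot J\<^esub>)"
    by (rule lift_orthogonal_family[OF J quasi lift \<epsilon> \<epsilon>_mult order_refl])
  then obtain e f where ef: "\<forall>i<n. e i \<in> carrier M \<and> J +>\<^bsub>M\<^esub> e i = \<epsilon> i"
    "\<forall>i<n. \<forall>j<n. e i \<otimes>\<^bsub>M\<^esub> e j = (if i = j then e i else \<zero>\<^bsub>M\<^esub>)"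
    "\<forall>i<n. f \<otimes>\<^bsub>M\<^esub> e i = e i \<and> e i \<otimes>\<^bsub>M\<^esub> f = e i"
    and f: "f \<in> carrier M" "f \<otimes>\<^bsub>M\<^esub> f = f" "f = (\<Oplus>\<^bsub>M\<^esub>i\<in>{..<n}. e i)"
    by (elim exE conjE) (rule that)
  have e: "e i \<in> carrier M" "J +>\<^bsub>M\<^esub> e i = \<epsilon> i" "e i \<otimes>\<^bsub>M\<^esub> f = e i" if "i < n" for i
    using ef(1,3) that by blast+
  have \<pi>c: "J +>\<^bsub>M\<^esub> x \<in> carrier (M Quot J)" if "x \<in> carrier M" for x using \<pi>.hom_closed[OF that] .
  have h\<epsilon>: "h (\<epsilon> i) t = (if t = \<tau> i then \<one>\<^bsub>?K\<^esub> else \<zero>\<^bsub>?K\<^esub>)" if "t \<in> T" for i t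
    unfolding \<epsilon>_def by (rule C.unit_vector(2)[OF that])
  have "J +>\<^bsub>M\<^esub> f = \<one>\<^bsub>M Quot J\<^esub>"
  proof (rule C.h_eqI[OF \<pi>c[OF f(1)] \<pi>.S.one_closed])
    fix t assume t: "t \<in> T"
    then obtain i where i: "i < n" "t = \<tau> i" using \<tau>_image by auto
    have "\<epsilon> i \<otimes>\<^bsub>M Quot J\<^esub> (J +>\<^bsub>M\<^esub> f) = \<epsilon> i"
      using \<pi>.hom_mult[OF e(1)[OF i(1)] f(1)] e(2,3)[OF i(1)] by simp
    then have "h (\<epsilon> i) t \<otimes>\<^bsub>?K\<^esub> h (J +>\<^bsub>M\<^esub> f) t = h (\<epsilon> i) t"
      using C.h_simps(2)[OF \<epsilon> t \<pi>c[OF f(1)]] by metis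
    then show "h (J +>\<^bsub>M\<^esub> f) t = h \<one>\<^bsub>M Quot J\<^esub> t"
      using h\<epsilon>[OF t] i C.h_simps(1)[OF \<pi>c[OF f(1)] t] C.h_one[OF t] by simp
  qed
  \<comment> \<open>An idempotent congruent to 1 modulo \<open>J\<close> is 1: it equals 1 - (1 - f)
    with 1 - f in \<open>J\<close>, hence is a unit, and the only idempotent unit is 1.\<close>
  then have "J +>\<^bsub>M\<^esub> \<one>\<^bsub>M\<^esub> = J +>\<^bsub>M\<^esub> f" by simp
  then have "\<one>\<^bsub>M\<^esub> \<ominus>\<^bsub>M\<^esub> f \<in> J" using quotient_eq_iff_same_a_r_cos[OF J one_closed f(1)] by simp
  moreover have "\<one>\<^bsub>M\<^esub> \<ominus>\<^bsub>M\<^esub> (\<one>\<^bsub>M\<^esub> \<ominus>\<^bsub>M\<^esub> f) = f"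
    using f(1) by (simp add: a_minus_def minus_add r_neg2 M.r_neg1 M.r_neg2)
  ultimately have "f \<in> Units M" using quasi by metis
  then obtain g where g: "g \<in> carrier M" "g \<otimes>\<^bsub>M\<^esub> f = \<one>\<^bsub>M\<^esub>" unfolding Units_def by blast
  have "f = (g \<otimes>\<^bsub>M\<^esub> f) \<otimes>\<^bsub>M\<^esub> f" using g f(1) by simp
  also have "\<dots> = g \<otimes>\<^bsub>M\<^esub> (f \<otimes>\<^bsub>M\<^esub> f)" using g(1) f(1) by (simp add: m_assoc)
  also have "\<dots> = \<one>\<^bsub>M\<^esub>" unfolding f(2) by (rule g(2))
  finally have e_sum: "(\<Oplus>\<^bsub>M\<^esub>i\<in>{..<n}. e i) = \<one>\<^bsub>M\<^esub>" unfolding f(3) .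
  have "split_algebra R M P J {..<n} e"
  proof (intro split_algebra.intro split_algebra_axioms.intro assoc_algebra_axioms)
    show "\<exists>S. finite S \<and> S \<subseteq> carrier M \<and> carrier M \<subseteq> rspan S"
    proof -
      obtain S where S: "S \<subseteq> carrier M" "finite S"
        and gen: "\<And>x. x \<in> carrier M \<Longrightarrow> \<exists>c\<in>S \<rightarrow> carrier R. x = (\<Oplus>\<^bsub>M\<^esub>s\<in>S. c s \<odot>\<^bsub>M\<^esub> s)"
        using M(2) unfolding module_finite_def by blast
      note sub = rspan_submodule[OF S(1)]
      have "x \<in> rspan S" if x: "x \<in> carrier M" for x
      proof -
        obtain c where c: "c \<in> S \<rightarrow> carrier R" "x = (\<Oplus>\<^bsub>M\<^esub>s\<in>S. c s \<odot>\<^bsub>M\<^esub> s)" using gen[OF x] by blast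
        have "(\<lambda>s. c s \<odot>\<^bsub>M\<^esub> s) \<in> S \<rightarrow> rspan S"
        proof
          fix s assume s: "s \<in> S"
          show "c s \<odot>\<^bsub>M\<^esub> s \<in> rspan S"
            by (rule submodule_smult[OF sub]) (use s c(1) rspan_incl[of S] in auto)
        qed
        then show ?thesis unfolding c(2) by (rule submodule_finsum[OF sub S(2)])
      qed
      then show ?thesis using S by blast
    qed
    show "r \<in> Units R" if "r \<in> carrier R" "r \<notin> P" for r by (rule R.local_ring_Units[OF R(2) that])
    show "r \<odot>\<^bsub>M\<^esub> x \<in> J" if r: "r \<in> carrier R" "r \<in> P" and x: "x \<in> carrier M" for r x
    proof -
      have "P +> r = \<zero>\<^bsub>?K\<^esub>" using R.a_rcos_zero[OF P.is_ideal r(2)] zero_Quot by metis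
      then have "J +>\<^bsub>M\<^esub> (r \<odot>\<^bsub>M\<^esub> x) = \<zero>\<^bsub>M Quot J\<^esub>"
        using r x by (intro C.h_eqI) (simp_all add: \<pi>c h_smult' C.h_zero C.h_simps(1))
      then have "J +>\<^bsub>M\<^esub> (r \<odot>\<^bsub>M\<^esub> x) = J" unfolding zero_Quot .
      then show ?thesis by (rule J.rcos_const_imp_mem[OF smult_closed[OF r(1) x]])
    qed
    show "e i \<noteq> \<zero>\<^bsub>M\<^esub>" if "i \<in> {..<n}" for i
    proof
      assume "e i = \<zero>\<^bsub>M\<^esub>"
      then have "\<epsilon> i = \<zero>\<^bsub>M Quot J\<^esub>" using e(2)[of i] that \<pi>.hom_zero by simp
      then show False using h\<epsilon>[OF \<tau>T, of i i] C.h_zero[OF \<tau>T, of i] that C.nontrivial by simp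
    qed
    show "carrier M \<subseteq> rspan (J \<union> e ` {..<n})"
    proof
      fix x assume x: "x \<in> carrier M"
      have sc: "J \<union> e ` {..<n} \<subseteq> carrier M" using J.a_subset e(1) by auto
      note sub = rspan_submodule[OF sc]
      have "x \<otimes>\<^bsub>M\<^esub> e i \<in> rspan (J \<union> e ` {..<n})" if i: "i < n" for i
      proof -
        have "h (J +>\<^bsub>M\<^esub> x) (\<tau> i) \<in> carrier ?K" using C.h_simps(1)[OF \<pi>c[OF x] \<tau>T[OF i]] .
        \<comment> \<open>\<open>r\<close> represents the coordinate of \<open>x\<close> at
          \<open>\<tau> i\<close>. Modulo \<open>J\<close>, both x e_i and r e_i have this
          coordinate at \<open>\<tau> i\<close> and zero elsewhere.\<close>
        then obtain r where r: "r \<in> carrier R" "h (J +>\<^bsub>M\<^esub> x) (\<tau> i) = P +> r" unfolding carrier_Quot by blast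
        have rK: "P +> r \<in> carrier ?K" unfolding carrier_Quot using r(1) by blast
        have xe: "x \<otimes>\<^bsub>M\<^esub> e i \<in> carrier M" "r \<odot>\<^bsub>M\<^esub> e i \<in> carrier M" using x e(1)[OF i] r(1) by simp_all
        have "J +>\<^bsub>M\<^esub> (x \<otimes>\<^bsub>M\<^esub> e i) = J +>\<^bsub>M\<^esub> (r \<odot>\<^bsub>M\<^esub> e i)"
        proof (rule C.h_eqI[OF \<pi>c[OF xe(1)] \<pi>c[OF xe(2)]])
          fix t assume t: "t \<in> T"
          have "h (J +>\<^bsub>M\<^esub> (x \<otimes>\<^bsub>M\<^esub> e i)) t = h (J +>\<^bsub>M\<^esub> x) t \<otimes>\<^bsub>?K\<^esub> h (\<epsilon> i) t"
            using \<pi>.hom_mult[OF x e(1)[OF i]] C.h_simps(2)[OF \<pi>c[OF x] t \<epsilon>] e(2)[OF i] by simp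
          also have "\<dots> = (P +> r) \<otimes>\<^bsub>?K\<^esub> h (\<epsilon> i) t"
            using h\<epsilon>[OF t] r(2) rK C.h_simps(1)[OF \<pi>c[OF x] t] by simp
          also have "\<dots> = h (J +>\<^bsub>M\<^esub> (r \<odot>\<^bsub>M\<^esub> e i)) t"
            using h_smult'[OF r(1) e(1)[OF i] t] e(2)[OF i] by simp
          finally show "h (J +>\<^bsub>M\<^esub> (x \<otimes>\<^bsub>M\<^esub> e i)) t = h (J +>\<^bsub>M\<^esub> (r \<odot>\<^bsub>M\<^esub> e i)) t" .
        qed
        then have "x \<otimes>\<^bsub>M\<^esub> e i \<ominus>\<^bsub>M\<^esub> r \<odot>\<^bsub>M\<^esub> e i \<in> J" using quotient_eq_iff_same_a_r_cos[OF J xe] by simp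
        then have 1: "x \<otimes>\<^bsub>M\<^esub> e i \<ominus>\<^bsub>M\<^esub> r \<odot>\<^bsub>M\<^esub> e i \<in> rspan (J \<union> e ` {..<n})"
          by (intro subsetD[OF rspan_incl] UnI1)
        have "e i \<in> rspan (J \<union> e ` {..<n})"
          using i by (intro subsetD[OF rspan_incl] UnI2 imageI) simp
        then have 2: "r \<odot>\<^bsub>M\<^esub> e i \<in> rspan (J \<union> e ` {..<n})" by (rule submodule_smult[OF sub r(1)])
        have "(x \<otimes>\<^bsub>M\<^esub> e i \<ominus>\<^bsub>M\<^esub> r \<odot>\<^bsub>M\<^esub> e i) \<oplus>\<^bsub>M\<^esub> r \<odot>\<^bsub>M\<^esub> e i = x \<otimes>\<^bsub>M\<^esub> e i"
          using xe by (simp add: a_minus_def M.a_assoc M.l_neg)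
        then show ?thesis using submodule_add[OF sub 1 2] by simp
      qed
      then have "(\<Oplus>\<^bsub>M\<^esub>i\<in>{..<n}. x \<otimes>\<^bsub>M\<^esub> e i) \<in> rspan (J \<union> e ` {..<n})"
        by (intro submodule_finsum[OF sub]) auto
      moreover have "x \<otimes>\<^bsub>M\<^esub> (\<Oplus>\<^bsub>M\<^esub>i\<in>{..<n}. e i) = (\<Oplus>\<^bsub>M\<^esub>i\<in>{..<n}. x \<otimes>\<^bsub>M\<^esub> e i)"
        by (rule finsum_rdistr) (use x e(1) in auto)
      ultimately show "x \<in> rspan (J \<union> e ` {..<n})" using x e_sum by simp
    qed
    show "(\<Oplus>\<^bsub>M\<^esub>v\<in>{..<n}. e v) = \<one>\<^bsub>M\<^esub>" by (rule e_sum)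
    show "e v \<otimes>\<^bsub>M\<^esub> e w = (if v = w then e v else \<zero>\<^bsub>M\<^esub>)" if "v \<in> {..<n}" "w \<in> {..<n}" for v w
      using ef(2) that by simp
    show "e v \<in> carrier M" if "v \<in> {..<n}" for v using e(1) that by simp
  qed (use R J quasi in simp_all)
  then show ?thesis unfolding J_def by blast
qed

text \<open>Vertices and arrows of a finite quiver can be numbered, which fixes the type of
  \<open>Q\<close> independently of the types of \<open>R\<close> and
  \<open>\<Gamma>\<close>.\<close>

theorem theorem1p1:
  fixes R :: "('r, 'm) ring_scheme" and \<mm> :: "'r set" and \<Gamma> :: "('r, 'g, 'n) module_scheme"
  assumes "cring R" and "noetherian_ring R" and "local_ring R \<mm>"
    and "assoc_algebra R \<Gamma>"
    and "semiperfect \<Gamma>" and "module_finite R \<Gamma>" and "elementary R \<mm> \<Gamma>"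
  shows "\<exists>(Q :: (nat, nat) pre_digraph) I.
    fin_digraph Q \<and> ideal I (path_algebra R Q) \<and>
    permissible R Q I \<and> arrow_radical R Q I \<and> arrow_distinct R Q I \<and>
    algebra_isomorphic R \<Gamma> (quot_algebra (path_algebra R Q) I)"
proof -
  interpret assoc_algebra R \<Gamma> by fact
  obtain n and e :: "nat \<Rightarrow> 'g" where "split_algebra R \<Gamma> \<mm> (jacobson_radical \<Gamma>) {..<n} e"
    using exists_split_algebra[OF assms(2,3,5-7)] by blast
  then obtain E :: "nat set" and \<beta> hd tl
    where "arrow_algebra R \<Gamma> \<mm> (jacobson_radical \<Gamma>) {..<n} e E \<beta> hd tl"
    using split_algebra.exists_arrows by blast
  then interpret A: arrow_algebra R \<Gamma> \<mm> "jacobson_radical \<Gamma>" "{..<n}" e E \<beta> hd tl .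
  show ?thesis using A.quiver_presentation A.fin_digraph_quiver by blast
qed

end
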